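(* Let $H$ be a fixed finite simple graph containing at least one cycle, and let $d^*$ be its maximum $1$-density (so $d^*>1$). For $n$ divisible by $v_H$, equip the edges of the complete graph $K_n$ with i.i.d. edge weights that are either uniform on $[0,1]$ or exponential $\mathrm{Exp}(1)$, and let the random variable $F_H=F_H(n)$ be the minimum weight of an $H$-factor on $K_n$. Then there exists a deterministic sequence $M=M(n)=\Theta(n^{1-1/d^*})$ such that $$|F_H-M|=O_{\mathbb{P}}(M^{3/4})\quad\text{as } n\to\infty$$ (along multiples of $v_H$).
   Context: For a graph $G$, $v_G$ and $e_G$ denote its numbers of vertices and edges. For $v_G\ge 2$ the ($1$-)density of $G$ is $d_G:=e_G/(v_G-1)$, and the maximum $1$-density of $H$ is $d^*:=\max\{d_G: G\subseteq H,\ v_G\ge 2\}$. An $H$-factor on $K_n$ is a collection of pairwise vertex-disjoint subgraphs of $K_n$ (not necessarily induced), each isomorphic to $H$, which together cover all $n$ vertices. Its weight is the sum of the weights of all edges of all the copies of $H$ in it. For random variables $X_n,Y_n$ (possibly deterministic), $X_n=O_{\mathbb{P}}(Y_n)$ means: for every $\varepsilon>0$ there is $C=C(\varepsilon)$ such that $\mathbb{P}(|X_n|>C|Y_n|)<\varepsilon$ for all sufficiently large $n$. *)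

theory Defs
  imports "HOL-Probability.Probability" "HOL-Library.Landau_Symbols"
begin

text \<open>A graph is a pair of a vertex set and a set of two-element sets of vertices.\<close>

type_synonym 'a ugraph = "'a set \<times> 'a set set"

abbreviation verts :: "'a ugraph \<Rightarrow> 'a set" where
  "verts G \<equiv> fst G"

abbreviation edges :: "'a ugraph \<Rightarrow> 'a set set" where
  "edges G \<equiv> snd G"

definition simple_graph :: "'a ugraph \<Rightarrow> bool" where
  "simple_graph G \<longleftrightarrow> finite (verts G) \<and> (\<forall>e\<in>edges G. e \<subseteq> verts G \<and> card e = 2)"

text \<open>Subgraphs are not necessarily induced.\<close>

definition is_subgraph :: "'a ugraph \<Rightarrow> 'a ugraph \<Rightarrow> bool" where
  "is_subgraph G H \<longleftrightarrow> simple_graph G \<and> verts G \<subseteq> verts H \<and> edges G \<subseteq> edges H"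

definition graph_isomorphic :: "'a ugraph \<Rightarrow> 'b ugraph \<Rightarrow> bool" where
  "graph_isomorphic G H \<longleftrightarrow>
     (\<exists>f. bij_betw f (verts G) (verts H) \<and> edges H = (\<lambda>e. f ` e) ` edges G)"

definition has_cycle :: "'a ugraph \<Rightarrow> bool" where
  "has_cycle G \<longleftrightarrow>
     (\<exists>vs. length vs \<ge> 3 \<and> distinct vs \<and> set vs \<subseteq> verts G \<and>
        (\<forall>i<length vs. {vs ! i, vs ! (Suc i mod length vs)} \<in> edges G))"

definition density1 :: "'a ugraph \<Rightarrow> real" where
  "density1 G = real (card (edges G)) / (real (card (verts G)) - 1)"

definition max_density1 :: "'a ugraph \<Rightarrow> real" where
  "max_density1 H = Max {density1 G | G. is_subgraph G H \<and> card (verts G) \<ge> 2}"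

definition complete_graph :: "nat \<Rightarrow> nat ugraph" where
  "complete_graph n = ({..<n}, {e. e \<subseteq> {..<n} \<and> card e = 2})"

definition is_factor :: "'a ugraph \<Rightarrow> nat \<Rightarrow> nat ugraph set \<Rightarrow> bool" where
  "is_factor H n \<F> \<longleftrightarrow>
     (\<forall>S\<in>\<F>. is_subgraph S (complete_graph n) \<and> graph_isomorphic H S) \<and>
     pairwise (\<lambda>S T. verts S \<inter> verts T = {}) \<F> \<and>
     (\<Union>S\<in>\<F>. verts S) = verts (complete_graph n)"

definition factor_weight :: "(nat set \<Rightarrow> real) \<Rightarrow> nat ugraph set \<Rightarrow> real" where
  "factor_weight w \<F> = (\<Sum>S\<in>\<F>. \<Sum>e\<in>edges S. w e)"

text \<open>The minimum is over a finite set, nonempty if the number of vertices of \<open>H\<close> divides \<open>n\<close>.\<close>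

definition min_factor_weight :: "'a ugraph \<Rightarrow> nat \<Rightarrow> (nat set \<Rightarrow> real) \<Rightarrow> real" where
  "min_factor_weight H n w = Min (factor_weight w ` {\<F>. is_factor H n \<F>})"

text \<open>The filter \<open>n \<rightarrow> \<infinity>\<close> along the multiples of \<open>k\<close>.\<close>

definition multiples_at_top :: "nat \<Rightarrow> nat filter" where
  "multiples_at_top k = inf at_top (principal {n. k dvd n})"

text \<open>\<open>X\<^sub>n = O\<^sub>\<bbbP>(Y\<^sub>n)\<close> along the filter \<open>F\<close>, where \<open>X\<^sub>n\<close> and \<open>Y\<^sub>n\<close> live on the
  probability space \<open>P n\<close>.\<close>

definition bigo_in_prob ::
  "nat filter \<Rightarrow> (nat \<Rightarrow> 'w measure) \<Rightarrow> (nat \<Rightarrow> 'w \<Rightarrow> real) \<Rightarrow> (nat \<Rightarrow> 'w \<Rightarrow> real) \<Rightarrow> bool" where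
  "bigo_in_prob F P X Y \<longleftrightarrow>
     (\<forall>\<epsilon>>0. \<exists>C. \<forall>\<^sub>F n in F.
        measure (P n) {\<omega> \<in> space (P n). \<bar>X n \<omega>\<bar> > C * \<bar>Y n \<omega>\<bar>} < \<epsilon>)"

end

theory Submission
  imports Defs "HOL-Real_Asymp.Real_Asymp"
begin

text \<open>
  Let \<open>d\<close> be the maximum 1-density of \<open>H\<close>, let \<open>v\<close> and \<open>m\<close> be its numbers of vertices and edges, and put
  \<open>a = 1 - 1 / d\<close>; then \<open>0 < a < 1\<close>, because a cycle of length \<open>l\<close> has 1-density \<open>l / (l - 1) > 1\<close>.

  \<^emph>\<open>Light copies are everywhere.\<close> Fix a small \<open>\<delta> > 0\<close>. With high probability, for all
  \<open>k \<ge> n powr (a / 4)\<close> at once, every set of \<open>k\<close> vertices contains a copy of \<open>H\<close> all of whose edges weigh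
  at most \<open>C (n / k) powr \<delta> * k powr (- 1 / d)\<close>. For a single set this is Janson's inequality
  (\<open>janson_inequality\<close>, \<open>no_copy_janson\<close>): at edge probability \<open>p = x k powr (- 1 / d)\<close> with \<open>x \<ge> 1\<close> every
  subgraph of \<open>H\<close> with at least one edge has expected count of order at least \<open>x k\<close>, so the failure
  probability is \<open>exp (- \<Omega>(x k))\<close>. Taking \<open>x\<close> of order \<open>(n / k) powr \<delta>\<close> beats the number of sets of \<open>k\<close>
  vertices (\<open>light_copy_everywhere_prob\<close>).

  \<^emph>\<open>Upper bound.\<close> Removing light copies greedily covers any set of \<open>r\<close> vertices, \<open>v\<close> dividing \<open>r\<close>, at cost
  \<open>O(n powr \<delta> * r powr (a - \<delta>) + n powr (3a/4))\<close>; the second term pays for the last \<open>n powr (a / 4)\<close>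
  vertices, which are covered by arbitrary copies (\<open>greedy_factor\<close>, \<open>good_patch\<close>). For \<open>r = n\<close> this is
  \<open>O(n powr a)\<close>.

  \<^emph>\<open>Concentration.\<close> Truncate all weights at \<open>t = n powr (3a/4 - 1/2)\<close>. Resampling the edges at one vertex
  changes the truncated minimum by at most \<open>m t\<close>, since a factor has only one copy at that vertex;
  exposing the vertices one by one bounds the variance by
  \<open>n (m t)\<^sup>2 = m\<^sup>2 n powr (3a/2)\<close> (\<open>second_moment_bounded_differences\<close>). On the other hand a factor that
  is optimal for the truncated weights has only \<open>O(n powr a / t)\<close> copies with an edge heavier than \<open>t\<close>.
  Their vertices form a set on which nothing is known, but the greedy cover works for every set,
  and its cost there is \<open>O(n powr (3a/4))\<close> (\<open>good_le_truncated\<close>). Hence the minimum weight differs from the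
  mean \<open>M\<close> of the truncated minimum by \<open>O(n powr (3a/4))\<close> in probability.

  \<^emph>\<open>Lower bound.\<close> A factor of weight less than \<open>c n powr a\<close> contains at least \<open>n / (2 v)\<close> copies of the
  densest subgraph of \<open>H\<close> with all edges of weight \<open>O(n powr (- 1 / d))\<close>. For a suitable constant \<open>c\<close> the
  expected number of such copies in the complete graph is at most a quarter of that (\<open>lower_event\<close>), so the minimum weight is at least
  \<open>c n powr a\<close> with probability at least 3/4. By concentration this forces
  \<open>M = \<Omega>(n powr a)\<close>, and \<open>M powr (3/4)\<close> has the order of the error \<open>n powr (3a/4)\<close>.
\<close>

section \<open>Bernoulli random subsets and the Janson inequality\<close>

text \<open>
  The expectation of \<open>f\<close> on the random subset of \<open>E\<close> that contains each element independently with
  probability \<open>p\<close>. A finite sum, rather than an integral, makes both the induction on \<open>E\<close> and the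
  differentiation under the expectation immediate.
\<close>

definition bern_sum :: "'e set \<Rightarrow> real \<Rightarrow> ('e set \<Rightarrow> real) \<Rightarrow> real" where
  "bern_sum E p f = (\<Sum>S\<in>Pow E. p ^ card S * (1 - p) ^ card (E - S) * f S)"

lemma bern_sum_empty [simp]: "bern_sum {} p f = f {}"
  by (simp add: bern_sum_def)

lemma bern_sum_insert:
  assumes "finite E" "x \<notin> E"
  shows "bern_sum (insert x E) p f =
    p * bern_sum E p (\<lambda>S. f (insert x S)) + (1 - p) * bern_sum E p f"
proof -
  have inj: "inj_on (insert x) (Pow E)"
    using assms(2) by (auto simp: inj_on_def)
  have "bern_sum (insert x E) p f =
      (\<Sum>S\<in>Pow E. p ^ card S * (1 - p) ^ card (insert x E - S) * f S) +
      (\<Sum>S\<in>insert x ` Pow E. p ^ card S * (1 - p) ^ card (insert x E - S) * f S)"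
    unfolding bern_sum_def Pow_insert
    by (rule sum.union_disjoint) (use assms in auto)
  also have "(\<Sum>S\<in>Pow E. p ^ card S * (1 - p) ^ card (insert x E - S) * f S) =
      (1 - p) * bern_sum E p f"
    unfolding bern_sum_def sum_distrib_left
  proof (rule sum.cong[OF refl])
    fix S assume S: "S \<in> Pow E"
    then have "insert x E - S = insert x (E - S)" "x \<notin> E - S" using assms by auto
    then have "card (insert x E - S) = Suc (card (E - S))" using assms by simp
    then show "p ^ card S * (1 - p) ^ card (insert x E - S) * f S =
      (1 - p) * (p ^ card S * (1 - p) ^ card (E - S) * f S)" by simp
  qed
  also have "(\<Sum>S\<in>insert x ` Pow E. p ^ card S * (1 - p) ^ card (insert x E - S) * f S) =
      p * bern_sum E p (\<lambda>S. f (insert x S))"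
    unfolding bern_sum_def sum_distrib_left sum.reindex[OF inj] o_def
  proof (rule sum.cong[OF refl])
    fix S assume S: "S \<in> Pow E"
    then have "insert x E - insert x S = E - S" "x \<notin> S" "finite S"
      using assms by (auto intro: finite_subset)
    then show "p ^ card (insert x S) * (1 - p) ^ card (insert x E - insert x S) * f (insert x S) =
      p * (p ^ card S * (1 - p) ^ card (E - S) * f (insert x S))" by simp
  qed
  finally show ?thesis by simp
qed

lemma bern_sum_cong:
  "(\<And>S. S \<subseteq> E \<Longrightarrow> f S = g S) \<Longrightarrow> bern_sum E p f = bern_sum E p g"
  unfolding bern_sum_def by (intro sum.cong) auto

lemma bern_sum_const:
  assumes "finite E" shows "bern_sum E p (\<lambda>_. c) = c"
  using assms by (induction E rule: finite_induct) (auto simp: bern_sum_insert algebra_simps)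

lemma bern_sum_mono:
  assumes "0 \<le> p" "p \<le> 1" "\<And>S. S \<subseteq> E \<Longrightarrow> f S \<le> g S"
  shows "bern_sum E p f \<le> bern_sum E p g"
  unfolding bern_sum_def using assms by (intro sum_mono mult_left_mono) auto

lemma bern_sum_nonneg:
  assumes "0 \<le> p" "p \<le> 1" "\<And>S. S \<subseteq> E \<Longrightarrow> 0 \<le> f S"
  shows "0 \<le> bern_sum E p f"
  unfolding bern_sum_def using assms by (intro sum_nonneg) auto

lemma bern_sum_cmult: "bern_sum E p (\<lambda>S. c * f S) = c * bern_sum E p f"
  unfolding bern_sum_def sum_distrib_left by (intro sum.cong) auto

lemma bern_sum_diff: "bern_sum E p (\<lambda>S. f S - g S) = bern_sum E p f - bern_sum E p g"
  unfolding bern_sum_def by (simp add: algebra_simps sum_subtractf)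

lemma bern_sum_sum: "bern_sum E p (\<lambda>S. \<Sum>i\<in>I. f i S) = (\<Sum>i\<in>I. bern_sum E p (f i))"
  unfolding bern_sum_def sum_distrib_left by (rule sum.swap)

text \<open>
  Conditioning on the event that the random set contains \<open>A\<close>: the elements outside \<open>A\<close> keep their
  distribution, so the conditional expectation of \<open>g S\<close> is the expectation of \<open>g (S \<union> A)\<close>.
\<close>

lemma bern_sum_superset:
  assumes "finite E" "finite A" "A \<subseteq> E"
  shows "bern_sum E p (\<lambda>S. if A \<subseteq> S then g S else 0) = p ^ card A * bern_sum E p (\<lambda>S. g (S \<union> A))"
  using assms(2,3)
proof (induction A arbitrary: g rule: finite_induct)
  case empty
  then show ?case by simp
next
  case (insert x A)
  have single: "bern_sum E p (\<lambda>S. if x \<in> S then h S else 0) = p * bern_sum E p (\<lambda>S. h (insert x S))" for h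
  proof -
    have E: "E = insert x (E - {x})" using insert by auto
    have fin: "finite (E - {x})" "x \<notin> E - {x}" using assms(1) by auto
    have "bern_sum (insert x (E - {x})) p (\<lambda>S. if x \<in> S then h S else 0) =
        p * bern_sum (E - {x}) p (\<lambda>S. h (insert x S))
        + (1 - p) * bern_sum (E - {x}) p (\<lambda>S. if x \<in> S then h S else 0)"
      by (subst bern_sum_insert[OF fin]) simp
    also have "bern_sum (E - {x}) p (\<lambda>S. if x \<in> S then h S else 0) = bern_sum (E - {x}) p (\<lambda>_. 0)"
      by (rule bern_sum_cong) auto
    also have "\<dots> = 0" using fin by (simp add: bern_sum_const)
    finally have 1: "bern_sum E p (\<lambda>S. if x \<in> S then h S else 0) =
        p * bern_sum (E - {x}) p (\<lambda>S. h (insert x S))" using E by simp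
    have "bern_sum (insert x (E - {x})) p (\<lambda>S. h (insert x S)) =
        bern_sum (E - {x}) p (\<lambda>S. h (insert x S))"
      by (subst bern_sum_insert[OF fin]) (simp add: algebra_simps)
    then show ?thesis using 1 E by simp
  qed
  have "bern_sum E p (\<lambda>S. if insert x A \<subseteq> S then g S else 0) =
      bern_sum E p (\<lambda>S. if x \<in> S then (if A \<subseteq> S then g S else 0) else 0)"
    by (rule bern_sum_cong) auto
  also have "\<dots> = p * bern_sum E p (\<lambda>S. if A \<subseteq> insert x S then g (insert x S) else 0)"
    by (rule single)
  also have "bern_sum E p (\<lambda>S. if A \<subseteq> insert x S then g (insert x S) else 0) =
      bern_sum E p (\<lambda>S. if A \<subseteq> S then g (insert x S) else 0)"
    using insert by (intro bern_sum_cong) auto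
  also have "\<dots> = p ^ card A * bern_sum E p (\<lambda>S. g (insert x (S \<union> A)))"
    using insert by (intro insert.IH) auto
  finally show ?case using insert by simp
qed

text \<open>
  Harris' inequality. By induction on the ground set, the claim for \<open>insert x E\<close> reduces to the
  two-point inequality \<open>p (1 - p) (F\<^sub>0 - F\<^sub>1) (G\<^sub>0 - G\<^sub>1) \<ge> 0\<close>, where the index tells whether \<open>x\<close> is
  present.
\<close>

lemma harris_decreasing:
  assumes "finite E" "0 \<le> p" "p \<le> 1"
    and "\<And>S T. S \<subseteq> T \<Longrightarrow> T \<subseteq> E \<Longrightarrow> f T \<le> f S"
    and "\<And>S T. S \<subseteq> T \<Longrightarrow> T \<subseteq> E \<Longrightarrow> g T \<le> g S"
  shows "bern_sum E p f * bern_sum E p g \<le> bern_sum E p (\<lambda>S. f S * g S)"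
  using assms(1,4,5)
proof (induction E arbitrary: f g rule: finite_induct)
  case empty
  then show ?case by simp
next
  case (insert x E)
  define F1 F0 G1 G0 where "F1 = bern_sum E p (\<lambda>S. f (insert x S))" and "F0 = bern_sum E p f"
    and "G1 = bern_sum E p (\<lambda>S. g (insert x S))" and "G0 = bern_sum E p g"
  have i1: "F1 * G1 \<le> bern_sum E p (\<lambda>S. f (insert x S) * g (insert x S))"
    unfolding F1_def G1_def by (rule insert.IH; rule insert.prems) auto
  have i0: "F0 * G0 \<le> bern_sum E p (\<lambda>S. f S * g S)"
    unfolding F0_def G0_def by (rule insert.IH; rule insert.prems) auto
  have le: "F1 \<le> F0" "G1 \<le> G0"
    unfolding F1_def F0_def G1_def G0_def
    using assms(2,3) by (intro bern_sum_mono insert.prems; auto)+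
  have "0 \<le> p * (1 - p) * ((F0 - F1) * (G0 - G1))"
    using assms(2,3) le by simp
  then have "(p * F1 + (1 - p) * F0) * (p * G1 + (1 - p) * G0) \<le>
      p * (F1 * G1) + (1 - p) * (F0 * G0)"
    by (simp add: algebra_simps)
  also have "\<dots> \<le> p * bern_sum E p (\<lambda>S. f (insert x S) * g (insert x S)) +
      (1 - p) * bern_sum E p (\<lambda>S. f S * g S)"
    using assms(2,3) i1 i0 by (intro add_mono mult_left_mono) auto
  finally show ?case
    using insert(1,2) by (simp add: bern_sum_insert F1_def F0_def G1_def G0_def)
qed

text \<open>
  The right-hand side is the negative of the derivative of the Laplace transform
  \<open>\<psi> t = E (exp (- t X))\<close> of the number \<open>X\<close> of sets \<open>A i\<close> that are present. It is a sum over \<open>i\<close> of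
  expectations restricted to the event that \<open>A i\<close> is present. Under this conditioning the sets
  disjoint from \<open>A i\<close> behave as before and contribute at least \<open>\<psi> t\<close>, the sets meeting \<open>A i\<close> contribute at
  least \<open>1 - t E (X\<^sub>1)\<close>, and Harris' inequality separates the two factors.
\<close>

lemma laplace_derivative_bound:
  fixes A :: "'i \<Rightarrow> 'e set" and I :: "'i set"
  defines "X \<equiv> \<lambda>S::'e set. \<Sum>i\<in>I. if A i \<subseteq> S then 1 else (0::real)"
  assumes fin: "finite E" "finite I" and A: "\<And>i. i \<in> I \<Longrightarrow> A i \<subseteq> E"
    and p: "0 \<le> p" "p \<le> 1" and t: "0 \<le> t"
  shows "((\<Sum>i\<in>I. p ^ card (A i)) - t * (\<Sum>i\<in>I. \<Sum>j\<in>{j\<in>I. A i \<inter> A j \<noteq> {}}. p ^ card (A i \<union> A j)))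
      * bern_sum E p (\<lambda>S. exp (- t * X S))
    \<le> bern_sum E p (\<lambda>S. X S * exp (- t * X S))"
proof -
  define \<psi> where "\<psi> = bern_sum E p (\<lambda>S. exp (- t * X S))"
  have \<psi>: "0 \<le> \<psi>" unfolding \<psi>_def using p by (intro bern_sum_nonneg) auto
  have finA: "finite (A i)" if "i \<in> I" for i using A[OF that] fin(1) by (rule finite_subset)
  have conditioned: "(p ^ card (A i) - t * (\<Sum>j\<in>{j\<in>I. A i \<inter> A j \<noteq> {}}. p ^ card (A i \<union> A j))) * \<psi>
      \<le> bern_sum E p (\<lambda>S. if A i \<subseteq> S then exp (- t * X S) else 0)" if i: "i \<in> I" for i
  proof -
    define J where "J = {j\<in>I. A i \<inter> A j \<noteq> {}}"
    have J: "finite J" "J \<subseteq> I" using fin by (auto simp: J_def)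
    \<comment> \<open>\<open>X1\<close> counts the sets that meet \<open>A i\<close>, given that \<open>A i\<close> is present; \<open>X2\<close> counts the others.\<close>
    define X1 where "X1 = (\<lambda>S. \<Sum>j\<in>J. if A j - A i \<subseteq> S then 1 else (0::real))"
    define X2 where "X2 = (\<lambda>S. \<Sum>j\<in>I - J. if A j \<subseteq> S then 1 else (0::real))"
    have X1_mono: "X1 S \<le> X1 T" if "S \<subseteq> T" for S T
      unfolding X1_def using that by (intro sum_mono) auto
    have X2_mono: "X2 S \<le> X2 T" if "S \<subseteq> T" for S T
      unfolding X2_def using that by (intro sum_mono) auto
    have split: "X (S \<union> A i) = X1 S + X2 S" for S
    proof -
      have "X (S \<union> A i) = (\<Sum>j\<in>I - J. if A j \<subseteq> S \<union> A i then 1 else 0) +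
          (\<Sum>j\<in>J. if A j \<subseteq> S \<union> A i then 1 else 0)"
        unfolding X_def using J fin by (intro sum.subset_diff) auto
      also have "(\<Sum>j\<in>I - J. if A j \<subseteq> S \<union> A i then 1 else 0) = X2 S"
        unfolding X2_def by (intro sum.cong) (auto simp: J_def)
      also have "(\<Sum>j\<in>J. if A j \<subseteq> S \<union> A i then 1 else 0) = X1 S"
        unfolding X1_def by (intro sum.cong) auto
      finally show ?thesis by simp
    qed
    have X2_le: "X2 S \<le> X S" for S
      unfolding X2_def X_def using fin by (intro sum_mono2) auto
    have "(1 - t * (\<Sum>j\<in>J. p ^ card (A j - A i))) * \<psi> \<le>
        bern_sum E p (\<lambda>S. exp (- t * X1 S)) * bern_sum E p (\<lambda>S. exp (- t * X2 S))"
    proof -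
      have "(1 - t * (\<Sum>j\<in>J. p ^ card (A j - A i))) = bern_sum E p (\<lambda>S. 1 - t * X1 S)"
      proof -
        have "bern_sum E p (\<lambda>S. if A j - A i \<subseteq> S then 1 else 0) = p ^ card (A j - A i)"
          if "j \<in> J" for j
        proof -
          have "A j - A i \<subseteq> E" "finite (A j - A i)" using that J A finA by auto
          then show ?thesis using bern_sum_superset[of E "A j - A i" p "\<lambda>_. 1"] fin
            by (simp add: bern_sum_const)
        qed
        then show ?thesis
          by (simp add: bern_sum_diff bern_sum_cmult bern_sum_const fin X1_def bern_sum_sum)
      qed
      also have "\<dots> \<le> bern_sum E p (\<lambda>S. exp (- t * X1 S))"
        using p exp_ge_add_one_self[of "- t * X1 _"] by (intro bern_sum_mono) (auto simp: algebra_simps)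
      finally have 1: "(1 - t * (\<Sum>j\<in>J. p ^ card (A j - A i))) \<le> bern_sum E p (\<lambda>S. exp (- t * X1 S))" .
      have 2: "\<psi> \<le> bern_sum E p (\<lambda>S. exp (- t * X2 S))"
        unfolding \<psi>_def using p t X2_le by (intro bern_sum_mono) (auto intro: mult_left_mono)
      have "(1 - t * (\<Sum>j\<in>J. p ^ card (A j - A i))) * \<psi> \<le> bern_sum E p (\<lambda>S. exp (- t * X1 S)) * \<psi>"
        using 1 \<psi> by (rule mult_right_mono)
      also have "\<dots> \<le> bern_sum E p (\<lambda>S. exp (- t * X1 S)) * bern_sum E p (\<lambda>S. exp (- t * X2 S))"
        using 2 p by (intro mult_left_mono bern_sum_nonneg) auto
      finally show ?thesis .
    qed
    also have "\<dots> \<le> bern_sum E p (\<lambda>S. exp (- t * X1 S) * exp (- t * X2 S))"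
      using fin p t X1_mono X2_mono by (intro harris_decreasing) (auto intro: mult_left_mono)
    also have "\<dots> = bern_sum E p (\<lambda>S. exp (- t * X (S \<union> A i)))"
      by (simp add: split exp_add[symmetric] algebra_simps)
    finally have "p ^ card (A i) * ((1 - t * (\<Sum>j\<in>J. p ^ card (A j - A i))) * \<psi>) \<le>
       p ^ card (A i) * bern_sum E p (\<lambda>S. exp (- t * X (S \<union> A i)))"
      using p by (intro mult_left_mono) auto
    also have "\<dots> = bern_sum E p (\<lambda>S. if A i \<subseteq> S then exp (- t * X S) else 0)"
      using bern_sum_superset[OF fin(1) finA[OF i] A[OF i]] by simp
    also have "p ^ card (A i) * ((1 - t * (\<Sum>j\<in>J. p ^ card (A j - A i))) * \<psi>) =
        (p ^ card (A i) - t * (\<Sum>j\<in>J. p ^ card (A i \<union> A j))) * \<psi>"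
    proof -
      have "p ^ card (A i \<union> A j) = p ^ card (A i) * p ^ card (A j - A i)" if "j \<in> J" for j
      proof -
        have "A i \<union> A j = A i \<union> (A j - A i)" by auto
        then have "card (A i \<union> A j) = card (A i) + card (A j - A i)"
          using finA i that J by (metis Diff_disjoint card_Un_disjoint finite_Diff subsetD)
        then show ?thesis by (simp add: power_add)
      qed
      then have "(\<Sum>j\<in>J. p ^ card (A i \<union> A j)) = p ^ card (A i) * (\<Sum>j\<in>J. p ^ card (A j - A i))"
        by (simp add: sum_distrib_left)
      then show ?thesis by (simp add: algebra_simps)
    qed
    finally show ?thesis unfolding J_def .
  qed
  have "((\<Sum>i\<in>I. p ^ card (A i)) - t * (\<Sum>i\<in>I. \<Sum>j\<in>{j\<in>I. A i \<inter> A j \<noteq> {}}. p ^ card (A i \<union> A j))) * \<psi>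
     = (\<Sum>i\<in>I. (p ^ card (A i) - t * (\<Sum>j\<in>{j\<in>I. A i \<inter> A j \<noteq> {}}. p ^ card (A i \<union> A j))) * \<psi>)"
    by (simp add: sum_distrib_right sum_distrib_left sum_subtractf algebra_simps)
  also have "\<dots> \<le> (\<Sum>i\<in>I. bern_sum E p (\<lambda>S. if A i \<subseteq> S then exp (- t * X S) else 0))"
    by (intro sum_mono conditioned)
  also have "\<dots> = bern_sum E p (\<lambda>S. \<Sum>i\<in>I. if A i \<subseteq> S then exp (- t * X S) else 0)"
    by (simp add: bern_sum_sum)
  also have "\<dots> = bern_sum E p (\<lambda>S. X S * exp (- t * X S))"
    by (rule bern_sum_cong) (auto simp: X_def sum_distrib_right intro!: sum.cong)
  finally show ?thesis unfolding \<psi>_def .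
qed

text \<open>
  By the previous bound, \<open>\<psi> t exp (\<mu> t - \<Delta> t\<^sup>2 / 2)\<close> is nonincreasing on \<open>t \<ge> 0\<close>, hence at most its
  value 1 at 0. The probability that no \<open>A i\<close> is present is at most \<open>\<psi> t\<close>, and \<open>t = \<mu> / \<Delta>\<close> is the
  optimal choice. Here \<open>\<Delta>\<close> counts ordered pairs and includes the diagonal.
\<close>

lemma janson_inequality:
  fixes A :: "'i \<Rightarrow> 'e set" and I :: "'i set"
  assumes fin: "finite E" "finite I" and A: "\<And>i. i \<in> I \<Longrightarrow> A i \<subseteq> E"
    and p: "0 \<le> p" "p \<le> 1"
    and \<mu>: "\<mu> = (\<Sum>i\<in>I. p ^ card (A i))"
    and \<Delta>: "(\<Sum>i\<in>I. \<Sum>j\<in>{j\<in>I. A i \<inter> A j \<noteq> {}}. p ^ card (A i \<union> A j)) \<le> \<Delta>" "0 < \<Delta>"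
  shows "bern_sum E p (\<lambda>S. if \<exists>i\<in>I. A i \<subseteq> S then 0 else 1) \<le> exp (- (\<mu>\<^sup>2 / (2 * \<Delta>)))"
proof -
  define X where "X = (\<lambda>S::'e set. \<Sum>i\<in>I. if A i \<subseteq> S then 1 else (0::real))"
  define \<psi> where "\<psi> = (\<lambda>t. bern_sum E p (\<lambda>S. exp (- t * X S)))"
  define h where "h = (\<lambda>t. \<psi> t * exp (\<mu> * t - \<Delta> * t\<^sup>2 / 2))"
  have \<psi>: "0 \<le> \<psi> t" for t unfolding \<psi>_def using p by (intro bern_sum_nonneg) auto
  have deriv_\<psi>: "(\<psi> has_real_derivative - bern_sum E p (\<lambda>S. X S * exp (- t * X S))) (at t)" for t
    unfolding \<psi>_def bern_sum_def
    by (auto intro!: derivative_eq_intros simp: sum_negf[symmetric] algebra_simps intro!: sum.cong)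
  have bound: "(\<mu> - t * \<Delta>) * \<psi> t \<le> bern_sum E p (\<lambda>S. X S * exp (- t * X S))" if "0 \<le> t" for t
  proof -
    have "(\<mu> - t * \<Delta>) * \<psi> t \<le> (\<mu> - t * (\<Sum>i\<in>I. \<Sum>j\<in>{j\<in>I. A i \<inter> A j \<noteq> {}}. p ^ card (A i \<union> A j))) * \<psi> t"
      using \<psi>[of t] \<Delta> that by (intro mult_right_mono diff_left_mono mult_left_mono) auto
    also have "\<dots> \<le> bern_sum E p (\<lambda>S. X S * exp (- t * X S))"
      unfolding \<mu> \<psi>_def X_def
      by (rule laplace_derivative_bound) (use fin A p that in auto)
    finally show ?thesis .
  qed
  have deriv_h: "(h has_real_derivative
      ((\<mu> - t * \<Delta>) * \<psi> t - bern_sum E p (\<lambda>S. X S * exp (- t * X S))) * exp (\<mu> * t - \<Delta> * t\<^sup>2 / 2)) (at t)" for t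
    unfolding h_def
    by (rule derivative_eq_intros deriv_\<psi> refl | simp)+ (simp add: algebra_simps)
  define s where "s = \<mu> / \<Delta>"
  have "0 \<le> \<mu>" unfolding \<mu> using p by (intro sum_nonneg) auto
  then have s: "0 \<le> s" using \<Delta> by (simp add: s_def)
  have "h s \<le> h 0"
  proof (rule DERIV_nonpos_imp_nonincreasing[OF s])
    fix t assume "0 \<le> t" "t \<le> s"
    then show "\<exists>y. DERIV h t :> y \<and> y \<le> 0"
      using deriv_h[of t] bound[of t] by (intro exI conjI) (auto intro!: mult_nonpos_nonneg)
  qed
  moreover have "h 0 = 1" using fin by (simp add: h_def \<psi>_def bern_sum_const)
  moreover have "\<mu> * s - \<Delta> * s\<^sup>2 / 2 = \<mu>\<^sup>2 / (2 * \<Delta>)"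
    using \<Delta>(2) by (simp add: s_def field_simps power2_eq_square)
  ultimately have "\<psi> s * exp (\<mu>\<^sup>2 / (2 * \<Delta>)) \<le> 1"
    by (simp add: h_def)
  then have "\<psi> s \<le> exp (- (\<mu>\<^sup>2 / (2 * \<Delta>)))"
    by (simp add: exp_minus field_simps)
  moreover have "bern_sum E p (\<lambda>S. if \<exists>i\<in>I. A i \<subseteq> S then 0 else 1) \<le> \<psi> s"
    unfolding \<psi>_def
  proof (rule bern_sum_mono[OF p])
    fix S assume "S \<subseteq> E"
    show "(if \<exists>i\<in>I. A i \<subseteq> S then 0 else 1) \<le> exp (- s * X S)"
    proof (cases "\<exists>i\<in>I. A i \<subseteq> S")
      case False
      then have "X S = 0" unfolding X_def by (intro sum.neutral) auto
      then show ?thesis using False by simp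
    qed simp
  qed
  ultimately show ?thesis by linarith
qed

section \<open>Product measures\<close>

lemma measure_PiM_sublevel_superset:
  fixes D :: "real measure"
  assumes D: "prob_space D" "sets D = sets borel" and fin: "finite E" and A: "A \<subseteq> E"
  shows "measure (PiM E (\<lambda>_. D)) {w \<in> space (PiM E (\<lambda>_. D)). \<forall>e\<in>A. w e \<le> q} = measure D {..q} ^ card A"
proof -
  interpret D: prob_space D by fact
  interpret product_prob_space "\<lambda>_::'a. D" E ..
  interpret finite_product_prob_space "\<lambda>_::'a. D" E by standard fact
  have sp: "space D = UNIV" using D(2) by (metis sets_eq_imp_space_eq space_borel)
  have box_prob: "measure (PiM E (\<lambda>_. D)) (Pi\<^sub>E E F) = (\<Prod>e\<in>E. measure D (F e))"
    if "\<And>e. F e \<in> sets borel" for F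
    using that D(2) by (intro finite_measure_PiM_emb) simp
  have "{w \<in> space (PiM E (\<lambda>_. D)). \<forall>e\<in>A. w e \<le> q} = (\<Pi>\<^sub>E e\<in>E. if e \<in> A then {..q} else UNIV)"
  proof (intro set_eqI)
    fix w
    have "(\<forall>e\<in>E. w e \<in> (if e \<in> A then {..q} else UNIV)) \<longleftrightarrow> (\<forall>e\<in>A. w e \<le> q)"
      using A by (auto split: if_splits)
    then show "w \<in> {w \<in> space (PiM E (\<lambda>_. D)). \<forall>e\<in>A. w e \<le> q} \<longleftrightarrow> w \<in> (\<Pi>\<^sub>E e\<in>E. if e \<in> A then {..q} else UNIV)"
      by (simp add: space_PiM sp PiE_iff conj_commute)
  qed
  then have "measure (PiM E (\<lambda>_. D)) {w \<in> space (PiM E (\<lambda>_. D)). \<forall>e\<in>A. w e \<le> q} =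
      (\<Prod>e\<in>E. measure D (if e \<in> A then {..q} else UNIV))"
    by (simp add: box_prob)
  also have "\<dots> = (\<Prod>e\<in>E. if e \<in> A then measure D {..q} else 1)"
    using D.prob_space by (intro prod.cong) (auto simp: sp)
  also have "\<dots> = measure D {..q} ^ card A"
    using A fin by (simp add: prod.If_cases Int_absorb1)
  finally show ?thesis .
qed

text \<open>
  For independent weights the set of indices with weight at most \<open>q\<close> is a Bernoulli random subset, so
  the finite expectations above compute probabilities in the product measure.
\<close>

lemma measure_PiM_sublevel_set:
  fixes D :: "real measure"
  assumes D: "prob_space D" "sets D = sets borel" and fin: "finite E"
  shows "measure (PiM E (\<lambda>_. D)) {w \<in> space (PiM E (\<lambda>_. D)). Q {e\<in>E. w e \<le> q}} =
    bern_sum E (measure D {..q}) (\<lambda>S. if Q S then 1 else 0)"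
proof -
  interpret D: prob_space D by fact
  interpret product_prob_space "\<lambda>_::'a. D" E ..
  interpret finite_product_prob_space "\<lambda>_::'a. D" E by standard fact
  have sp: "space D = UNIV" using D(2) by (metis sets_eq_imp_space_eq space_borel)
  have box_prob: "measure (PiM E (\<lambda>_. D)) (Pi\<^sub>E E F) = (\<Prod>e\<in>E. measure D (F e))"
    if "\<And>e. F e \<in> sets borel" for F
    using that D(2) by (intro finite_measure_PiM_emb) simp
  define p where "p = measure D {..q}"
  define box where "box = (\<lambda>S. \<Pi>\<^sub>E e\<in>E. if e \<in> S then {..q} else {q<..})"
  have box: "box S = {w \<in> space (PiM E (\<lambda>_. D)). {e\<in>E. w e \<le> q} = S}" if "S \<subseteq> E" for S
  proof (intro set_eqI)
    fix w
    have "(\<forall>e\<in>E. w e \<in> (if e \<in> S then {..q} else {q<..})) \<longleftrightarrow> (\<forall>e\<in>E. (w e \<le> q) = (e \<in> S))"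
      by (intro ball_cong) auto
    also have "\<dots> \<longleftrightarrow> {e\<in>E. w e \<le> q} = S" using that by auto
    finally show "w \<in> box S \<longleftrightarrow> w \<in> {w \<in> space (PiM E (\<lambda>_. D)). {e\<in>E. w e \<le> q} = S}"
      by (simp add: box_def space_PiM sp PiE_iff conj_commute)
  qed
  have box_sets: "box S \<in> sets (PiM E (\<lambda>_. D))" for S
    unfolding box_def using fin D(2) by (intro sets_PiM_I_finite) auto
  have "measure D (space D - {..q}) = 1 - p"
    unfolding p_def by (rule D.prob_compl) (simp add: D(2))
  moreover have "space D - {..q} = {q<..}" by (auto simp: sp)
  ultimately have gt: "measure D {q<..} = 1 - p" by metis
  have box_measure: "measure (PiM E (\<lambda>_. D)) (box S) = p ^ card S * (1 - p) ^ card (E - S)"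
    if S: "S \<subseteq> E" for S
  proof -
    have "measure (PiM E (\<lambda>_. D)) (box S) = (\<Prod>e\<in>E. measure D (if e \<in> S then {..q} else {q<..}))"
      unfolding box_def by (simp add: box_prob)
    also have "\<dots> = (\<Prod>e\<in>E. if e \<in> S then p else 1 - p)"
      by (intro prod.cong) (auto simp: gt p_def)
    also have "\<dots> = p ^ card S * (1 - p) ^ card (E - S)"
    proof -
      have "(\<Prod>e\<in>E. if e \<in> S then p else 1 - p) = (\<Prod>e\<in>S. p) * (\<Prod>e\<in>E - S. 1 - p)"
        using S fin by (simp add: prod.If_cases Int_absorb1 Diff_eq)
      then show ?thesis by simp
    qed
    finally show ?thesis .
  qed
  have "(\<Union>S\<in>{S\<in>Pow E. Q S}. box S) =
      (\<Union>S\<in>{S\<in>Pow E. Q S}. {w \<in> space (PiM E (\<lambda>_. D)). {e\<in>E. w e \<le> q} = S})"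
    by (intro SUP_cong) (simp_all add: box)
  also have "\<dots> = {w \<in> space (PiM E (\<lambda>_. D)). Q {e\<in>E. w e \<le> q}}" by auto
  finally have "{w \<in> space (PiM E (\<lambda>_. D)). Q {e\<in>E. w e \<le> q}} = (\<Union>S\<in>{S\<in>Pow E. Q S}. box S)" ..
  also have "measure (PiM E (\<lambda>_. D)) \<dots> = (\<Sum>S\<in>{S\<in>Pow E. Q S}. measure (PiM E (\<lambda>_. D)) (box S))"
  proof (rule finite_measure_finite_Union)
    show "disjoint_family_on box {S \<in> Pow E. Q S}"
      unfolding disjoint_family_on_def
    proof (intro ballI impI)
      fix S T assume "S \<in> {S \<in> Pow E. Q S}" "T \<in> {S \<in> Pow E. Q S}" "S \<noteq> T"
      then show "box S \<inter> box T = {}" by (subst (1 2) box) auto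
    qed
    show "box ` {S \<in> Pow E. Q S} \<subseteq> sets (PiM E (\<lambda>_. D))" using box_sets by blast
    show "finite {S \<in> Pow E. Q S}" using fin by simp
  qed
  also have "\<dots> = (\<Sum>S\<in>{S\<in>Pow E. Q S}. p ^ card S * (1 - p) ^ card (E - S))"
    by (rule sum.cong) (simp_all add: box_measure)
  also have "\<dots> = bern_sum E p (\<lambda>S. if Q S then 1 else 0)"
    unfolding bern_sum_def using fin by (intro sum.mono_neutral_cong_left) auto
  finally show ?thesis by (simp add: p_def)
qed

lemma square_le_of_abs_le: "\<bar>x :: real\<bar> \<le> b \<Longrightarrow> x\<^sup>2 \<le> b\<^sup>2"
  by (metis abs_ge_zero power2_abs power_mono)

text \<open>
  A function that varies by at most \<open>c\<close> stays within \<open>c\<close> of its own mean, so its variance is at most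
  \<open>c\<^sup>2\<close>.
\<close>

lemma (in prob_space) second_moment_le_of_small_oscillation:
  fixes f :: "'a \<Rightarrow> real"
  assumes f[measurable]: "f \<in> borel_measurable M" and bd: "\<And>y. y \<in> space M \<Longrightarrow> \<bar>f y\<bar> \<le> b"
    and osc: "\<And>y y'. y \<in> space M \<Longrightarrow> y' \<in> space M \<Longrightarrow> \<bar>f y - f y'\<bar> \<le> c"
  shows "(\<integral>y. (f y)\<^sup>2 \<partial>M) \<le> (\<integral>y. f y \<partial>M)\<^sup>2 + c\<^sup>2"
proof -
  have int: "integrable M f" by (rule integrable_const_bound[where B = b]) (auto intro!: bd)
  have int2: "integrable M (\<lambda>y. (f y)\<^sup>2)"
    by (rule integrable_const_bound[where B = "b\<^sup>2"]) (auto intro!: AE_I2 square_le_of_abs_le bd)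
  have near_mean: "\<bar>f y - expectation f\<bar> \<le> c" if y: "y \<in> space M" for y
  proof -
    have "f y - expectation f = (\<integral>y'. f y - f y' \<partial>M)" using int by (simp add: prob_space)
    also have "\<bar>\<dots>\<bar> \<le> (\<integral>y'. \<bar>f y - f y'\<bar> \<partial>M)" by (rule integral_abs_bound)
    also have "\<dots> \<le> (\<integral>y'. c \<partial>M)"
      using int osc[OF y] by (intro integral_mono) auto
    finally show ?thesis by (simp add: prob_space)
  qed
  have "variance f \<le> (\<integral>y. c\<^sup>2 \<partial>M)"
  proof (rule integral_mono')
    fix y assume y: "y \<in> space M"
    show "(f y - expectation f)\<^sup>2 \<le> c\<^sup>2"
      using near_mean[OF y] by (rule square_le_of_abs_le)
  qed auto
  then show ?thesis using variance_eq[OF int int2] by (simp add: prob_space)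
qed

text \<open>
  The variance form of the bounded differences inequality, for coordinates grouped into blocks. The
  blocks are integrated out one at a time: averaging over the last block costs at most \<open>c\<^sup>2\<close> in the second
  moment by the preceding lemma, and the average still oscillates by at most \<open>c\<close> in each remaining
  block.
\<close>

lemma second_moment_bounded_differences:
  fixes D :: "real measure" and B :: "nat \<Rightarrow> 'i set" and f :: "('i \<Rightarrow> real) \<Rightarrow> real"
  assumes D: "prob_space D"
    and fin: "\<And>i. finite (B i)" and disj: "\<And>i j. i \<noteq> j \<Longrightarrow> B i \<inter> B j = {}"
    and "f \<in> borel_measurable (PiM (\<Union>i<n. B i) (\<lambda>_. D))"
    and "\<And>x. x \<in> space (PiM (\<Union>i<n. B i) (\<lambda>_. D)) \<Longrightarrow> \<bar>f x\<bar> \<le> b"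
    and "\<And>i x y. i < n \<Longrightarrow> x \<in> space (PiM (\<Union>i<n. B i) (\<lambda>_. D)) \<Longrightarrow>
        y \<in> space (PiM (\<Union>i<n. B i) (\<lambda>_. D)) \<Longrightarrow>
        (\<And>j. j \<in> (\<Union>i<n. B i) - B i \<Longrightarrow> x j = y j) \<Longrightarrow> \<bar>f x - f y\<bar> \<le> c"
  shows "(\<integral>x. (f x)\<^sup>2 \<partial>PiM (\<Union>i<n. B i) (\<lambda>_. D)) \<le> (\<integral>x. f x \<partial>PiM (\<Union>i<n. B i) (\<lambda>_. D))\<^sup>2 + n * c\<^sup>2"
  using assms(4-)
proof (induction n arbitrary: f)
  case 0
  interpret D: prob_space D by fact
  interpret P: prob_space "PiM {} (\<lambda>_::'i. D)" by (intro prob_space_PiM D)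
  have "(\<integral>x. (f x)\<^sup>2 \<partial>PiM {} (\<lambda>_. D)) = (\<integral>x. (f (\<lambda>_. undefined))\<^sup>2 \<partial>PiM {} (\<lambda>_::'i. D))"
    by (intro Bochner_Integration.integral_cong) (auto simp: space_PiM)
  moreover have "(\<integral>x. f x \<partial>PiM {} (\<lambda>_. D)) = (\<integral>x. f (\<lambda>_. undefined) \<partial>PiM {} (\<lambda>_::'i. D))"
    by (intro Bochner_Integration.integral_cong) (auto simp: space_PiM)
  moreover have "measure (PiM {} (\<lambda>_::'i. D)) (space (PiM {} (\<lambda>_::'i. D))) = 1"
    by (rule P.prob_space)
  ultimately show ?case by simp
next
  case (Suc n)
  interpret D: prob_space D by fact
  interpret product_prob_space "\<lambda>_::'i. D" UNIV ..
  define I J where "I = (\<Union>i<n. B i)" and "J = B n"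
  have "B i \<inter> B n = {}" if "i < n" for i using disj[of i n] that by simp
  then have IJ: "I \<inter> J = {}" by (auto simp: I_def J_def)
  have finIJ: "finite I" "finite J" using fin by (auto simp: I_def J_def)
  have U: "(\<Union>i<Suc n. B i) = I \<union> J" by (auto simp: I_def J_def lessThan_Suc)
  interpret I: prob_space "PiM I (\<lambda>_. D)" by (intro prob_space_PiM D)
  interpret J: prob_space "PiM J (\<lambda>_. D)" by (intro prob_space_PiM D)
  interpret IJ: prob_space "PiM (I \<union> J) (\<lambda>_. D)" by (intro prob_space_PiM D)
  have f[measurable]: "f \<in> borel_measurable (PiM (I \<union> J) (\<lambda>_. D))" using Suc.prems(1) U by simp
  have bd: "\<bar>f x\<bar> \<le> b" if "x \<in> space (PiM (I \<union> J) (\<lambda>_. D))" for x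
    using Suc.prems(2) U that by simp
  have merge_space: "merge I J (x, y) \<in> space (PiM (I \<union> J) (\<lambda>_. D))"
    if "x \<in> space (PiM I (\<lambda>_. D))" "y \<in> space (PiM J (\<lambda>_. D))" for x y
    using that IJ by (auto simp: space_PiM)
  define g where "g = (\<lambda>x. \<integral>y. f (merge I J (x, y)) \<partial>PiM J (\<lambda>_. D))"
  have g[measurable]: "g \<in> borel_measurable (PiM I (\<lambda>_. D))"
    unfolding g_def by (intro J.borel_measurable_lebesgue_integral) measurable
  have f_sec[measurable]: "(\<lambda>y. f (merge I J (x, y))) \<in> borel_measurable (PiM J (\<lambda>_. D))"
    if "x \<in> space (PiM I (\<lambda>_. D))" for x
    using that by measurable
  have int_sec: "integrable (PiM J (\<lambda>_. D)) (\<lambda>y. f (merge I J (x, y)))"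
    if "x \<in> space (PiM I (\<lambda>_. D))" for x
    using that by (intro J.integrable_const_bound[where B = b]) (auto intro!: bd merge_space f_sec)
  have int_f: "integrable (PiM (I \<union> J) (\<lambda>_. D)) f"
    by (rule IJ.integrable_const_bound[where B = b]) (auto intro!: bd)
  have int_f2: "integrable (PiM (I \<union> J) (\<lambda>_. D)) (\<lambda>x. (f x)\<^sup>2)"
    by (rule IJ.integrable_const_bound[where B = "b\<^sup>2"])
      (auto intro!: AE_I2 square_le_of_abs_le bd)
  have g_bd: "\<bar>g x\<bar> \<le> b" if x: "x \<in> space (PiM I (\<lambda>_. D))" for x
  proof -
    have "\<bar>g x\<bar> \<le> (\<integral>y. \<bar>f (merge I J (x, y))\<bar> \<partial>PiM J (\<lambda>_. D))"
      unfolding g_def by (rule integral_abs_bound)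
    also have "\<dots> \<le> (\<integral>y. b \<partial>PiM J (\<lambda>_. D))"
      using int_sec[OF x] x by (intro integral_mono) (auto intro!: bd merge_space)
    finally show ?thesis by (simp add: J.prob_space)
  qed
  have "(\<integral>x. (f x)\<^sup>2 \<partial>PiM (I \<union> J) (\<lambda>_. D)) =
      (\<integral>x. (\<integral>y. (f (merge I J (x, y)))\<^sup>2 \<partial>PiM J (\<lambda>_. D)) \<partial>PiM I (\<lambda>_. D))"
    using product_integral_fold[OF IJ finIJ int_f2] by simp
  also have "\<dots> \<le> (\<integral>x. (g x)\<^sup>2 + c\<^sup>2 \<partial>PiM I (\<lambda>_. D))"
  proof (rule integral_mono')
    show "integrable (PiM I (\<lambda>_. D)) (\<lambda>x. (g x)\<^sup>2 + c\<^sup>2)"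
      by (intro Bochner_Integration.integrable_add I.integrable_const
            I.integrable_const_bound[where B = "b\<^sup>2" and f = "\<lambda>x. (g x)\<^sup>2"])
        (auto intro!: AE_I2 square_le_of_abs_le g_bd)
  next
    fix x assume x: "x \<in> space (PiM I (\<lambda>_. D))"
    show "(\<integral>y. (f (merge I J (x, y)))\<^sup>2 \<partial>PiM J (\<lambda>_. D)) \<le> (g x)\<^sup>2 + c\<^sup>2"
      unfolding g_def
    proof (rule J.second_moment_le_of_small_oscillation[where b = b])
      fix y y' assume y: "y \<in> space (PiM J (\<lambda>_. D))" "y' \<in> space (PiM J (\<lambda>_. D))"
      show "\<bar>f (merge I J (x, y)) - f (merge I J (x, y'))\<bar> \<le> c"
      proof (rule Suc.prems(3)[of n], unfold U)
        fix j assume "j \<in> I \<union> J - B n"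
        then have "j \<in> I" by (auto simp: J_def)
        then show "merge I J (x, y) j = merge I J (x, y') j" by (simp add: merge_def)
      qed (use x y merge_space in auto)
    qed (use x in \<open>auto intro!: bd merge_space f_sec\<close>)
    show "0 \<le> (g x)\<^sup>2 + c\<^sup>2" by simp
  qed
  also have "\<dots> = (\<integral>x. (g x)\<^sup>2 \<partial>PiM I (\<lambda>_. D)) + c\<^sup>2"
  proof -
    have "integrable (PiM I (\<lambda>_. D)) (\<lambda>x. (g x)\<^sup>2)"
      by (intro I.integrable_const_bound[where B = "b\<^sup>2"])
        (auto intro!: AE_I2 square_le_of_abs_le g_bd)
    then show ?thesis by (simp add: I.prob_space)
  qed
  also have "(\<integral>x. (g x)\<^sup>2 \<partial>PiM I (\<lambda>_. D)) \<le> (\<integral>x. g x \<partial>PiM I (\<lambda>_. D))\<^sup>2 + n * c\<^sup>2"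
    unfolding I_def
  proof (rule Suc.IH; unfold I_def[symmetric])
    fix i x x' assume i: "i < n" and x: "x \<in> space (PiM I (\<lambda>_. D))" "x' \<in> space (PiM I (\<lambda>_. D))"
      and eq: "\<And>j. j \<in> I - B i \<Longrightarrow> x j = x' j"
    have "g x - g x' = (\<integral>y. f (merge I J (x, y)) - f (merge I J (x', y)) \<partial>PiM J (\<lambda>_. D))"
      unfolding g_def using int_sec x by simp
    also have "\<bar>\<dots>\<bar> \<le> (\<integral>y. \<bar>f (merge I J (x, y)) - f (merge I J (x', y))\<bar> \<partial>PiM J (\<lambda>_. D))"
      by (rule integral_abs_bound)
    also have "\<dots> \<le> (\<integral>y. c \<partial>PiM J (\<lambda>_. D))"
    proof (rule integral_mono)
      fix y assume y: "y \<in> space (PiM J (\<lambda>_. D))"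
      show "\<bar>f (merge I J (x, y)) - f (merge I J (x', y))\<bar> \<le> c"
      proof (rule Suc.prems(3)[of i], unfold U)
        fix j assume "j \<in> I \<union> J - B i"
        then show "merge I J (x, y) j = merge I J (x', y) j"
          using eq[of j] by (auto simp: merge_def)
      qed (use x y i merge_space in auto)
    qed (use int_sec x in auto)
    finally show "\<bar>g x - g x'\<bar> \<le> c" by (simp add: J.prob_space)
  qed (auto intro!: g_bd)
  also have "(\<integral>x. g x \<partial>PiM I (\<lambda>_. D)) = (\<integral>x. f x \<partial>PiM (I \<union> J) (\<lambda>_. D))"
    unfolding g_def using product_integral_fold[OF IJ finIJ int_f] by simp
  finally show ?case by (simp add: U algebra_simps)
qed

section \<open>Copies of a fixed graph in a random graph\<close>

lemma finite_edges: "simple_graph G \<Longrightarrow> finite (edges G)"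
  unfolding simple_graph_def by (rule finite_subset[of _ "Pow (verts G)"]) auto

lemma finite_edges_complete_graph [simp]: "finite (edges (complete_graph n))"
  by (rule finite_subset[of _ "Pow {..<n}"]) (auto simp: complete_graph_def)

text \<open>
  Restricting to extensional functions makes each injection of the vertex set a single object, so that
  embeddings can be counted.
\<close>

definition embeddings :: "'a ugraph \<Rightarrow> nat set \<Rightarrow> ('a \<Rightarrow> nat) set" where
  "embeddings G R = {\<phi> \<in> verts G \<rightarrow>\<^sub>E R. inj_on \<phi> (verts G)}"

lemma finite_embeddings: "simple_graph G \<Longrightarrow> finite R \<Longrightarrow> finite (embeddings G R)"
  unfolding embeddings_def simple_graph_def
  by (rule finite_subset[of _ "verts G \<rightarrow>\<^sub>E R"]) (auto intro: finite_PiE)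

lemma inj_on_image_edges:
  assumes "simple_graph G" "inj_on \<phi> (verts G)"
  shows "inj_on ((`) \<phi>) (edges G)"
proof (rule inj_onI)
  fix e f assume "e \<in> edges G" "f \<in> edges G" "\<phi> ` e = \<phi> ` f"
  then show "e = f"
    using assms by (auto simp: simple_graph_def dest: inj_on_image_eq_iff)
qed

lemma card_image_edges:
  assumes "simple_graph G" "inj_on \<phi> (verts G)"
  shows "card ((`) \<phi> ` edges G) = card (edges G)"
  by (rule card_image) (rule inj_on_image_edges[OF assms])

lemma image_edges_subset:
  assumes "simple_graph G" "inj_on \<phi> (verts G)" "\<phi> ` verts G \<subseteq> {..<n}"
  shows "(\<lambda>e. \<phi> ` e) ` edges G \<subseteq> edges (complete_graph n)"
proof -
  have "card (\<phi> ` e) = 2 \<and> \<phi> ` e \<subseteq> {..<n}" if "e \<in> edges G" for e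
  proof -
    have "e \<subseteq> verts G" "card e = 2" using assms(1) that by (auto simp: simple_graph_def)
    then show ?thesis using assms(2,3) by (auto simp: card_image inj_on_subset)
  qed
  then show ?thesis by (auto simp: complete_graph_def)
qed

text \<open>
  An injection on \<open>A\<close> extends to a further point in at least \<open>card B - card A\<close> ways.
\<close>

lemma card_injections_ge:
  assumes "finite A" "finite B"
  shows "(card B - card A) ^ card A \<le> card {f \<in> A \<rightarrow>\<^sub>E B. inj_on f A}"
  using assms(1)
proof (induction A rule: finite_induct)
  case empty
  have "{f \<in> {} \<rightarrow>\<^sub>E B. inj_on f {}} = {\<lambda>_. undefined}" by auto
  then show ?case by simp
next
  case (insert x A)
  let ?I = "{f \<in> A \<rightarrow>\<^sub>E B. inj_on f A}"
  have finI: "finite ?I" using insert assms(2) by (intro finite_subset[OF _ finite_PiE[of A "\<lambda>_. B"]]) auto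
  have fin': "finite {f \<in> insert x A \<rightarrow>\<^sub>E B. inj_on f (insert x A)}"
    using insert assms(2) by (intro finite_subset[OF _ finite_PiE[of "insert x A" "\<lambda>_. B"]]) auto
  have "(card B - card (insert x A)) ^ card (insert x A) \<le> (card B - card A) ^ card A * (card B - card A)"
    using insert unfolding card_insert_disjoint[OF insert(1,2)] power_Suc2
    by (intro mult_mono power_mono) auto
  also have "\<dots> \<le> card ?I * (card B - card A)"
    using insert.IH by (rule mult_right_mono) simp
  also have "\<dots> = (\<Sum>f\<in>?I. card B - card A)" by simp
  also have "\<dots> \<le> (\<Sum>f\<in>?I. card (B - f ` A))"
  proof (rule sum_mono)
    fix f assume "f \<in> ?I"
    have "card (f ` A) \<le> card A" using insert by (simp add: card_image_le)
    moreover have "card B - card (f ` A) \<le> card (B - f ` A)"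
      using assms insert by (intro diff_card_le_card_Diff) auto
    ultimately show "card B - card A \<le> card (B - f ` A)" by linarith
  qed
  also have "\<dots> = card (Sigma ?I (\<lambda>f. B - f ` A))"
    using finI assms(2) by (subst card_SigmaI) auto
  also have "\<dots> \<le> card {f \<in> insert x A \<rightarrow>\<^sub>E B. inj_on f (insert x A)}"
  proof (rule card_inj_on_le[OF _ _ fin'])
    show "inj_on (\<lambda>(f, y). f(x := y)) (Sigma ?I (\<lambda>f. B - f ` A))"
    proof (rule inj_onI, clarsimp)
      fix f y g z
      assume f: "f \<in> A \<rightarrow>\<^sub>E B" and g: "g \<in> A \<rightarrow>\<^sub>E B" and eq: "f(x := y) = g(x := z)"
      have "f = g"
      proof (rule PiE_ext[OF f g])
        fix i assume "i \<in> A"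
        then have "i \<noteq> x" using insert by auto
        then show "f i = g i" using fun_cong[OF eq, of i] by simp
      qed
      then show "f = g \<and> y = z" using fun_cong[OF eq, of x] by simp
    qed
    show "(\<lambda>(f, y). f(x := y)) ` (Sigma ?I (\<lambda>f. B - f ` A)) \<subseteq>
        {f \<in> insert x A \<rightarrow>\<^sub>E B. inj_on f (insert x A)}"
    proof
      fix h assume "h \<in> (\<lambda>(f, y). f(x := y)) ` (Sigma ?I (\<lambda>f. B - f ` A))"
      then obtain f y where h: "h = f(x := y)" and f: "f \<in> A \<rightarrow>\<^sub>E B" "inj_on f A"
        and y: "y \<in> B" "y \<notin> f ` A" by auto
      have eq: "(f(x := y)) i = f i" if "i \<in> A" for i using that insert by auto
      have "inj_on (f(x := y)) A" using f(2) inj_on_cong[of A "f(x := y)" f] eq by blast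
      moreover have "(f(x := y)) ` A = f ` A" using eq by (intro image_cong) auto
      ultimately have "inj_on (f(x := y)) (insert x A)" using insert(2) y by simp
      moreover have "f(x := y) \<in> insert x A \<rightarrow>\<^sub>E B" using PiE_fun_upd[of y "\<lambda>_. B" x f A] y f by simp
      ultimately show "h \<in> {f \<in> insert x A \<rightarrow>\<^sub>E B. inj_on f (insert x A)}"
        unfolding h by blast
    qed
  qed
  finally show ?case .
qed

text \<open>
  Janson's inequality for the family of all embeddings of \<open>H\<close> into \<open>R\<close>. The mean is about
  \<open>k\<^sup>v p\<^sup>m\<close>. In the correlation sum fix \<open>\<phi>\<close> and classify \<open>\<psi>\<close> by the set \<open>F\<close> of edges of \<open>H\<close> that \<open>\<psi>\<close>
  sends to edges used by \<open>\<phi>\<close>: the endpoints of \<open>F\<close> then land among the \<open>v\<close> vertices of the image of \<open>\<phi>\<close>,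
  which loses a factor \<open>k\<close> in the number of choices for each of them, and the shared edges gain
  \<open>1 / p\<close> each. Relative to the square of the mean, every class therefore contributes at most a constant over
  \<open>k ^ card (\<Union>F) * p ^ card F\<close>, which \<open>\<Lambda>\<close> bounds from below.
\<close>

lemma no_copy_janson:
  fixes H :: "'a ugraph" and k :: nat
  defines "v \<equiv> card (verts H)" and "m \<equiv> card (edges H)"
  assumes H: "simple_graph H" "edges H \<noteq> {}" and R: "R \<subseteq> {..<n}" "card R = k" "2 * v \<le> k" "0 < v"
    and p: "0 \<le> p" "p \<le> 1" and \<Lambda>: "0 < \<Lambda>"
    and dense: "\<And>F. F \<subseteq> edges H \<Longrightarrow> F \<noteq> {} \<Longrightarrow> \<Lambda> \<le> real k ^ card (\<Union>F) * p ^ card F"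
  shows "bern_sum (edges (complete_graph n)) p
      (\<lambda>S. if \<exists>\<phi>\<in>embeddings H R. (`) \<phi> ` edges H \<subseteq> S then 0 else 1)
    \<le> exp (- (\<Lambda> / (2 ^ (m + 1) * (2 * real v) ^ v)))"
proof -
  have finR: "finite R" using R(1) by (rule finite_subset) simp
  have finH: "finite (verts H)" "finite (edges H)" using H finite_edges[OF H(1)] by (auto simp: simple_graph_def)
  define \<Phi> where "\<Phi> = embeddings H R"
  have fin\<Phi>: "finite \<Phi>" unfolding \<Phi>_def using H finR by (intro finite_embeddings)
  define A where "A = (\<lambda>\<phi>::'a \<Rightarrow> nat. (`) \<phi> ` edges H)"
  have \<Phi>: "\<phi> \<in> verts H \<rightarrow>\<^sub>E R" "inj_on \<phi> (verts H)" if "\<phi> \<in> \<Phi>" for \<phi>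
    using that by (auto simp: \<Phi>_def embeddings_def)
  have A: "A \<phi> \<subseteq> edges (complete_graph n)" "card (A \<phi>) = m" "finite (A \<phi>)" if "\<phi> \<in> \<Phi>" for \<phi>
  proof -
    have "\<phi> ` verts H \<subseteq> {..<n}" using \<Phi>[OF that] R by (auto simp: PiE_def Pi_def)
    then show "A \<phi> \<subseteq> edges (complete_graph n)" "card (A \<phi>) = m" "finite (A \<phi>)"
      unfolding A_def m_def
      using image_edges_subset[OF H(1) \<Phi>(2)[OF that]] card_image_edges[OF H(1) \<Phi>(2)[OF that]] finH by auto
  qed
  have k: "0 < k" using R by simp
  have p0: "0 < p"
  proof (rule ccontr)
    assume "\<not> 0 < p"
    then have "p = 0" using p by simp
    moreover have "0 < m" using H finH by (simp add: m_def card_gt_0_iff)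
    ultimately show False using dense[OF order.refl H(2)] \<Lambda> by (simp add: m_def power_0_left)
  qed
  define B where "B = 2 ^ m * (real v ^ v * real k ^ v * p ^ (2 * m) / \<Lambda>)"
  have B0: "0 < B" using R p0 k \<Lambda> by (simp add: B_def)
  have overlap: "(\<Sum>\<psi>\<in>{\<psi>\<in>\<Phi>. A \<phi> \<inter> A \<psi> \<noteq> {}}. p ^ card (A \<phi> \<union> A \<psi>)) \<le> B" if \<phi>: "\<phi> \<in> \<Phi>" for \<phi>
  proof -
    \<comment> \<open>\<open>common \<psi>\<close> is the set \<open>F\<close> by which the embeddings \<open>\<psi>\<close> are classified.\<close>
    define common where "common = (\<lambda>\<psi>::'a \<Rightarrow> nat. {f \<in> edges H. \<psi> ` f \<in> A \<phi>})"
    have A_Int: "A \<phi> \<inter> A \<psi> = (`) \<psi> ` common \<psi>" for \<psi>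
      unfolding common_def A_def by blast
    have card_Un: "p ^ card (A \<phi> \<union> A \<psi>) = p ^ (2 * m) / p ^ card (common \<psi>)" if "\<psi> \<in> \<Phi>" for \<psi>
    proof -
      have "inj_on ((`) \<psi>) (common \<psi>)"
        using inj_on_image_edges[OF H(1) \<Phi>(2)[OF that]] by (rule inj_on_subset) (auto simp: common_def)
      then have "card (A \<phi> \<inter> A \<psi>) = card (common \<psi>)" by (simp add: A_Int card_image)
      then have "card (A \<phi> \<union> A \<psi>) + card (common \<psi>) = 2 * m"
        using card_Un_Int[of "A \<phi>" "A \<psi>"] A \<phi> that by simp
      then have "p ^ card (A \<phi> \<union> A \<psi>) * p ^ card (common \<psi>) = p ^ (2 * m)"
        by (simp flip: power_add)
      then show ?thesis using p0 by (simp add: field_simps)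
    qed
    have "(\<Sum>\<psi>\<in>{\<psi>\<in>\<Phi>. A \<phi> \<inter> A \<psi> \<noteq> {}}. p ^ card (A \<phi> \<union> A \<psi>)) =
        (\<Sum>F\<in>Pow (edges H) - {{}}. \<Sum>\<psi>\<in>{\<psi>\<in>{\<psi>\<in>\<Phi>. A \<phi> \<inter> A \<psi> \<noteq> {}}. common \<psi> = F}. p ^ card (A \<phi> \<union> A \<psi>))"
    proof (rule sum.group[symmetric])
      show "common ` {\<psi> \<in> \<Phi>. A \<phi> \<inter> A \<psi> \<noteq> {}} \<subseteq> Pow (edges H) - {{}}"
        unfolding A_Int by (auto simp: common_def)
    qed (use fin\<Phi> finH in auto)
    also have "\<dots> \<le> (\<Sum>F\<in>Pow (edges H) - {{}}. real v ^ v * real k ^ v * p ^ (2 * m) / \<Lambda>)"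
    proof (rule sum_mono)
      fix F assume F: "F \<in> Pow (edges H) - {{}}"
      define U where "U = \<Union>F"
      have U: "U \<subseteq> verts H" using F H by (auto simp: U_def simple_graph_def)
      have cU: "card U \<le> v" unfolding v_def using U finH by (intro card_mono)
      let ?\<Psi> = "{\<psi>\<in>{\<psi>\<in>\<Phi>. A \<phi> \<inter> A \<psi> \<noteq> {}}. common \<psi> = F}"
      have "?\<Psi> \<subseteq> (\<Pi>\<^sub>E x\<in>verts H. if x \<in> U then \<phi> ` verts H else R)"
      proof
        fix \<psi> assume \<psi>: "\<psi> \<in> ?\<Psi>"
        have "\<psi> x \<in> \<phi> ` verts H" if x: "x \<in> U" for x
        proof -
          obtain f where f: "x \<in> f" "f \<in> F" using x by (auto simp: U_def)
          then have "\<psi> ` f \<in> A \<phi>" using \<psi> by (auto simp: common_def)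
          then obtain f' where "f' \<in> edges H" "\<psi> ` f = \<phi> ` f'" by (auto simp: A_def)
          moreover have "f' \<subseteq> verts H" using H calculation by (auto simp: simple_graph_def)
          ultimately show ?thesis using f by blast
        qed
        then show "\<psi> \<in> (\<Pi>\<^sub>E x\<in>verts H. if x \<in> U then \<phi> ` verts H else R)"
          using \<Phi>(1)[of \<psi>] \<psi> by (auto simp: PiE_iff)
      qed
      then have "card ?\<Psi> \<le> card (\<Pi>\<^sub>E x\<in>verts H. if x \<in> U then \<phi> ` verts H else R)"
        using finH finR by (intro card_mono finite_PiE) auto
      also have "\<dots> = (\<Prod>x\<in>verts H. if x \<in> U then v else k)"
        using finH \<Phi>(2)[OF \<phi>] R by (simp add: card_PiE if_distrib[of card] card_image v_def cong: if_cong)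
      also have "\<dots> = v ^ card U * k ^ (v - card U)"
      proof -
        have "card (verts H - U) = v - card U"
          using U finH unfolding v_def by (intro card_Diff_subset) (auto intro: finite_subset)
        then show ?thesis using U finH by (simp add: prod.If_cases Int_absorb1 flip: Diff_eq)
      qed
      finally have "real (card ?\<Psi>) \<le> real (v ^ card U * k ^ (v - card U))"
        unfolding of_nat_le_iff .
      also have "\<dots> \<le> real v ^ v * real k ^ (v - card U)"
      proof -
        have "real v ^ card U \<le> real v ^ v" using cU R(4) by (intro power_increasing) auto
        then have "real v ^ card U * real k ^ (v - card U) \<le> real v ^ v * real k ^ (v - card U)"
          by (rule mult_right_mono) simp
        then show ?thesis by simp
      qed
      finally have card_\<Psi>: "real (card ?\<Psi>) \<le> real v ^ v * real k ^ (v - card U)" .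
      have "(\<Sum>\<psi>\<in>?\<Psi>. p ^ card (A \<phi> \<union> A \<psi>)) = (\<Sum>\<psi>\<in>?\<Psi>. p ^ (2 * m) / p ^ card F)"
        by (rule sum.cong) (auto simp: card_Un)
      also have "\<dots> = real (card ?\<Psi>) * (p ^ (2 * m) / p ^ card F)" by simp
      also have "\<dots> \<le> (real v ^ v * real k ^ (v - card U)) * (p ^ (2 * m) / p ^ card F)"
        using card_\<Psi> p0 by (intro mult_right_mono) auto
      also have "\<dots> = real v ^ v * real k ^ v * p ^ (2 * m) / (real k ^ card U * p ^ card F)"
      proof -
        have "real k ^ v = real k ^ (v - card U) * real k ^ card U"
          using cU by (simp flip: power_add)
        then show ?thesis using k p0 by (simp add: divide_simps)
      qed
      also have "\<dots> \<le> real v ^ v * real k ^ v * p ^ (2 * m) / \<Lambda>"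
        using dense[of F] F p0 k \<Lambda> by (intro divide_left_mono) (auto simp: U_def)
      finally show "(\<Sum>\<psi>\<in>?\<Psi>. p ^ card (A \<phi> \<union> A \<psi>)) \<le> real v ^ v * real k ^ v * p ^ (2 * m) / \<Lambda>" .
    qed
    also have "\<dots> = real (card (Pow (edges H) - {{}})) * (real v ^ v * real k ^ v * p ^ (2 * m) / \<Lambda>)"
      by simp
    also have "\<dots> \<le> B"
    proof -
      have "card (Pow (edges H) - {{}}) \<le> 2 ^ m"
        using finH card_mono[of "Pow (edges H)" "Pow (edges H) - {{}}"] by (simp add: card_Pow m_def)
      then have "real (card (Pow (edges H) - {{}})) \<le> 2 ^ m" by (metis of_nat_le_iff of_nat_numeral of_nat_power)
      then show ?thesis unfolding B_def using p0 \<Lambda> by (intro mult_right_mono) auto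
    qed
    finally show ?thesis .
  qed
  have N: "(real k / 2) ^ v \<le> real (card \<Phi>)"
  proof -
    have "(real k / 2) ^ v \<le> real (k - v) ^ v"
      using R by (intro power_mono) (auto simp: of_nat_diff)
    also have "\<dots> \<le> real (card \<Phi>)"
      using of_nat_mono[OF card_injections_ge[OF finH(1) finR], where ?'a = real] R(2)
      by (simp add: \<Phi>_def embeddings_def v_def)
    finally show ?thesis .
  qed
  moreover have "0 < (real k / 2) ^ v" using k by simp
  ultimately have N0: "0 < real (card \<Phi>)" by linarith
  have "bern_sum (edges (complete_graph n)) p (\<lambda>S. if \<exists>\<phi>\<in>\<Phi>. A \<phi> \<subseteq> S then 0 else 1)
    \<le> exp (- ((real (card \<Phi>) * p ^ m)\<^sup>2 / (2 * (real (card \<Phi>) * B))))"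
  proof (rule janson_inequality)
    show "real (card \<Phi>) * p ^ m = (\<Sum>\<phi>\<in>\<Phi>. p ^ card (A \<phi>))"
      by (simp add: A(2))
    have "(\<Sum>\<phi>\<in>\<Phi>. \<Sum>\<psi>\<in>{\<psi> \<in> \<Phi>. A \<phi> \<inter> A \<psi> \<noteq> {}}. p ^ card (A \<phi> \<union> A \<psi>)) \<le> (\<Sum>\<phi>\<in>\<Phi>. B)"
      by (rule sum_mono) (rule overlap)
    then show "(\<Sum>\<phi>\<in>\<Phi>. \<Sum>\<psi>\<in>{\<psi> \<in> \<Phi>. A \<phi> \<inter> A \<psi> \<noteq> {}}. p ^ card (A \<phi> \<union> A \<psi>)) \<le> real (card \<Phi>) * B"
      by (simp only: sum_constant)
    show "A \<phi> \<subseteq> edges (complete_graph n)" if "\<phi> \<in> \<Phi>" for \<phi> by (rule A(1)[OF that])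
  qed (use N0 B0 fin\<Phi> p in simp_all)
  also have "\<dots> \<le> exp (- (\<Lambda> / (2 ^ (m + 1) * (2 * real v) ^ v)))"
  proof -
    define N where "N = real (card \<Phi>)"
    define K where "K = real v ^ v * real k ^ v"
    have pos: "0 < K" "0 < p ^ m" "0 < N" using k R p0 N0 by (auto simp: K_def N_def)
    have "(2 * real v) ^ v * (real k / 2) ^ v = K"
      unfolding K_def power_mult_distrib[symmetric] by simp
    then have "\<Lambda> / (2 ^ (m + 1) * (2 * real v) ^ v) = (real k / 2) ^ v * \<Lambda> / (2 ^ (m + 1) * K)"
      using k R by (auto simp: divide_simps)
    also have "\<dots> \<le> N * \<Lambda> / (2 ^ (m + 1) * K)"
      using N \<Lambda> pos unfolding N_def by (intro divide_right_mono mult_right_mono) auto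
    also have "\<dots> = (N * p ^ m)\<^sup>2 / (2 * (N * (2 ^ m * (K * (p ^ m)\<^sup>2 / \<Lambda>))))"
      using pos \<Lambda> p0 by (auto simp: divide_simps power2_eq_square)
    also have "\<dots> = (real (card \<Phi>) * p ^ m)\<^sup>2 / (2 * (real (card \<Phi>) * B))"
      unfolding B_def K_def N_def by (simp add: power_mult[symmetric] mult.commute[of m])
    finally show ?thesis by simp
  qed
  finally show ?thesis by (simp add: \<Phi>_def A_def)
qed

section \<open>Maximum 1-density and light copies\<close>

lemma finite_subgraphs:
  assumes "simple_graph H" shows "finite {G. is_subgraph G H}"
proof (rule finite_subset)
  show "{G. is_subgraph G H} \<subseteq> Pow (verts H) \<times> Pow (edges H)"
    by (auto simp: is_subgraph_def)
  show "finite (Pow (verts H) \<times> Pow (edges H))"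
    using assms finite_edges[OF assms] by (simp add: simple_graph_def)
qed

lemma finite_densities:
  assumes "simple_graph H"
  shows "finite {density1 G | G. is_subgraph G H \<and> card (verts G) \<ge> 2}"
proof (rule finite_subset)
  show "{density1 G | G. is_subgraph G H \<and> card (verts G) \<ge> 2} \<subseteq> density1 ` {G. is_subgraph G H}"
    by auto
  show "finite (density1 ` {G. is_subgraph G H})" using finite_subgraphs[OF assms] by simp
qed

lemma density1_le_max_density1:
  assumes "simple_graph H" "is_subgraph G H" "card (verts G) \<ge> 2"
  shows "density1 G \<le> max_density1 H"
  unfolding max_density1_def by (rule Max_ge[OF finite_densities[OF assms(1)]]) (use assms in blast)

lemma max_density1_attained:
  assumes "simple_graph H" "is_subgraph G H" "card (verts G) \<ge> 2"
  shows "\<exists>G. is_subgraph G H \<and> card (verts G) \<ge> 2 \<and> density1 G = max_density1 H"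
proof -
  have "density1 G \<in> {density1 G | G. is_subgraph G H \<and> card (verts G) \<ge> 2}"
    using assms by blast
  then have "{density1 G | G. is_subgraph G H \<and> card (verts G) \<ge> 2} \<noteq> {}" by (metis empty_iff)
  then have "max_density1 H \<in> {density1 G | G. is_subgraph G H \<and> card (verts G) \<ge> 2}"
    unfolding max_density1_def by (rule Max_in[OF finite_densities[OF assms(1)]])
  then show ?thesis unfolding mem_Collect_eq by (elim exE conjE) (metis)
qed

text \<open>
  The cycle itself: different positions give different edges because the cycle has length at least 3.
\<close>

lemma has_cycle_dense_subgraph:
  assumes "simple_graph H" "has_cycle H"
  shows "\<exists>G. is_subgraph G H \<and> 3 \<le> card (verts G) \<and> card (edges G) = card (verts G)"
proof -
  from assms(2) obtain vs where vs: "length vs \<ge> 3" "distinct vs" "set vs \<subseteq> verts H"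
    and cyc: "\<And>i. i < length vs \<Longrightarrow> {vs ! i, vs ! (Suc i mod length vs)} \<in> edges H"
    unfolding has_cycle_def by auto
  define l where "l = length vs"
  define s where "s = (\<lambda>i. Suc i mod l)"
  define f where "f = (\<lambda>i. {vs ! i, vs ! s i})"
  have s: "s i < l" "s i \<noteq> i" "s (s i) \<noteq> i" if "i < l" for i
    using that vs(1) unfolding s_def l_def by (auto simp: mod_Suc split: if_splits)
  have nth: "vs ! i = vs ! j \<longleftrightarrow> i = j" if "i < l" "j < l" for i j
    using that vs(2) by (simp add: l_def nth_eq_iff_index_eq)
  have "inj_on f {..<l}"
  proof (rule inj_onI)
    fix i j assume ij: "i \<in> {..<l}" "j \<in> {..<l}" and "f i = f j"
    then have "i = j \<or> (i = s j \<and> s i = j)"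
      using s[of i] s[of j] nth unfolding f_def by (auto simp: doubleton_eq_iff)
    then show "i = j" using s(3)[of i] ij by auto
  qed
  then have card_f: "card (f ` {..<l}) = l" by (simp add: card_image)
  have "is_subgraph (set vs, f ` {..<l}) H"
    unfolding is_subgraph_def simple_graph_def
  proof (intro conjI ballI)
    show "edges (set vs, f ` {..<l}) \<subseteq> edges H"
      using cyc by (auto simp: f_def s_def l_def)
    fix e assume "e \<in> edges (set vs, f ` {..<l})"
    then obtain i where i: "i < l" "e = f i" by auto
    then show "e \<subseteq> verts (set vs, f ` {..<l})" using s(1)[OF i(1)] by (auto simp: f_def l_def)
    have "f i \<in> edges H" using cyc[of i] i by (simp add: f_def s_def l_def)
    then show "card e = 2" using assms(1) i by (auto simp: simple_graph_def)
  qed (use vs in auto)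
  moreover have "card (set vs) = l" using vs(2) by (simp add: distinct_card l_def)
  ultimately show ?thesis using card_f vs(1)
    by (intro exI[of _ "(set vs, f ` {..<l})"]) (auto simp: l_def)
qed

lemma max_density1_gt_1:
  assumes "simple_graph H" "has_cycle H"
  shows "max_density1 H > 1"
proof -
  obtain G where G: "is_subgraph G H" "3 \<le> card (verts G)" "card (edges G) = card (verts G)"
    using has_cycle_dense_subgraph[OF assms] by auto
  have "1 < density1 G" using G by (simp add: density1_def field_simps)
  also have "\<dots> \<le> max_density1 H" using G by (intro density1_le_max_density1 assms) auto
  finally show ?thesis .
qed

text \<open>
  Apply the maximality of the density to the graph formed by the edges \<open>F\<close> and their endpoints.
\<close>

lemma card_edges_le_max_density1:
  assumes H: "simple_graph H" and F: "F \<subseteq> edges H" "F \<noteq> {}"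
  shows "real (card F) \<le> max_density1 H * (real (card (\<Union>F)) - 1)"
proof -
  have sub: "is_subgraph (\<Union>F, F) H"
    using H F unfolding is_subgraph_def simple_graph_def
    by (auto intro!: finite_Union finite_subset[of "\<Union>F" "verts H"])
  obtain e where e: "e \<in> F" using F by auto
  then have "card e = 2" "e \<subseteq> \<Union>F" using H F by (auto simp: simple_graph_def)
  then have two: "2 \<le> card (\<Union>F)"
    using sub by (metis card_mono fst_conv is_subgraph_def simple_graph_def)
  then have "density1 (\<Union>F, F) \<le> max_density1 H"
    using density1_le_max_density1[OF H sub] by simp
  then show ?thesis using two by (simp add: density1_def divide_le_eq)
qed

text \<open>
  The threshold of \<open>H\<close> enters here: at edge probability \<open>k powr (- 1 / d)\<close>, every subgraph with edge set
  \<open>F\<close> has expected count at least of order \<open>k\<close> because \<open>card F \<le> d (card (\<Union>F) - 1)\<close>; raising the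
  probability by a factor \<open>x\<close> gains at least one more factor \<open>x\<close>.
\<close>

lemma janson_exponent_ge:
  assumes H: "simple_graph H" and d: "max_density1 H > 0" and F: "F \<subseteq> edges H" "F \<noteq> {}"
    and k: "1 \<le> k" and x: "1 \<le> x" and p: "x * real k powr (- 1 / max_density1 H) \<le> p"
  shows "x * real k \<le> real k ^ card (\<Union>F) * p ^ card F"
proof -
  define b where "b = 1 / max_density1 H"
  have finF: "finite F" using finite_edges[OF H] F(1) by (rule finite_subset[rotated])
  have cF: "1 \<le> card F" using finF F by (simp add: card_gt_0_iff Suc_le_eq)
  have "b * card F \<le> real (card (\<Union>F)) - 1"
    using card_edges_le_max_density1[OF H F] d unfolding b_def by (simp add: field_simps)
  then have "real k powr 1 \<le> real k powr (real (card (\<Union>F)) - b * card F)"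
    using k by (intro powr_mono) auto
  then have "x * real k \<le> x ^ card F * real k powr (real (card (\<Union>F)) - b * card F)"
    using x k cF by (intro mult_mono) (auto simp: self_le_power)
  also have "\<dots> = real k ^ card (\<Union>F) * (x * real k powr (- b)) ^ card F"
    using k by (simp add: power_mult_distrib powr_power powr_diff powr_realpow powr_minus field_simps)
  also have "\<dots> \<le> real k ^ card (\<Union>F) * p ^ card F"
    using p x by (intro mult_left_mono power_mono) (auto simp: b_def)
  finally show ?thesis .
qed

definition light_copy :: "'a ugraph \<Rightarrow> (nat set \<Rightarrow> real) \<Rightarrow> real \<Rightarrow> nat set \<Rightarrow> bool" where
  "light_copy H w q R \<longleftrightarrow> (\<exists>\<phi>\<in>embeddings H R. \<forall>e\<in>edges H. w (\<phi> ` e) \<le> q)"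

lemma embedding_edge:
  assumes "simple_graph H" "R \<subseteq> {..<n}" "\<phi> \<in> embeddings H R" "e \<in> edges H"
  shows "\<phi> ` e \<in> edges (complete_graph n)"
proof -
  have "inj_on \<phi> (verts H)" "\<phi> ` verts H \<subseteq> {..<n}"
    using assms(2,3) by (auto simp: embeddings_def PiE_def Pi_def)
  then show ?thesis using image_edges_subset[OF assms(1)] assms(4) by blast
qed

lemma sets_light_copy:
  assumes H: "simple_graph H" and D: "sets D = sets borel" and R: "R \<subseteq> {..<n}"
  defines "Q \<equiv> PiM (edges (complete_graph n)) (\<lambda>_. D)"
  shows "{w \<in> space Q. light_copy H w q R} \<in> sets Q"
proof -
  have "{w \<in> space Q. w (\<phi> ` e) \<le> q} \<in> sets Q"
    if "\<phi> \<in> embeddings H R" "e \<in> edges H" for \<phi> e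
  proof -
    have "(\<lambda>w. w (\<phi> ` e)) \<in> measurable Q D"
      unfolding Q_def using embedding_edge[OF H R that] by (rule measurable_component_singleton)
    then have "(\<lambda>w. w (\<phi> ` e)) \<in> borel_measurable Q" using D measurable_cong_sets by blast
    then show ?thesis by measurable
  qed
  then show ?thesis
    unfolding light_copy_def using R
    by (intro sets.sets_Collect_finite_Ex sets.sets_Collect_finite_All finite_edges H
        finite_embeddings) (auto intro: finite_subset)
qed

lemma light_copy_compl_prob:
  fixes H :: "'a ugraph" and k :: nat
  defines "v \<equiv> card (verts H)" and "m \<equiv> card (edges H)"
  assumes H: "simple_graph H" "edges H \<noteq> {}" and d: "max_density1 H > 0"
    and D: "prob_space D" "sets D = sets borel"
    and R: "R \<subseteq> {..<n}" "card R = k" "2 * v \<le> k" "0 < v"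
    and x: "1 \<le> x" "x * real k powr (- 1 / max_density1 H) \<le> measure D {..q}"
  defines "Q \<equiv> PiM (edges (complete_graph n)) (\<lambda>_. D)"
  shows "measure Q {w \<in> space Q. \<not> light_copy H w q R} \<le> exp (- (x * k / (2 ^ (m + 1) * (2 * real v) ^ v)))"
proof -
  interpret D: prob_space D by fact
  let ?E = "edges (complete_graph n)"
  have "light_copy H w q R \<longleftrightarrow> (\<exists>\<phi>\<in>embeddings H R. (`) \<phi> ` edges H \<subseteq> {e \<in> ?E. w e \<le> q})" for w
    using embedding_edge[OF H(1) R(1)] unfolding light_copy_def image_subset_iff by blast
  then have "measure Q {w \<in> space Q. \<not> light_copy H w q R} =
    bern_sum ?E (measure D {..q})
      (\<lambda>S. if \<not> (\<exists>\<phi>\<in>embeddings H R. (`) \<phi> ` edges H \<subseteq> S) then 1 else 0)"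
    using measure_PiM_sublevel_set[OF D, of ?E "\<lambda>S. \<not> (\<exists>\<phi>\<in>embeddings H R. (`) \<phi> ` edges H \<subseteq> S)" q]
    by (simp add: Q_def)
  also have "\<dots> = bern_sum ?E (measure D {..q})
      (\<lambda>S. if \<exists>\<phi>\<in>embeddings H R. (`) \<phi> ` edges H \<subseteq> S then 0 else 1)"
    by (rule bern_sum_cong) auto
  also have "\<dots> \<le> exp (- (x * k / (2 ^ (m + 1) * (2 * real v) ^ v)))"
    unfolding v_def m_def
  proof (rule no_copy_janson[OF H R(1,2)])
    fix F assume "F \<subseteq> edges H" "F \<noteq> {}"
    then show "x * real k \<le> real k ^ card (\<Union>F) * measure D {..q} ^ card F"
      using R x by (intro janson_exponent_ge[OF H(1) d]) auto
  qed (use R x in \<open>auto simp: v_def\<close>)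
  finally show ?thesis .
qed

lemma power_self_le_fact_exp: "real k ^ k \<le> fact k * exp (real k)"
proof -
  have "(\<Sum>i\<in>{k}. real k ^ i /\<^sub>R fact i) \<le> (\<Sum>i. real k ^ i /\<^sub>R fact i)"
    by (rule sum_le_suminf) (auto intro: summable_exp)
  then show ?thesis by (simp add: exp_def field_simps)
qed

lemma binomial_le_exp:
  assumes "1 \<le> k" "k \<le> n"
  shows "real (n choose k) \<le> exp (real k * (1 + ln (real n / real k)))"
proof -
  have "real (n choose k) * fact k \<le> real n ^ k"
    using binomial_fact_pow[of n k] by (metis of_nat_fact of_nat_le_iff of_nat_mult of_nat_power)
  then have "real (n choose k) * (real k ^ k) \<le> real (n choose k) * (fact k * exp (real k))"
    by (intro mult_left_mono power_self_le_fact_exp) simp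
  also have "\<dots> \<le> real n ^ k * exp (real k)"
    using \<open>real (n choose k) * fact k \<le> real n ^ k\<close> by simp
  finally have "real (n choose k) \<le> (real n / real k) ^ k * exp (real k)"
    using assms by (simp add: power_divide field_simps)
  also have "\<dots> = exp (real k * (1 + ln (real n / real k)))"
  proof -
    have "(real n / real k) ^ k = exp (real k * ln (real n / real k))"
      using assms by (simp add: exp_of_nat_mult)
    then show ?thesis by (simp add: exp_add[symmetric] algebra_simps)
  qed
  finally show ?thesis .
qed

text \<open>
  Trades the logarithm in the number of \<open>k\<close>-subsets for a small power.
\<close>

lemma one_plus_ln_le_powr:
  fixes y :: real assumes "0 < \<delta>" "\<delta> \<le> 1" "1 \<le> y"
  shows "1 + ln y \<le> y powr \<delta> / \<delta>"
proof -
  have "\<delta> * (1 + ln y) \<le> 1 + \<delta> * ln y" using assms by (simp add: algebra_simps)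
  also have "\<dots> \<le> y powr \<delta>"
    using assms exp_ge_add_one_self[of "\<delta> * ln y"] by (simp add: powr_def)
  finally show ?thesis using assms by (simp add: field_simps)
qed

text \<open>
  A union bound over all sets of \<open>k\<close> vertices. Their number is at most \<open>exp (k (1 + ln (n / k)))\<close>, and
  the factor \<open>(n / k) powr \<delta>\<close> in the weight level \<open>q\<close>, together with the constant \<open>C\<close>, makes the Janson
  exponent at least twice as large. A level with \<open>ln n\<close> in place of \<open>(n / k) powr \<delta>\<close> would lose
  a logarithm in the order of magnitude of the minimum weight.
\<close>

lemma light_copy_everywhere_prob:
  fixes H :: "'a ugraph" and k :: nat
  defines "v \<equiv> card (verts H)" and "m \<equiv> card (edges H)"
  assumes H: "simple_graph H" "edges H \<noteq> {}" and d: "max_density1 H > 0"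
    and D: "prob_space D" "sets D = sets borel"
    and k: "2 * v \<le> k" "0 < v" "k \<le> n" and \<delta>: "0 < \<delta>" "\<delta> \<le> 1"
  defines "C \<equiv> 2 ^ (m + 3) * (2 * real v) ^ v / \<delta>"
  assumes q: "q = C * (real n / real k) powr \<delta> * real k powr (- 1 / max_density1 H)"
    and low: "q / 2 \<le> measure D {..q}"
  defines "Q \<equiv> PiM (edges (complete_graph n)) (\<lambda>_. D)"
  shows "measure Q {w \<in> space Q. \<exists>R\<subseteq>{..<n}. card R = k \<and> \<not> light_copy H w q R} \<le> exp (- real k)"
proof -
  interpret D: prob_space D by fact
  interpret Q: prob_space Q unfolding Q_def by (intro prob_space_PiM D)
  define c where "c = 2 ^ (m + 1) * (2 * real v) ^ v"
  have c1: "1 \<le> c"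
  proof -
    have "1 \<le> (2 * real v) ^ v" using k by (intro one_le_power) auto
    moreover have "(1::real) \<le> 2 ^ (m + 1)" by (rule one_le_power) simp
    ultimately show ?thesis unfolding c_def using mult_mono[of 1 "2 ^ (m + 1)" 1 "(2 * real v) ^ v"] by simp
  qed
  have Cc: "C = 4 * c / \<delta>" by (simp add: C_def c_def power_add)
  define y where "y = real n / real k"
  have k0: "0 < k" "1 \<le> k" using k by auto
  have y: "1 \<le> y" using k k0 by (simp add: y_def)
  define x where "x = 2 * c / \<delta> * y powr \<delta>"
  have yd: "1 \<le> y powr \<delta>" using y \<delta> by (simp add: ge_one_powr_ge_zero)
  have "1 \<le> c * y powr \<delta> * 1" using mult_mono[of 1 c 1 "y powr \<delta>"] c1 yd by simp
  also have "\<dots> \<le> (c * y powr \<delta>) * (2 / \<delta>)"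
    using \<delta> c1 yd by (intro mult_left_mono) auto
  also have "\<dots> = x" by (simp add: x_def)
  finally have x1: "1 \<le> x" .
  have xq: "x * real k powr (- 1 / max_density1 H) \<le> measure D {..q}"
    using low by (simp add: q Cc x_def y_def)
  have xc: "x * k / c \<ge> 2 * (real k * (1 + ln y))"
  proof -
    have "2 * (real k * (1 + ln y)) \<le> 2 * (real k * (y powr \<delta> / \<delta>))"
      by (intro mult_left_mono one_plus_ln_le_powr \<delta> y) auto
    also have "\<dots> = x * k / c" using c1 by (simp add: x_def)
    finally show ?thesis .
  qed
  define \<R> where "\<R> = {R. R \<subseteq> {..<n} \<and> card R = k}"
  have fin\<R>: "finite \<R>" unfolding \<R>_def by (rule finite_subset[of _ "Pow {..<n}"]) auto
  have card\<R>: "card \<R> = n choose k" unfolding \<R>_def using n_subsets[of "{..<n}" k] by simp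
  have "{w \<in> space Q. \<exists>R\<subseteq>{..<n}. card R = k \<and> \<not> light_copy H w q R} =
      (\<Union>R\<in>\<R>. {w \<in> space Q. \<not> light_copy H w q R})"
    by (auto simp: \<R>_def)
  also have "measure Q \<dots> \<le> (\<Sum>R\<in>\<R>. measure Q {w \<in> space Q. \<not> light_copy H w q R})"
  proof (rule Q.finite_measure_subadditive_finite[OF fin\<R>], rule image_subsetI)
    fix R assume "R \<in> \<R>"
    then have "{w \<in> space Q. light_copy H w q R} \<in> sets Q"
      unfolding Q_def by (intro sets_light_copy H D) (simp add: \<R>_def)
    then show "{w \<in> space Q. \<not> light_copy H w q R} \<in> sets Q" by (rule sets.sets_Collect_neg)
  qed
  also have "\<dots> \<le> (\<Sum>R\<in>\<R>. exp (- (x * k / c)))"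
  proof (rule sum_mono)
    fix R assume "R \<in> \<R>"
    then show "measure Q {w \<in> space Q. \<not> light_copy H w q R} \<le> exp (- (x * k / c))"
      unfolding Q_def c_def v_def m_def using k x1 xq
      by (intro light_copy_compl_prob H d D) (auto simp: \<R>_def v_def)
  qed
  also have "\<dots> = real (n choose k) * exp (- (x * k / c))" by (simp add: card\<R>)
  also have "\<dots> \<le> exp (real k * (1 + ln y)) * exp (- (2 * (real k * (1 + ln y))))"
    using binomial_le_exp[of k n] k k0 xc by (intro mult_mono) (auto simp: y_def)
  also have "\<dots> = exp (- (real k * (1 + ln y)))" by (simp add: exp_add[symmetric])
  also have "\<dots> \<le> exp (- real k)" using y by (simp add: algebra_simps)
  finally show ?thesis .
qed

section \<open>Partial factors and their repair\<close>

lemma simple_complete_graph: "simple_graph (complete_graph n)"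
  by (auto simp: simple_graph_def complete_graph_def)

definition graph_copy :: "('a \<Rightarrow> nat) \<Rightarrow> 'a ugraph \<Rightarrow> nat ugraph" where
  "graph_copy \<phi> H = (\<phi> ` verts H, (\<lambda>e. \<phi> ` e) ` edges H)"

lemma graph_copy_embedding:
  assumes H: "simple_graph H" and R: "R \<subseteq> {..<n}" and \<phi>: "\<phi> \<in> embeddings H R"
  shows "is_subgraph (graph_copy \<phi> H) (complete_graph n)" "graph_isomorphic H (graph_copy \<phi> H)"
    "verts (graph_copy \<phi> H) \<subseteq> R" "card (verts (graph_copy \<phi> H)) = card (verts H)"
    "card (edges (graph_copy \<phi> H)) = card (edges H)"
proof -
  have inj: "inj_on \<phi> (verts H)" and im: "\<phi> ` verts H \<subseteq> R"
    using \<phi> by (auto simp: embeddings_def PiE_def Pi_def)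
  show "verts (graph_copy \<phi> H) \<subseteq> R" using im by (simp add: graph_copy_def)
  show "card (verts (graph_copy \<phi> H)) = card (verts H)" using inj by (simp add: graph_copy_def card_image)
  show "card (edges (graph_copy \<phi> H)) = card (edges H)"
    using card_image_edges[OF H inj] by (simp add: graph_copy_def)
  show "graph_isomorphic H (graph_copy \<phi> H)"
    unfolding graph_isomorphic_def using inj by (intro exI[of _ \<phi>]) (simp add: graph_copy_def bij_betw_def)
  have E: "edges (graph_copy \<phi> H) \<subseteq> edges (complete_graph n)"
    using embedding_edge[OF H R \<phi>] by (auto simp: graph_copy_def)
  moreover have "e \<subseteq> verts (graph_copy \<phi> H)" if "e \<in> edges (graph_copy \<phi> H)" for e
    using that H by (auto simp: graph_copy_def simple_graph_def)
  moreover have "verts (graph_copy \<phi> H) \<subseteq> {..<n}" using im R by (auto simp: graph_copy_def)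
  moreover have "finite (verts H)" using H by (simp add: simple_graph_def)
  ultimately show "is_subgraph (graph_copy \<phi> H) (complete_graph n)"
    by (auto simp: is_subgraph_def simple_graph_def complete_graph_def graph_copy_def)
qed

lemma copy_is_graph_copy:
  assumes H: "simple_graph H" and S: "is_subgraph S (complete_graph n)" "graph_isomorphic H S"
  shows "\<exists>\<phi>\<in>embeddings H (verts S). S = graph_copy \<phi> H"
proof -
  obtain f where f: "bij_betw f (verts H) (verts S)" "edges S = (\<lambda>e. f ` e) ` edges H"
    using S(2) by (auto simp: graph_isomorphic_def)
  define \<phi> where "\<phi> = restrict f (verts H)"
  have img: "\<phi> ` e = f ` e" if "e \<in> edges H" for e
    using H that by (force simp: \<phi>_def simple_graph_def)
  have "\<phi> \<in> embeddings H (verts S)"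
    using f(1) by (auto simp: embeddings_def \<phi>_def bij_betw_def cong: inj_on_cong)
  moreover have "S = graph_copy \<phi> H"
  proof (rule prod_eqI)
    show "verts S = verts (graph_copy \<phi> H)" using f(1) by (simp add: graph_copy_def \<phi>_def bij_betw_def)
    show "edges S = edges (graph_copy \<phi> H)" using img by (simp add: graph_copy_def f(2))
  qed
  ultimately show ?thesis by blast
qed

text \<open>
  The notion of a factor relative to a vertex set \<open>R\<close>, so that partial factors can be cut out, replaced
  and glued together.
\<close>

definition factor_of :: "'a ugraph \<Rightarrow> nat \<Rightarrow> nat set \<Rightarrow> nat ugraph set \<Rightarrow> bool" where
  "factor_of H n R \<F> \<longleftrightarrow>
     (\<forall>S\<in>\<F>. is_subgraph S (complete_graph n) \<and> graph_isomorphic H S) \<and>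
     pairwise (\<lambda>S T. verts S \<inter> verts T = {}) \<F> \<and> (\<Union>S\<in>\<F>. verts S) = R"

lemma is_factor_iff_factor_of: "is_factor H n \<F> \<longleftrightarrow> factor_of H n {..<n} \<F>"
  by (simp add: is_factor_def factor_of_def complete_graph_def)

lemma factor_of_copy:
  assumes "simple_graph H" "factor_of H n R \<F>" "S \<in> \<F>"
  shows "\<exists>\<phi>\<in>embeddings H (verts S). S = graph_copy \<phi> H" "verts S \<subseteq> {..<n}" "verts S \<subseteq> R"
    "edges S \<subseteq> edges (complete_graph n)" "finite (edges S)"
    "card (verts S) = card (verts H)" "card (edges S) = card (edges H)"
proof -
  have S: "is_subgraph S (complete_graph n)" "graph_isomorphic H S"
    using assms(2,3) by (auto simp: factor_of_def)
  show ex: "\<exists>\<phi>\<in>embeddings H (verts S). S = graph_copy \<phi> H"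
    by (rule copy_is_graph_copy[OF assms(1) S])
  show sub: "verts S \<subseteq> {..<n}" using S(1) by (simp add: is_subgraph_def complete_graph_def)
  show "verts S \<subseteq> R" using assms(2,3) by (auto simp: factor_of_def)
  show "edges S \<subseteq> edges (complete_graph n)" using S(1) by (simp add: is_subgraph_def)
  then show "finite (edges S)" by (rule finite_subset) simp
  show "card (verts S) = card (verts H)" "card (edges S) = card (edges H)"
    using ex graph_copy_embedding(4,5)[OF assms(1) sub] by auto
qed

lemma finite_factor_of:
  assumes "factor_of H n R \<F>" shows "finite \<F>"
proof (rule finite_subset)
  show "\<F> \<subseteq> {S. is_subgraph S (complete_graph n)}" using assms by (auto simp: factor_of_def)
qed (rule finite_subgraphs[OF simple_complete_graph])

lemma finite_factors: "finite {\<F>. is_factor H n \<F>}"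
proof (rule finite_subset)
  show "{\<F>. is_factor H n \<F>} \<subseteq> Pow {S. is_subgraph S (complete_graph n)}"
    by (auto simp: is_factor_def)
qed (simp add: finite_subgraphs[OF simple_complete_graph])

lemma card_factor_of:
  assumes "simple_graph H" "factor_of H n R \<F>"
  shows "card R = card (verts H) * card \<F>"
proof -
  have R: "R = (\<Union>S\<in>\<F>. verts S)" using assms(2) by (simp add: factor_of_def)
  have "card R = (\<Sum>S\<in>\<F>. card (verts S))"
    unfolding R
  proof (rule card_UN_disjoint[OF finite_factor_of[OF assms(2)]])
    show "\<forall>S\<in>\<F>. finite (verts S)" using factor_of_copy(2)[OF assms] finite_subset by blast
    show "\<forall>S\<in>\<F>. \<forall>T\<in>\<F>. S \<noteq> T \<longrightarrow> verts S \<inter> verts T = {}"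
      using assms(2) unfolding factor_of_def pairwise_def by blast
  qed
  then show ?thesis using factor_of_copy(6)[OF assms] by simp
qed

lemma factor_of_Un:
  assumes H: "simple_graph H" "0 < card (verts H)"
    and F: "factor_of H n R \<F>" "factor_of H n R' \<G>" and disj: "R \<inter> R' = {}"
  shows "factor_of H n (R \<union> R') (\<F> \<union> \<G>)"
    "factor_weight w (\<F> \<union> \<G>) = factor_weight w \<F> + factor_weight w \<G>"
proof -
  have sub: "verts S \<subseteq> R" if "S \<in> \<F>" for S using F(1) that by (auto simp: factor_of_def)
  have sub': "verts S \<subseteq> R'" if "S \<in> \<G>" for S using F(2) that by (auto simp: factor_of_def)
  have cross: "verts S \<inter> verts T = {}" if "S \<in> \<F>" "T \<in> \<G>" for S T
    using sub[OF that(1)] sub'[OF that(2)] disj by blast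
  have pw: "pairwise (\<lambda>S T. verts S \<inter> verts T = {}) \<F>" "pairwise (\<lambda>S T. verts S \<inter> verts T = {}) \<G>"
    using F by (simp_all add: factor_of_def)
  show "factor_of H n (R \<union> R') (\<F> \<union> \<G>)"
    unfolding factor_of_def
  proof (intro conjI)
    show "\<forall>S\<in>\<F> \<union> \<G>. is_subgraph S (complete_graph n) \<and> graph_isomorphic H S"
      using F unfolding factor_of_def by blast
    show "(\<Union>S\<in>\<F> \<union> \<G>. verts S) = R \<union> R'"
      using F unfolding factor_of_def by simp
    show "pairwise (\<lambda>S T. verts S \<inter> verts T = {}) (\<F> \<union> \<G>)"
    proof (rule pairwiseI)
      fix S T assume "S \<in> \<F> \<union> \<G>" "T \<in> \<F> \<union> \<G>" "S \<noteq> T"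
      then show "verts S \<inter> verts T = {}"
        using cross[of S T] cross[of T S] pairwiseD[OF pw(1), of S T] pairwiseD[OF pw(2), of S T]
        by (elim UnE) (simp_all add: Int_commute)
    qed
  qed
  have "\<F> \<inter> \<G> = {}"
  proof (rule ccontr)
    assume "\<F> \<inter> \<G> \<noteq> {}"
    then obtain S where S: "S \<in> \<F>" "S \<in> \<G>" by auto
    then have "verts S = {}" using sub sub' disj by blast
    then show False using factor_of_copy(6)[OF H(1) F(1) S(1)] H(2) by simp
  qed
  then show "factor_weight w (\<F> \<union> \<G>) = factor_weight w \<F> + factor_weight w \<G>"
    unfolding factor_weight_def by (intro sum.union_disjoint finite_factor_of[OF F(1)] finite_factor_of[OF F(2)])
qed

lemma factor_of_subset:
  assumes "factor_of H n R \<F>" "\<G> \<subseteq> \<F>"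
  shows "factor_of H n (\<Union>S\<in>\<G>. verts S) \<G>"
  using assms pairwise_subset[of "\<lambda>S T. verts S \<inter> verts T = {}" \<F> \<G>]
  unfolding factor_of_def by blast

lemma factor_of_single:
  assumes "simple_graph H" "R \<subseteq> {..<n}" "\<phi> \<in> embeddings H R"
  shows "factor_of H n (verts (graph_copy \<phi> H)) {graph_copy \<phi> H}"
  using graph_copy_embedding[OF assms] by (simp add: factor_of_def)

text \<open>
  Concavity of \<open>k \<mapsto> k powr \<gamma>\<close>, in the form in which a sum of terms \<open>k powr (\<gamma> - 1)\<close> telescopes.
\<close>

lemma powr_concave_step:
  fixes \<gamma> j k :: real
  assumes "0 < \<gamma>" "\<gamma> < 1" "1 \<le> j" "j \<le> k"
  shows "k powr (\<gamma> - 1) + (k - j) powr \<gamma> / \<gamma> \<le> k powr \<gamma> / \<gamma>"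
proof -
  have k: "0 < k" using assms by simp
  have split: "k powr \<gamma> = k * k powr (\<gamma> - 1)" using k by (simp add: powr_diff)
  have "(k - j) powr \<gamma> * k powr (1 - \<gamma>) \<le> k - \<gamma> * j"
  proof (cases "j = k")
    case True
    then show ?thesis using assms k by (simp add: algebra_simps)
  next
    case False
    then have "(k - j) powr \<gamma> * k powr (1 - \<gamma>) \<le> \<gamma> * (k - j) + (1 - \<gamma>) * k"
      using assms k by (intro Youngs_inequality_0) auto
    then show ?thesis by (simp add: algebra_simps)
  qed
  then have "(k - j) powr \<gamma> * k powr (1 - \<gamma>) * k powr (\<gamma> - 1) \<le> (k - \<gamma> * j) * k powr (\<gamma> - 1)"
    by (rule mult_right_mono) simp
  moreover have "k powr (1 - \<gamma>) * k powr (\<gamma> - 1) = 1" using k by (simp flip: powr_add)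
  ultimately have "(k - j) powr \<gamma> \<le> (k - \<gamma> * j) * k powr (\<gamma> - 1)"
    by (simp add: mult.assoc)
  also have "\<dots> \<le> (k - \<gamma>) * k powr (\<gamma> - 1)"
    using assms by (intro mult_right_mono) auto
  also have "\<dots> = k powr \<gamma> - \<gamma> * k powr (\<gamma> - 1)" by (simp add: split algebra_simps)
  finally have "(k - j) powr \<gamma> / \<gamma> \<le> (k powr \<gamma> - \<gamma> * k powr (\<gamma> - 1)) / \<gamma>"
    using assms by (intro divide_right_mono) auto
  then show ?thesis using assms by (simp add: diff_divide_distrib)
qed

lemma embedding_exists:
  assumes "simple_graph H" "finite R" "card (verts H) \<le> card R"
  shows "embeddings H R \<noteq> {}"
proof -
  have "finite (verts H)" using assms(1) by (simp add: simple_graph_def)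
  then obtain f where f: "f ` verts H \<subseteq> R" "inj_on f (verts H)"
    using card_le_inj[OF _ assms(2,3)] by auto
  have "restrict f (verts H) \<in> embeddings H R"
    using f by (auto simp: embeddings_def cong: inj_on_cong)
  then show ?thesis by auto
qed

text \<open>
  Repeatedly split off a light copy. The cost of the copy taken from \<open>k\<close> remaining vertices is
  \<open>A k powr (\<gamma> - 1)\<close> per edge, which sums to at most \<open>A r powr \<gamma> / \<gamma>\<close> from \<open>r\<close> vertices downwards. Once fewer than
  \<open>K\<close> vertices remain, arbitrary copies are taken at cost at most \<open>L\<close> per edge.
\<close>

lemma greedy_factor:
  assumes H: "simple_graph H" "0 < card (verts H)"
    and L: "\<And>e. e \<in> edges (complete_graph n) \<Longrightarrow> w e \<le> L" "0 \<le> L"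
    and A: "0 \<le> A" and \<gamma>: "0 < \<gamma>" "\<gamma> < 1" and K: "0 \<le> K"
    and light: "\<And>R. R \<subseteq> {..<n} \<Longrightarrow> K \<le> real (card R) \<Longrightarrow> R \<noteq> {} \<Longrightarrow>
      light_copy H w (A * real (card R) powr (\<gamma> - 1)) R"
    and R: "R \<subseteq> {..<n}" "card (verts H) dvd card R"
  shows "\<exists>\<F>. factor_of H n R \<F> \<and>
    factor_weight w \<F> \<le> card (edges H) * (A * real (card R) powr \<gamma> / \<gamma> + min (real (card R)) K * L)"
  using R
proof (induction "card R" arbitrary: R rule: less_induct)
  case less
  define v m where "v = card (verts H)" and "m = card (edges H)"
  \<comment> \<open>The claimed cost per edge of \<open>H\<close>, as a potential: a copy must weigh at most its decrease.\<close>
  define cost where "cost = (\<lambda>k::real. A * k powr \<gamma> / \<gamma> + min k K * L)"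
  have finR: "finite R" using less.prems(1) by (rule finite_subset) simp
  show ?case
  proof (cases "R = {}")
    case True
    have "factor_of H n R {}" using True by (simp add: factor_of_def)
    then show ?thesis using True \<gamma> K by (intro exI[of _ "{}"]) (simp add: factor_weight_def)
  next
    case False
    define k where "k = card R"
    have "0 < k" using False finR by (simp add: k_def card_gt_0_iff)
    then have vk: "v \<le> k" using less.prems(2) by (auto simp: v_def k_def dest: dvd_imp_le)
    have v1: "1 \<le> v" using H by (simp add: v_def)
    have step: "\<exists>\<phi>\<in>embeddings H R. \<forall>e\<in>edges H. w (\<phi> ` e) \<le> cost k - cost (real k - real v)"
    proof (cases "K \<le> real k")
      case True
      have "A * real k powr (\<gamma> - 1) \<le> cost k - cost (real k - real v)"
      proof -
        have "A * (real k powr (\<gamma> - 1) + (real k - real v) powr \<gamma> / \<gamma>) \<le> A * (real k powr \<gamma> / \<gamma>)"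
          using vk v1 \<gamma> A by (intro mult_left_mono powr_concave_step) auto
        moreover have "min (real k - real v) K * L \<le> min (real k) K * L"
          using L(2) by (intro mult_right_mono) auto
        ultimately show ?thesis by (simp add: cost_def algebra_simps)
      qed
      moreover have "light_copy H w (A * real k powr (\<gamma> - 1)) R"
        unfolding k_def using True less.prems False by (intro light) (auto simp: k_def)
      ultimately show ?thesis unfolding light_copy_def by (meson order_trans)
    next
      case K: False
      obtain \<phi> where \<phi>: "\<phi> \<in> embeddings H R"
        using embedding_exists[OF H(1) finR] vk by (auto simp: v_def k_def)
      have "L \<le> cost k - cost (real k - real v)"
      proof -
        have "(real k - real v) powr \<gamma> \<le> real k powr \<gamma>"
          using vk \<gamma> by (intro powr_mono2) auto
        then have "A * (real k - real v) powr \<gamma> / \<gamma> \<le> A * real k powr \<gamma> / \<gamma>"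
          using A \<gamma> by (intro divide_right_mono mult_left_mono) auto
        moreover have "L \<le> real v * L" using mult_right_mono[of 1 "real v" L] v1 L(2) by simp
        ultimately show ?thesis using K vk by (simp add: cost_def algebra_simps)
      qed
      then show ?thesis
        using \<phi> L(1) embedding_edge[OF H(1) less.prems(1) \<phi>] by (meson order_trans)
    qed
    then obtain \<phi> where \<phi>: "\<phi> \<in> embeddings H R"
      and w: "\<And>e. e \<in> edges H \<Longrightarrow> w (\<phi> ` e) \<le> cost k - cost (real k - real v)" by blast
    define S where "S = graph_copy \<phi> H"
    note S = graph_copy_embedding[OF H(1) less.prems(1) \<phi>, folded S_def]
    define R' where "R' = R - verts S"
    have cardR': "card R' = k - v"
      unfolding R'_def k_def v_def using S finR by (metis card_Diff_subset finite_subset)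
    have "\<exists>\<F>. factor_of H n R' \<F> \<and> factor_weight w \<F> \<le> card (edges H) *
        (A * real (card R') powr \<gamma> / \<gamma> + min (real (card R')) K * L)"
    proof (rule less.hyps)
      show "card R' < card R" using cardR' v1 vk by (simp add: k_def)
      show "R' \<subseteq> {..<n}" using less.prems by (auto simp: R'_def)
      show "card (verts H) dvd card R'"
        using cardR' less.prems(2) by (simp add: v_def k_def dvd_diff_nat)
    qed
    then obtain \<F> where \<F>: "factor_of H n R' \<F>" "factor_weight w \<F> \<le> m * cost (real k - real v)"
      using cardR' vk by (auto simp: m_def cost_def of_nat_diff)
    have single: "factor_of H n (verts S) {S}"
      unfolding S_def by (rule factor_of_single[OF H(1) less.prems(1) \<phi>])
    have disj: "verts S \<inter> R' = {}" by (auto simp: R'_def)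
    have un: "verts S \<union> R' = R" using S(3) by (auto simp: R'_def)
    have "factor_weight w {S} = (\<Sum>e\<in>edges S. w e)" by (simp add: factor_weight_def)
    also have "\<dots> \<le> real (card (edges S)) * (cost k - cost (real k - real v))"
      by (rule sum_bounded_above) (auto simp: S_def graph_copy_def intro: w)
    finally have "factor_weight w {S} + factor_weight w \<F> \<le> m * cost k"
      using \<F>(2) S(5) by (simp add: m_def algebra_simps)
    then show ?thesis
      using factor_of_Un(1)[OF H single \<F>(1) disj] factor_of_Un(2)[OF H single \<F>(1) disj, of w] unfolding un
      by (intro exI[of _ "{S} \<union> \<F>"]) (simp add: m_def cost_def k_def)
  qed
qed

lemma factor_exists:
  assumes "simple_graph H" "0 < card (verts H)" "card (verts H) dvd n"
  shows "{\<F>. is_factor H n \<F>} \<noteq> {}"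
proof -
  have "\<exists>\<F>. factor_of H n {..<n} \<F> \<and> factor_weight (\<lambda>_. 0) \<F> \<le> card (edges H) *
      (0 * real (card {..<n}) powr (1/2) / (1/2) + min (real (card {..<n})) (real (n + 1)) * 0)"
  proof (rule greedy_factor[OF assms(1,2)])
    fix R assume "R \<subseteq> {..<n}" "real (n + 1) \<le> real (card R)"
    then have False using card_mono[of "{..<n}" R] by simp
    then show "light_copy H (\<lambda>_. 0) (0 * real (card R) powr (1/2 - 1)) R" ..
  qed (use assms in auto)
  then show ?thesis by (auto simp: is_factor_iff_factor_of)
qed

lemma min_factor_weight_le:
  "is_factor H n \<F> \<Longrightarrow> min_factor_weight H n w \<le> factor_weight w \<F>"
  unfolding min_factor_weight_def using finite_factors[where H = H and n = n] by (intro Min_le) auto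

lemma min_factor_weight_attained:
  assumes "{\<F>. is_factor H n \<F>} \<noteq> {}"
  shows "\<exists>\<F>. is_factor H n \<F> \<and> min_factor_weight H n w = factor_weight w \<F>"
proof -
  have "min_factor_weight H n w \<in> factor_weight w ` {\<F>. is_factor H n \<F>}"
    unfolding min_factor_weight_def using finite_factors[where H = H and n = n] assms by (intro Min_in) auto
  then show ?thesis by auto
qed

text \<open>
  Truncation to \<open>[0, t]\<close>. Clipping below at 0 keeps the truncated minimum in a bounded range even where
  some weight is negative.
\<close>

definition clip :: "real \<Rightarrow> real \<Rightarrow> real" where "clip t x = max 0 (min t x)"

lemma factor_weight_nonneg:
  assumes "simple_graph H" "factor_of H n R \<F>" "\<And>e. e \<in> edges (complete_graph n) \<Longrightarrow> 0 \<le> w e"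
  shows "0 \<le> factor_weight w \<F>"
  unfolding factor_weight_def using factor_of_copy(4)[OF assms(1,2)] assms(3)
  by (intro sum_nonneg) blast

lemma factor_weight_mono:
  assumes "simple_graph H" "factor_of H n R \<F>" "\<And>e. e \<in> edges (complete_graph n) \<Longrightarrow> w e \<le> w' e"
  shows "factor_weight w \<F> \<le> factor_weight w' \<F>"
  unfolding factor_weight_def using factor_of_copy(4)[OF assms(1,2)] assms(3)
  by (intro sum_mono) blast

lemma truncated_le:
  assumes H: "simple_graph H" and ex: "{\<F>. is_factor H n \<F>} \<noteq> {}"
    and w: "\<And>e. e \<in> edges (complete_graph n) \<Longrightarrow> 0 \<le> w e"
  shows "min_factor_weight H n (\<lambda>e. clip t (w e)) \<le> min_factor_weight H n w"
proof -
  obtain \<F> where \<F>: "is_factor H n \<F>" "min_factor_weight H n w = factor_weight w \<F>"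
    using min_factor_weight_attained[OF ex] by blast
  have "min_factor_weight H n (\<lambda>e. clip t (w e)) \<le> factor_weight (\<lambda>e. clip t (w e)) \<F>"
    by (rule min_factor_weight_le[OF \<F>(1)])
  also have "\<dots> \<le> factor_weight w \<F>"
    by (rule factor_weight_mono[OF H, of n "{..<n}"]) (use \<F> w in \<open>auto simp: is_factor_iff_factor_of clip_def\<close>)
  finally show ?thesis by (simp add: \<F>(2))
qed

text \<open>
  Take a factor that is optimal for the truncated weights. Each copy with an edge heavier than \<open>t\<close> costs
  at least \<open>t\<close> after truncation, so there are at most \<open>T / t\<close> of them. Discard these copies and cover
  their vertices again; on the copies that are kept, truncation changes nothing.
\<close>

lemma min_le_truncated_plus_patch:
  fixes T t :: real and g :: "nat \<Rightarrow> real"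
  assumes H: "simple_graph H" "0 < card (verts H)" and ex: "{\<F>. is_factor H n \<F>} \<noteq> {}"
    and w: "\<And>e. e \<in> edges (complete_graph n) \<Longrightarrow> 0 \<le> w e" and t: "0 < t"
    and patch: "\<And>R. R \<subseteq> {..<n} \<Longrightarrow> card (verts H) dvd card R \<Longrightarrow>
      \<exists>\<G>. factor_of H n R \<G> \<and> factor_weight w \<G> \<le> g (card R)"
    and T_def: "T = min_factor_weight H n (\<lambda>e. clip t (w e))"
  shows "\<exists>r. real r \<le> card (verts H) * T / t \<and> min_factor_weight H n w \<le> T + g r"
proof -
  obtain \<F> where \<F>: "is_factor H n \<F>" "T = factor_weight (\<lambda>e. clip t (w e)) \<F>"
    using min_factor_weight_attained[OF ex] unfolding T_def by blast
  then have fac: "factor_of H n {..<n} \<F>" by (simp add: is_factor_iff_factor_of)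
  have fin: "finite \<F>" by (rule finite_factor_of[OF fac])
  define B where "B = {S\<in>\<F>. \<exists>e\<in>edges S. t < w e}"
  define R where "R = (\<Union>S\<in>B. verts S)"
  have facB: "factor_of H n R B" and facG: "factor_of H n ({..<n} - R) (\<F> - B)"
  proof -
    have disj: "verts S \<inter> verts S' = {}" if "S \<in> \<F>" "S' \<in> \<F>" "S \<noteq> S'" for S S'
      using fac that unfolding factor_of_def pairwise_def by blast
    show "factor_of H n R B"
      unfolding R_def by (rule factor_of_subset[OF fac]) (auto simp: B_def)
    have "(\<Union>S\<in>\<F> - B. verts S) = {..<n} - R"
    proof
      show "(\<Union>S\<in>\<F> - B. verts S) \<subseteq> {..<n} - R"
      proof
        fix x assume "x \<in> (\<Union>S\<in>\<F> - B. verts S)"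
        then obtain S where S: "S \<in> \<F>" "S \<notin> B" "x \<in> verts S" by auto
        moreover have "x \<notin> verts S'" if "S' \<in> B" for S'
          using disj[of S S'] S that by (auto simp: B_def)
        ultimately show "x \<in> {..<n} - R" using factor_of_copy(2)[OF H(1) fac S(1)] by (auto simp: R_def)
      qed
      show "{..<n} - R \<subseteq> (\<Union>S\<in>\<F> - B. verts S)"
        using fac unfolding factor_of_def R_def by blast
    qed
    then show "factor_of H n ({..<n} - R) (\<F> - B)"
      using factor_of_subset[OF fac, of "\<F> - B"] by simp
  qed
  have clip0: "0 \<le> clip t x" for x by (simp add: clip_def)
  have "real (card B) * t \<le> (\<Sum>S\<in>B. \<Sum>e\<in>edges S. clip t (w e))"
  proof (rule sum_bounded_below)
    fix S assume S: "S \<in> B"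
    then obtain e where e: "e \<in> edges S" "t < w e" by (auto simp: B_def)
    have "t = clip t (w e)" using e t by (simp add: clip_def)
    also have "\<dots> \<le> (\<Sum>e\<in>edges S. clip t (w e))"
      using e factor_of_copy(5)[OF H(1) facB S] by (intro member_le_sum clip0) auto
    finally show "t \<le> (\<Sum>e\<in>edges S. clip t (w e))" .
  qed
  also have "\<dots> \<le> T"
    unfolding \<F>(2) factor_weight_def using fin by (intro sum_mono2 sum_nonneg clip0) (auto simp: B_def)
  finally have cardB: "real (card B) \<le> T / t" using t by (simp add: field_simps)
  have cardR: "card R = card (verts H) * card B" by (rule card_factor_of[OF H(1) facB])
  have Rn: "R \<subseteq> {..<n}" using factor_of_copy(2)[OF H(1) fac] by (auto simp: R_def B_def)
  obtain \<G> where \<G>: "factor_of H n R \<G>" "factor_weight w \<G> \<le> g (card R)"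
    using patch[OF Rn] cardR by auto
  have disj: "({..<n} - R) \<inter> R = {}" and un: "({..<n} - R) \<union> R = {..<n}" using Rn by auto
  have "is_factor H n ((\<F> - B) \<union> \<G>)"
    using factor_of_Un(1)[OF H facG \<G>(1) disj] un by (simp add: is_factor_iff_factor_of)
  then have "min_factor_weight H n w \<le> factor_weight w ((\<F> - B) \<union> \<G>)"
    by (rule min_factor_weight_le)
  also have "\<dots> = factor_weight w (\<F> - B) + factor_weight w \<G>"
    by (rule factor_of_Un(2)[OF H facG \<G>(1) disj])
  also have "factor_weight w (\<F> - B) \<le> T"
  proof -
    have "factor_weight w (\<F> - B) = (\<Sum>S\<in>\<F> - B. \<Sum>e\<in>edges S. clip t (w e))"
      unfolding factor_weight_def
    proof (intro sum.cong refl)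
      fix S e assume S: "S \<in> \<F> - B" and e: "e \<in> edges S"
      have "0 \<le> w e" using factor_of_copy(4)[OF H(1) facG S] e w by blast
      moreover have "w e \<le> t" using S e by (auto simp: B_def)
      ultimately show "w e = clip t (w e)" by (simp add: clip_def)
    qed
    also have "\<dots> \<le> T"
      unfolding \<F>(2) factor_weight_def using fin by (intro sum_mono2 sum_nonneg clip0) auto
    finally show ?thesis .
  qed
  finally have "min_factor_weight H n w \<le> T + g (card R)" using \<G>(2) by simp
  moreover have "real (card R) \<le> card (verts H) * T / t"
    using mult_left_mono[OF cardB, of "real (card (verts H))"] by (simp add: cardR)
  ultimately show ?thesis by blast
qed

text \<open>
  Only one copy of a factor contains the vertex \<open>i\<close>, and its truncated weight lies between 0 and
  \<open>card (edges H) * t\<close>.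
\<close>

lemma truncated_vertex_oscillation:
  fixes t :: real
  assumes H: "simple_graph H" and ex: "{\<F>. is_factor H n \<F>} \<noteq> {}" and t: "0 \<le> t"
    and agree: "\<And>e. e \<in> edges (complete_graph n) \<Longrightarrow> i \<notin> e \<Longrightarrow> w e = w' e"
  shows "min_factor_weight H n (\<lambda>e. clip t (w e)) \<le> min_factor_weight H n (\<lambda>e. clip t (w' e)) + real (card (edges H)) * t"
proof -
  obtain \<F> where \<F>: "is_factor H n \<F>"
      "min_factor_weight H n (\<lambda>e. clip t (w' e)) = factor_weight (\<lambda>e. clip t (w' e)) \<F>"
    using min_factor_weight_attained[OF ex] by blast
  then have fac: "factor_of H n {..<n} \<F>" by (simp add: is_factor_iff_factor_of)
  have fin: "finite \<F>" by (rule finite_factor_of[OF fac])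
  define \<delta> where "\<delta> = (\<lambda>S. \<Sum>e\<in>edges S. clip t (w e) - clip t (w' e))"
  define I where "I = {S\<in>\<F>. i \<in> verts S}"
  have "\<delta> S = 0" if S: "S \<in> \<F> - I" for S
    unfolding \<delta>_def
  proof (rule sum.neutral, rule ballI)
    fix e assume e: "e \<in> edges S"
    have "is_subgraph S (complete_graph n)" using fac S by (simp add: factor_of_def)
    then have "e \<subseteq> verts S" using e by (simp add: is_subgraph_def simple_graph_def)
    then have "i \<notin> e" using S by (auto simp: I_def)
    moreover have "e \<in> edges (complete_graph n)" using factor_of_copy(4)[OF H fac] S e by blast
    ultimately show "clip t (w e) - clip t (w' e) = 0" using agree by simp
  qed
  then have "(\<Sum>S\<in>\<F>. \<delta> S) = (\<Sum>S\<in>I. \<delta> S)"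
    using fin by (intro sum.mono_neutral_right) (auto simp: I_def)
  also have "\<dots> \<le> real (card I) * (card (edges H) * t)"
  proof (rule sum_bounded_above)
    fix S assume "S \<in> I"
    then have "card (edges S) = card (edges H)" using factor_of_copy(7)[OF H fac] by (simp add: I_def)
    moreover have "\<delta> S \<le> real (card (edges S)) * t"
      unfolding \<delta>_def by (rule sum_bounded_above) (use t in \<open>auto simp: clip_def\<close>)
    ultimately show "\<delta> S \<le> card (edges H) * t" by simp
  qed
  also have "\<dots> \<le> card (edges H) * t"
  proof -
    have "S = T" if "S \<in> I" "T \<in> I" for S T
      using that fac unfolding I_def factor_of_def pairwise_def by blast
    then have "card I \<le> 1" using fin by (auto simp: card_le_Suc0_iff_eq I_def)
    then show ?thesis using t mult_right_mono[of "real (card I)" 1 "card (edges H) * t"] by simp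
  qed
  finally have "factor_weight (\<lambda>e. clip t (w e)) \<F> - factor_weight (\<lambda>e. clip t (w' e)) \<F> \<le> card (edges H) * t"
    by (simp add: factor_weight_def \<delta>_def sum_subtractf)
  then show ?thesis using min_factor_weight_le[OF \<F>(1), of "\<lambda>e. clip t (w e)"] \<F>(2) by simp
qed

section \<open>Random edge weights\<close>

text \<open>
  The common features of the two weight distributions on which the argument relies: mass near 0
  comparable with the Lebesgue measure, and an exponential tail. The first bound at \<open>x = 0\<close> makes
  the weights positive almost surely.
\<close>

definition admissible_law :: "real measure \<Rightarrow> bool" where
  "admissible_law D \<longleftrightarrow> prob_space D \<and> sets D = sets borel \<and>
     (\<forall>x\<ge>0. measure D {..x} \<le> x) \<and> (\<forall>x\<in>{0..1}. x / 2 \<le> measure D {..x}) \<and>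
     (\<forall>x\<ge>0. measure D {x<..} \<le> exp (- x))"

lemma admissible_law_uniform: "admissible_law (uniform_measure lborel {0..1})"
proof -
  let ?U = "uniform_measure lborel {0..1::real}"
  have prob: "prob_space ?U" by (rule prob_space_uniform_measure) auto
  have m: "measure ?U B = measure lborel ({0..1} \<inter> B)" if "B \<in> sets borel" for B
    using that by simp
  have low: "measure ?U {..x} = min x 1" if "0 \<le> x" for x
  proof -
    have "{0..1} \<inter> {..x} = {0..min x 1}" using that by auto
    then show ?thesis using that by (simp add: m)
  qed
  have high: "measure ?U {x<..} \<le> exp (- x)" if x: "0 \<le> x" for x
  proof (cases "x \<le> 1")
    case True
    have "{0..1} \<inter> {x<..} = {x<..1}" using x by auto
    then have "measure ?U {x<..} = 1 - x" using True by (simp add: m)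
    then show ?thesis using exp_ge_add_one_self[of "- x"] by simp
  next
    case False
    then have "{0..1} \<inter> {x<..} = {}" by auto
    then show ?thesis by (simp add: m)
  qed
  show ?thesis unfolding admissible_law_def using prob low high by auto
qed

lemma admissible_law_exponential:
  "admissible_law (density lborel (\<lambda>x. ennreal (exponential_density 1 x)))"
proof -
  define D where "D = density lborel (\<lambda>x. ennreal (exponential_density 1 x))"
  have D: "prob_space D" unfolding D_def by (rule prob_space_exponential_density) simp
  interpret prob_space D by (rule D)
  have sD: "sets D = sets borel" "space D = UNIV" by (simp_all add: D_def)
  have "distr D lborel (\<lambda>x. x) = D"
    by (rule distr_id2) (simp add: sD)
  then have dist: "distributed D lborel (\<lambda>x. x) (exponential_density 1)"
    unfolding distributed_def D_def by auto
  have low: "measure D {..x} = 1 - exp (- x)" if "0 \<le> x" for x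
  proof -
    have "{y \<in> space D. y \<le> x} = {..x}" by (auto simp: sD)
    then show ?thesis using exponential_distributedD_le[OF dist that] by simp
  qed
  have high: "measure D {x<..} = exp (- x)" if "0 \<le> x" for x
  proof -
    have "{y \<in> space D. x < y} = {x<..}" by (auto simp: sD)
    then show ?thesis using exponential_distributedD_gt[OF dist that] by simp
  qed
  have ge: "x / 2 \<le> 1 - exp (- x)" if "x \<in> {0..1}" for x :: real
  proof -
    have "x * x \<le> x * 1" using that by (intro mult_left_mono) auto
    then have "1 \<le> (1 - x / 2) * (1 + x)" by (simp add: algebra_simps)
    also have "\<dots> \<le> (1 - x / 2) * exp x" using that by (intro mult_left_mono exp_ge_add_one_self) auto
    finally have "exp (- x) \<le> 1 - x / 2" by (simp add: exp_minus field_simps)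
    then show ?thesis by simp
  qed
  have "admissible_law D"
    unfolding admissible_law_def
  proof (intro conjI allI ballI impI D sD)
    fix x :: real assume x: "0 \<le> x"
    show "measure D {..x} \<le> x" using low[OF x] exp_ge_add_one_self[of "- x"] by simp
    show "measure D {x<..} \<le> exp (- x)" using high[OF x] by simp
  next
    fix x :: real assume "x \<in> {0..1}"
    then show "x / 2 \<le> measure D {..x}" using low[of x] ge[of x] by simp
  qed
  then show ?thesis by (simp add: D_def)
qed

lemma has_cycle_card_verts:
  assumes "simple_graph H" "has_cycle H" shows "3 \<le> card (verts H)"
proof -
  obtain G where "is_subgraph G H" "3 \<le> card (verts G)"
    using has_cycle_dense_subgraph[OF assms] by auto
  moreover have "finite (verts H)" using assms by (simp add: simple_graph_def)
  ultimately show ?thesis using card_mono[of "verts H" "verts G"] by (simp add: is_subgraph_def)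
qed

locale random_weights =
  fixes H :: "'a ugraph" and D :: "real measure" and n :: nat
  assumes H: "simple_graph H" "has_cycle H" and law: "admissible_law D"
    and n: "card (verts H) dvd n" "0 < n"
begin

abbreviation "E \<equiv> edges (complete_graph n)"
abbreviation "v \<equiv> card (verts H)"
abbreviation "m \<equiv> card (edges H)"
abbreviation "d \<equiv> max_density1 H"
definition "Q = PiM E (\<lambda>_. D)"

lemma D: "prob_space D" "sets D = sets borel" and D_le: "0 \<le> x \<Longrightarrow> measure D {..x} \<le> x"
  and D_ge: "0 \<le> x \<Longrightarrow> x \<le> 1 \<Longrightarrow> x / 2 \<le> measure D {..x}"
  and D_tail: "0 \<le> x \<Longrightarrow> measure D {x<..} \<le> exp (- x)"
  using law by (auto simp: admissible_law_def)

sublocale Q: prob_space Q unfolding Q_def by (intro prob_space_PiM D)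

lemma d_gt_1: "1 < d" by (rule max_density1_gt_1[OF H])

lemma v_ge_3: "3 \<le> v" by (rule has_cycle_card_verts[OF H])

lemma edges_nonempty: "edges H \<noteq> {}"
proof -
  obtain G where "is_subgraph G H" "3 \<le> card (verts G)" "card (edges G) = card (verts G)"
    using has_cycle_dense_subgraph[OF H] by auto
  then show ?thesis by (auto simp: is_subgraph_def)
qed

lemma factors_nonempty: "{\<F>. is_factor H n \<F>} \<noteq> {}"
  by (rule factor_exists) (use H n v_ge_3 in auto)

lemma weight_measurable: "e \<in> E \<Longrightarrow> (\<lambda>w. w e) \<in> borel_measurable Q"
  using measurable_component_singleton[of e E "\<lambda>_. D"] D(2) unfolding Q_def
  by (metis measurable_cong_sets)

lemma weight_prob:
  assumes "e \<in> E" "A \<in> sets borel"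
  shows "measure Q {w \<in> space Q. w e \<in> A} = measure D A"
proof -
  have meas: "(\<lambda>w. w e) \<in> measurable Q D"
    unfolding Q_def using assms(1) by (rule measurable_component_singleton)
  have "distr Q D (\<lambda>w. w e) = D"
    unfolding Q_def using distr_PiM_component[of E "\<lambda>_. D" e] D assms(1) by simp
  then have "measure D A = measure (distr Q D (\<lambda>w. w e)) A" by simp
  also have "\<dots> = measure Q ((\<lambda>w. w e) -` A \<inter> space Q)"
    using meas assms(2) D(2) by (intro measure_distr) auto
  also have "(\<lambda>w. w e) -` A \<inter> space Q = {w \<in> space Q. w e \<in> A}" by auto
  finally show ?thesis ..
qed

lemma card_E_le: "card E \<le> n ^ 2"
proof -
  have "E = {e. e \<subseteq> {..<n} \<and> card e = 2}" by (simp add: complete_graph_def)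
  then have "card E = n choose 2" using n_subsets[of "{..<n}" 2] by simp
  also have "\<dots> \<le> n ^ 2" using binomial_fact_pow[of n 2] by (simp add: fact_2)
  finally show ?thesis .
qed

definition "out_of_range L = {w \<in> space Q. \<exists>e\<in>E. w e < 0 \<or> L < w e}"

lemma sets_out_of_range: "out_of_range L \<in> sets Q"
  unfolding out_of_range_def
proof (intro sets.sets_Collect_finite_Ex)
  fix e assume "e \<in> E"
  note [measurable] = weight_measurable[OF this]
  show "{w \<in> space Q. w e < 0 \<or> L < w e} \<in> sets Q" by measurable
qed simp

lemma prob_out_of_range:
  assumes L: "0 \<le> L"
  shows "measure Q (out_of_range L) \<le> real n ^ 2 * exp (- L)"
proof -
  have D0: "measure D {..<0} \<le> 0"
  proof -
    interpret D: prob_space D by (rule D)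
    have "measure D {..<0} \<le> measure D {..0}" by (rule D.finite_measure_mono) (auto simp: D)
    then show ?thesis using D_le[of 0] by simp
  qed
  have sets1: "{w \<in> space Q. w e < 0 \<or> L < w e} \<in> sets Q" if "e \<in> E" for e
  proof -
    note [measurable] = weight_measurable[OF that]
    show ?thesis by measurable
  qed
  have "out_of_range L = (\<Union>e\<in>E. {w \<in> space Q. w e < 0 \<or> L < w e})"
    by (auto simp: out_of_range_def)
  also have "measure Q \<dots> \<le> (\<Sum>e\<in>E. measure Q {w \<in> space Q. w e < 0 \<or> L < w e})"
    using sets1 by (intro Q.finite_measure_subadditive_finite) auto
  also have "\<dots> \<le> (\<Sum>e\<in>E. exp (- L))"
  proof (rule sum_mono)
    fix e assume e: "e \<in> E"
    have "measure Q {w \<in> space Q. w e < 0 \<or> L < w e} = measure Q {w \<in> space Q. w e \<in> {..<0} \<union> {L<..}}"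
      by simp
    also have "\<dots> = measure D ({..<0} \<union> {L<..})" by (rule weight_prob[OF e]) simp
    also have "\<dots> \<le> measure D {..<0} + measure D {L<..}"
      by (rule measure_Un_le) (simp_all add: D)
    also have "\<dots> \<le> exp (- L)" using D0 D_tail[OF L] by simp
    finally show "measure Q {w \<in> space Q. w e < 0 \<or> L < w e} \<le> exp (- L)" .
  qed
  also have "\<dots> = real (card E) * exp (- L)" by simp
  also have "\<dots> \<le> real n ^ 2 * exp (- L)"
    using card_E_le by (intro mult_right_mono) (simp_all flip: of_nat_power)
  finally show ?thesis .
qed

definition "no_light_copy K q =
  {w \<in> space Q. \<exists>k\<in>{k. K \<le> real k \<and> k \<le> n}. \<exists>R\<subseteq>{..<n}. card R = k \<and> \<not> light_copy H w (q k) R}"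

lemma prob_no_light_copy:
  fixes K \<delta> :: real and q :: "nat \<Rightarrow> real"
  assumes K: "2 * v \<le> K" and \<delta>: "0 < \<delta>" "\<delta> \<le> 1"
  defines "C \<equiv> 2 ^ (m + 3) * (2 * real v) ^ v / \<delta>"
  assumes q: "\<And>k. K \<le> real k \<Longrightarrow> k \<le> n \<Longrightarrow> q k = C * (real n / real k) powr \<delta> * real k powr (- 1 / d)"
    and q1: "\<And>k. K \<le> real k \<Longrightarrow> k \<le> n \<Longrightarrow> q k \<le> 1"
  shows "no_light_copy K q \<in> sets Q" "measure Q (no_light_copy K q) \<le> (real n + 1) * exp (- K)"
proof -
  define N where "N = (\<lambda>k. {w \<in> space Q. \<exists>R\<subseteq>{..<n}. card R = k \<and> \<not> light_copy H w (q k) R})"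
  define I where "I = {k. K \<le> real k \<and> k \<le> n}"
  have finI: "finite I" unfolding I_def by (rule finite_subset[of _ "{..n}"]) auto
  have setsN: "N k \<in> sets Q" for k
  proof -
    have "N k = {w \<in> space Q. \<exists>R\<in>{R. R \<subseteq> {..<n} \<and> card R = k}. \<not> light_copy H w (q k) R}"
      by (auto simp: N_def)
    also have "\<dots> \<in> sets Q"
    proof (intro sets.sets_Collect_finite_Ex sets.sets_Collect_neg)
      show "finite {R. R \<subseteq> {..<n} \<and> card R = k}" by (rule finite_subset[of _ "Pow {..<n}"]) auto
    qed (use sets_light_copy[OF H(1) D(2)] in \<open>auto simp: Q_def\<close>)
    finally show ?thesis .
  qed
  have un: "no_light_copy K q = (\<Union>k\<in>I. N k)" by (auto simp: no_light_copy_def N_def I_def)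
  show "no_light_copy K q \<in> sets Q" unfolding un using finI setsN by auto
  have "measure Q (no_light_copy K q) \<le> (\<Sum>k\<in>I. measure Q (N k))"
    unfolding un using finI setsN by (intro Q.finite_measure_subadditive_finite) auto
  also have "\<dots> \<le> (\<Sum>k\<in>I. exp (- K))"
  proof (rule sum_mono)
    fix k assume "k \<in> I"
    then have k: "K \<le> real k" "k \<le> n" by (auto simp: I_def)
    have "0 \<le> C" using \<delta> by (simp add: C_def)
    then have q0: "0 \<le> q k" using q[OF k] by simp
    have "measure Q (N k) \<le> exp (- real k)"
      unfolding N_def Q_def
    proof (rule light_copy_everywhere_prob[OF H(1) edges_nonempty _ D _ _ _ \<delta>])
      show "q k = 2 ^ (m + 3) * (2 * real v) ^ v / \<delta> * (real n / real k) powr \<delta> * real k powr (- 1 / d)"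
        using q[OF k] by (simp add: C_def)
      show "q k / 2 \<le> measure D {..q k}" using q0 q1[OF k] by (rule D_ge)
    qed (use d_gt_1 v_ge_3 k K in auto)
    also have "\<dots> \<le> exp (- K)" using k by simp
    finally show "measure Q (N k) \<le> exp (- K)" .
  qed
  also have "\<dots> = real (card I) * exp (- K)" by simp
  also have "\<dots> \<le> (real n + 1) * exp (- K)"
  proof -
    have "card I \<le> card {..n}" unfolding I_def by (intro card_mono) auto
    then show ?thesis by (intro mult_right_mono) auto
  qed
  finally show "measure Q (no_light_copy K q) \<le> (real n + 1) * exp (- K)" by simp
qed

definition "truncated t w = min_factor_weight H n (\<lambda>e. clip t (w e))"

lemma truncated_measurable: "truncated t \<in> borel_measurable Q"
proof -
  have "(\<lambda>w. Min ((\<lambda>\<F>. factor_weight (\<lambda>e. clip t (w e)) \<F>) ` {\<F>. is_factor H n \<F>})) \<in> borel_measurable Q"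
  proof (rule borel_measurable_Min[OF finite_factors])
    fix \<F> assume "\<F> \<in> {\<F>. is_factor H n \<F>}"
    then have fac: "factor_of H n {..<n} \<F>" by (simp add: is_factor_iff_factor_of)
    have "(\<lambda>w. clip t (w e)) \<in> borel_measurable Q" if "S \<in> \<F>" "e \<in> edges S" for S e
    proof -
      have "e \<in> E" using factor_of_copy(4)[OF H(1) fac that(1)] that(2) by blast
      note [measurable] = weight_measurable[OF this]
      show ?thesis unfolding clip_def by measurable
    qed
    then show "(\<lambda>w. factor_weight (\<lambda>e. clip t (w e)) \<F>) \<in> borel_measurable Q"
      unfolding factor_weight_def by (intro borel_measurable_sum)
  qed
  moreover have "truncated t = (\<lambda>w. Min ((\<lambda>\<F>. factor_weight (\<lambda>e. clip t (w e)) \<F>) ` {\<F>. is_factor H n \<F>}))"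
    by (simp add: fun_eq_iff truncated_def min_factor_weight_def)
  ultimately show ?thesis by simp
qed

lemma truncated_bounded: "\<exists>b. \<forall>w. \<bar>truncated t w\<bar> \<le> b"
proof -
  obtain \<F> where \<F>: "is_factor H n \<F>" using factors_nonempty by blast
  have up: "truncated t w \<le> (\<Sum>S\<in>\<F>. \<Sum>e\<in>edges S. \<bar>t\<bar>)" for w
  proof -
    have "truncated t w \<le> factor_weight (\<lambda>e. clip t (w e)) \<F>"
      unfolding truncated_def by (rule min_factor_weight_le[OF \<F>])
    also have "\<dots> \<le> (\<Sum>S\<in>\<F>. \<Sum>e\<in>edges S. \<bar>t\<bar>)"
      unfolding factor_weight_def by (intro sum_mono) (auto simp: clip_def)
    finally show ?thesis .
  qed
  have "0 \<le> truncated t w" for w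
  proof -
    obtain \<F> where \<F>: "is_factor H n \<F>" "truncated t w = factor_weight (\<lambda>e. clip t (w e)) \<F>"
      using min_factor_weight_attained[OF factors_nonempty] unfolding truncated_def by blast
    then show ?thesis
      using factor_weight_nonneg[OF H(1), of n "{..<n}" \<F> "\<lambda>e. clip t (w e)"]
      by (simp add: is_factor_iff_factor_of clip_def)
  qed
  then show ?thesis using up by (metis abs_of_nonneg)
qed

definition "mean t = (\<integral>w. truncated t w \<partial>Q)"

definition "deviation t a = {w \<in> space Q. a \<le> \<bar>truncated t w - mean t\<bar>}"

lemma sets_deviation: "deviation t a \<in> sets Q"
proof -
  note [measurable] = truncated_measurable[of t]
  show ?thesis unfolding deviation_def by measurable
qed

text \<open>
  Vertex exposure: the edges are grouped by their larger endpoint, so that each of the \<open>n\<close> blocks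
  consists of edges at one vertex, and Chebyshev's inequality is applied to the resulting variance
  bound.
\<close>

lemma prob_deviation:
  fixes t a :: real
  assumes t: "0 \<le> t" and a: "0 < a"
  shows "measure Q (deviation t a) \<le> real n * (real m * t)\<^sup>2 / a\<^sup>2"
proof -
  obtain b where b: "\<And>w. \<bar>truncated t w\<bar> \<le> b" using truncated_bounded by blast
  note meas[measurable] = truncated_measurable[of t]
  have int: "integrable Q (truncated t)"
    by (rule Q.integrable_const_bound[where B = b]) (auto simp: b)
  have int2: "integrable Q (\<lambda>w. (truncated t w)\<^sup>2)"
    by (rule Q.integrable_const_bound[where B = "b\<^sup>2"]) (auto intro!: AE_I2 square_le_of_abs_le b)
  \<comment> \<open>The block of \<open>i\<close> holds the edges from \<open>i\<close> to smaller vertices.\<close>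
  define B where "B = (\<lambda>i. {e \<in> E. Max e = i})"
  have Max_in_e: "Max e \<in> e" if "e \<in> E" for e
  proof -
    have "card e = 2" using that by (simp add: complete_graph_def)
    then show ?thesis by (intro Max_in) (auto intro: card_ge_0_finite)
  qed
  have UB: "(\<Union>i<n. B i) = E"
  proof
    show "E \<subseteq> (\<Union>i<n. B i)"
    proof
      fix e assume e: "e \<in> E"
      then have "Max e < n" using Max_in_e[OF e] by (auto simp: complete_graph_def)
      then show "e \<in> (\<Union>i<n. B i)" using e by (auto simp: B_def)
    qed
  qed (auto simp: B_def)
  have "(\<integral>w. (truncated t w)\<^sup>2 \<partial>PiM (\<Union>i<n. B i) (\<lambda>_. D)) \<le>
      (\<integral>w. truncated t w \<partial>PiM (\<Union>i<n. B i) (\<lambda>_. D))\<^sup>2 + real n * (real m * t)\<^sup>2"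
  proof (rule second_moment_bounded_differences[OF D(1)])
    show "finite (B i)" for i by (rule finite_subset[of _ E]) (auto simp: B_def)
    show "B i \<inter> B j = {}" if "i \<noteq> j" for i j using that by (auto simp: B_def)
    show "truncated t \<in> borel_measurable (PiM (\<Union>i<n. B i) (\<lambda>_. D))"
      unfolding UB using meas by (simp add: Q_def)
    show "\<bar>truncated t x\<bar> \<le> b" for x :: "nat set \<Rightarrow> real" by (rule b)
    fix i and x y :: "nat set \<Rightarrow> real" assume "i < n" and eq: "\<And>j. j \<in> (\<Union>i<n. B i) - B i \<Longrightarrow> x j = y j"
    have agree: "x e = y e" if "e \<in> E" "i \<notin> e" for e
      using eq[of e] that Max_in_e[of e] unfolding UB by (auto simp: B_def)
    show "\<bar>truncated t x - truncated t y\<bar> \<le> real m * t"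
      using truncated_vertex_oscillation[OF H(1) factors_nonempty t, of i x y]
        truncated_vertex_oscillation[OF H(1) factors_nonempty t, of i y x] agree
      by (fastforce simp: truncated_def abs_le_iff)
  qed
  then have "Q.variance (truncated t) \<le> real n * (real m * t)\<^sup>2"
    using Q.variance_eq[OF int int2] unfolding UB by (simp add: Q_def)
  moreover have "measure Q (deviation t a) \<le> Q.variance (truncated t) / a\<^sup>2"
    unfolding deviation_def mean_def by (rule Q.Chebyshev_inequality[OF meas int2 a])
  ultimately show ?thesis by (meson divide_right_mono order_trans zero_le_power2)
qed

definition "light_embeddings G s w = card {\<phi> \<in> embeddings G {..<n}. \<forall>e\<in>edges G. w (\<phi> ` e) \<le> s}"

definition "many_light G s = {w \<in> space Q. n / (2 * v) \<le> real (light_embeddings G s w)}"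

lemma light_embeddings_eq_sum:
  assumes "simple_graph G"
  shows "real (light_embeddings G s w) =
    (\<Sum>\<phi>\<in>embeddings G {..<n}. indicator {w. \<forall>e\<in>edges G. w (\<phi> ` e) \<le> s} w)"
  using finite_embeddings[OF assms, of "{..<n}"]
  by (simp add: light_embeddings_def indicator_def sum.If_cases Int_def)

text \<open>
  The first moment method: an embedding of \<open>G\<close> has all edges of weight at most \<open>s\<close> with probability at most
  \<open>s ^ card (edges G)\<close>; then Markov's inequality.
\<close>

lemma prob_many_light:
  assumes G: "simple_graph G" and s: "0 \<le> s"
  shows "many_light G s \<in> sets Q"
    "measure Q (many_light G s) \<le> real n ^ card (verts G) * s ^ card (edges G) * (2 * v / n)"
proof -
  define A where "A = (\<lambda>\<phi>. {w \<in> space Q. \<forall>e\<in>edges G. w (\<phi> ` e) \<le> s})"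
  have fin: "finite (embeddings G {..<n})" using G by (intro finite_embeddings) auto
  have setsA: "A \<phi> \<in> sets Q" if \<phi>: "\<phi> \<in> embeddings G {..<n}" for \<phi>
    unfolding A_def
  proof (intro sets.sets_Collect_finite_All finite_edges[OF G])
    fix e assume "e \<in> edges G"
    note [measurable] = weight_measurable[OF embedding_edge[OF G order.refl \<phi> this]]
    show "{w \<in> space Q. w (\<phi> ` e) \<le> s} \<in> sets Q" by measurable
  qed
  define X where "X = (\<lambda>w. \<Sum>\<phi>\<in>embeddings G {..<n}. indicator (A \<phi>) w :: real)"
  have X: "real (light_embeddings G s w) = X w" if "w \<in> space Q" for w
    unfolding light_embeddings_eq_sum[OF G] X_def
    using that by (intro sum.cong) (auto simp: A_def indicator_def)
  have intA: "integrable Q (indicator (A \<phi>) :: _ \<Rightarrow> real)" if "\<phi> \<in> embeddings G {..<n}" for \<phi>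
    using setsA[OF that] by (simp add: integrable_indicator_iff Q.emeasure_eq_measure)
  have intX: "integrable Q X" unfolding X_def using intA by (intro Bochner_Integration.integrable_sum)
  have many: "many_light G s = {w \<in> space Q. n / (2 * v) \<le> X w}"
    using X by (auto simp: many_light_def)
  have [measurable]: "X \<in> borel_measurable Q" using intX by simp
  show "many_light G s \<in> sets Q" unfolding many by measurable
  have "(\<integral>w. X w \<partial>Q) = (\<Sum>\<phi>\<in>embeddings G {..<n}. measure Q (A \<phi>))"
    unfolding X_def using intA setsA sets.sets_into_space[OF setsA]
    by (subst Bochner_Integration.integral_sum) (auto intro!: sum.cong simp: Int_absorb2 Int_absorb1)
  also have "\<dots> \<le> (\<Sum>\<phi>\<in>embeddings G {..<n}. s ^ card (edges G))"
  proof (rule sum_mono)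
    fix \<phi> assume \<phi>: "\<phi> \<in> embeddings G {..<n}"
    then have inj: "inj_on \<phi> (verts G)" by (simp add: embeddings_def)
    have "A \<phi> = {w \<in> space Q. \<forall>e\<in>(`) \<phi> ` edges G. w e \<le> s}" by (auto simp: A_def)
    then have "measure Q (A \<phi>) = measure D {..s} ^ card ((`) \<phi> ` edges G)"
      using measure_PiM_sublevel_superset[OF D, of E "(`) \<phi> ` edges G" s] embedding_edge[OF G order.refl \<phi>]
      by (simp add: Q_def image_subset_iff)
    also have "\<dots> \<le> s ^ card (edges G)"
      unfolding card_image_edges[OF G inj] using D_le[OF s] by (intro power_mono) auto
    finally show "measure Q (A \<phi>) \<le> s ^ card (edges G)" .
  qed
  also have "\<dots> = real (card (embeddings G {..<n})) * s ^ card (edges G)" by simp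
  also have "\<dots> \<le> real n ^ card (verts G) * s ^ card (edges G)"
  proof (rule mult_right_mono)
    have "finite (verts G)" using G by (simp add: simple_graph_def)
    then have "card (verts G \<rightarrow>\<^sub>E {..<n}) = n ^ card (verts G)" "finite (verts G \<rightarrow>\<^sub>E {..<n})"
      by (simp_all add: card_PiE finite_PiE)
    moreover have "embeddings G {..<n} \<subseteq> verts G \<rightarrow>\<^sub>E {..<n}" by (auto simp: embeddings_def)
    ultimately have "card (embeddings G {..<n}) \<le> n ^ card (verts G)" by (metis card_mono)
    then show "real (card (embeddings G {..<n})) \<le> real n ^ card (verts G)"
      by (simp flip: of_nat_power)
  qed (use s in simp)
  finally have EX: "(\<integral>w. X w \<partial>Q) \<le> real n ^ card (verts G) * s ^ card (edges G)" .
  have pos: "0 < n / (2 * v)" using n v_ge_3 by simp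
  have "measure Q (many_light G s) \<le> (\<integral>w. X w \<partial>Q) / (n / (2 * v))"
    unfolding many using intX pos
    by (intro integral_Markov_inequality_measure[where A = "{}"]) (auto simp: X_def intro!: AE_I2 sum_nonneg)
  also have "\<dots> \<le> real n ^ card (verts G) * s ^ card (edges G) / (n / (2 * v))"
    using EX pos by (intro divide_right_mono) auto
  finally show "measure Q (many_light G s) \<le> real n ^ card (verts G) * s ^ card (edges G) * (2 * v / n)"
    by (simp add: field_simps)
qed

text \<open>
  Among the \<open>n / v\<close> copies in an optimal factor, those without an edge heavier than \<open>s\<close> give different
  light embeddings of the subgraph \<open>G\<close>. If there are fewer than \<open>n / (2 v)\<close> of these, at least half of the copies
  weigh more than \<open>s\<close>.
\<close>

lemma min_factor_weight_ge:
  assumes G: "is_subgraph G H" "verts G \<noteq> {}" and s: "0 < s"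
    and w: "\<And>e. e \<in> E \<Longrightarrow> 0 \<le> w e" and few: "real (light_embeddings G s w) < n / (2 * v)"
  shows "s * (n / (2 * v)) \<le> min_factor_weight H n w"
proof -
  obtain \<F> where \<F>: "is_factor H n \<F>" "min_factor_weight H n w = factor_weight w \<F>"
    using min_factor_weight_attained[OF factors_nonempty] by blast
  then have fac: "factor_of H n {..<n} \<F>" by (simp add: is_factor_iff_factor_of)
  have fin: "finite \<F>" by (rule finite_factor_of[OF fac])
  have sG: "simple_graph G" and GH: "verts G \<subseteq> verts H" "edges G \<subseteq> edges H"
    using G(1) by (auto simp: is_subgraph_def)
  define B where "B = {S\<in>\<F>. \<exists>e\<in>edges S. s < w e}"
  have "\<exists>\<phi>. \<forall>S\<in>\<F>. \<phi> S \<in> embeddings H (verts S) \<and> S = graph_copy (\<phi> S) H"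
    using factor_of_copy(1)[OF H(1) fac] by (intro bchoice) blast
  then obtain \<phi> where \<phi>: "\<And>S. S \<in> \<F> \<Longrightarrow> \<phi> S \<in> embeddings H (verts S)"
    "\<And>S. S \<in> \<F> \<Longrightarrow> S = graph_copy (\<phi> S) H" by blast
  \<comment> \<open>Disjointness of the copies and \<open>verts G \<noteq> {}\<close> make \<open>\<psi>\<close> injective.\<close>
  define \<psi> where "\<psi> = (\<lambda>S. restrict (\<phi> S) (verts G))"
  have \<psi>_img: "\<psi> S ` e = \<phi> S ` e" if "e \<in> edges G" for S e
    using that sG by (force simp: \<psi>_def simple_graph_def)
  have \<psi>_in: "\<psi> S x \<in> verts S" if "S \<in> \<F>" "x \<in> verts G" for S x
    using \<phi>(1)[OF that(1)] that(2) GH by (auto simp: \<psi>_def embeddings_def)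
  have "card (\<F> - B) \<le> light_embeddings G s w"
    unfolding light_embeddings_def
  proof (rule card_inj_on_le)
    obtain x where x: "x \<in> verts G" using G(2) by blast
    show "inj_on \<psi> (\<F> - B)"
    proof (rule inj_onI, rule ccontr)
      fix S T assume S: "S \<in> \<F> - B" "T \<in> \<F> - B" and eq: "\<psi> S = \<psi> T" and "S \<noteq> T"
      then have "verts S \<inter> verts T = {}" using fac by (auto simp: factor_of_def pairwise_def)
      moreover have "\<psi> S x \<in> verts S" "\<psi> S x \<in> verts T"
        using \<psi>_in[of S x] \<psi>_in[of T x] S x eq by auto
      ultimately show False by blast
    qed
    show "\<psi> ` (\<F> - B) \<subseteq> {\<phi> \<in> embeddings G {..<n}. \<forall>e\<in>edges G. w (\<phi> ` e) \<le> s}"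
    proof (rule image_subsetI, rule CollectI, rule conjI)
      fix S assume S: "S \<in> \<F> - B"
      have "inj_on (\<phi> S) (verts G)"
        using \<phi>(1)[of S] S GH by (auto simp: embeddings_def intro: inj_on_subset)
      then have "inj_on (\<psi> S) (verts G)" by (simp add: \<psi>_def cong: inj_on_cong)
      moreover have "\<psi> S \<in> verts G \<rightarrow>\<^sub>E {..<n}"
        using \<psi>_in[of S] factor_of_copy(2)[OF H(1) fac, of S] S by (auto simp: PiE_iff \<psi>_def)
      ultimately show "\<psi> S \<in> embeddings G {..<n}" by (simp add: embeddings_def)
      show "\<forall>e\<in>edges G. w (\<psi> S ` e) \<le> s"
      proof
        fix e assume e: "e \<in> edges G"
        then have "\<phi> S ` e \<in> edges S"
          using \<phi>(2)[of S] S GH by (metis DiffD1 graph_copy_def image_eqI snd_conv subsetD)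
        then show "w (\<psi> S ` e) \<le> s" using S unfolding \<psi>_img[OF e] by (auto simp: B_def)
      qed
    qed
    show "finite {\<phi> \<in> embeddings G {..<n}. \<forall>e\<in>edges G. w (\<phi> ` e) \<le> s}"
      using finite_embeddings[OF sG, of "{..<n}"] by simp
  qed
  then have "real (card (\<F> - B)) < n / (2 * v)" using few by linarith
  moreover have "real (card \<F>) = n / v"
  proof -
    have "n = v * card \<F>" using card_factor_of[OF H(1) fac] by simp
    then show ?thesis using v_ge_3 by (simp add: field_simps flip: of_nat_mult)
  qed
  moreover have "card \<F> = card (\<F> - B) + card B"
  proof -
    have "\<F> \<inter> B = B" by (auto simp: B_def)
    then show ?thesis using card_Int_Diff[OF fin, of B] by simp
  qed
  moreover have "real n / real v = 2 * (n / (2 * v))" by simp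
  ultimately have "n / (2 * v) \<le> real (card B)" by linarith
  then have "s * (n / (2 * v)) \<le> s * real (card B)" using s by (intro mult_left_mono) auto
  also have "\<dots> = real (card B) * s" by simp
  also have "\<dots> \<le> (\<Sum>S\<in>B. \<Sum>e\<in>edges S. w e)"
  proof (rule sum_bounded_below)
    fix S assume S: "S \<in> B"
    then have SF: "S \<in> \<F>" by (simp add: B_def)
    obtain e where e: "e \<in> edges S" "s < w e" using S by (auto simp: B_def)
    have "w e \<le> (\<Sum>e\<in>edges S. w e)"
      using e factor_of_copy(4,5)[OF H(1) fac SF] w by (intro member_le_sum) blast+
    then show "s \<le> (\<Sum>e\<in>edges S. w e)" using e by simp
  qed
  also have "\<dots> \<le> factor_weight w \<F>"
    unfolding factor_weight_def
  proof (rule sum_mono2[OF fin])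
    fix S assume "S \<in> \<F> - B"
    then show "0 \<le> (\<Sum>e\<in>edges S. w e)"
      using factor_of_copy(4)[OF H(1) fac] w by (intro sum_nonneg) blast
  qed (auto simp: B_def)
  finally show ?thesis by (simp add: \<F>(2))
qed

end

section \<open>Concentration for a fixed number of vertices\<close>

text \<open>
  The exponent of \<open>n\<close> in the order of magnitude of the minimum weight; abbreviated \<open>a\<close> below.
\<close>

definition weight_exponent :: "'a ugraph \<Rightarrow> real" where
  "weight_exponent H = 1 - 1 / max_density1 H"

text \<open>
  The exponent \<open>\<delta>\<close> spent on the union bound over vertex sets. The relation
  \<open>\<delta> + a\<^sup>2 / 4 = a / 4\<close> keeps the cost of repairing a truncated factor at \<open>O(n powr (3 a / 4))\<close>.
\<close>

definition slack :: "'a ugraph \<Rightarrow> real" where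
  "slack H = weight_exponent H * (1 - weight_exponent H) / 4"

definition light_const :: "'a ugraph \<Rightarrow> real" where
  "light_const H = 2 ^ (card (edges H) + 3) * (2 * real (card (verts H))) ^ card (verts H) / slack H"

definition upper_const :: "'a ugraph \<Rightarrow> real" where
  "upper_const H = card (edges H) * (light_const H / (weight_exponent H - slack H) + 1)"

definition patch_const :: "'a ugraph \<Rightarrow> real" where
  "patch_const H = card (edges H) *
     (light_const H * (card (verts H) * upper_const H) powr (weight_exponent H - slack H)
        / (weight_exponent H - slack H) + 1)"

definition failure_bound :: "'a ugraph \<Rightarrow> nat \<Rightarrow> real" where
  "failure_bound H n = real n ^ 2 * exp (- (real n powr (weight_exponent H / 2)))
     + (real n + 1) * exp (- (real n powr (weight_exponent H / 4)))"

context random_weights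
begin

abbreviation "a \<equiv> weight_exponent H"
abbreviation "\<delta> \<equiv> slack H"

lemma exponent_bounds: "0 < a" "a < 1" "1 / d = 1 - a"
  using d_gt_1 by (auto simp: weight_exponent_def)

lemma slack_bounds: "0 < \<delta>" "\<delta> \<le> 1" "\<delta> < a" "\<delta> = a / 4 - a * a / 4"
proof -
  show "0 < \<delta>" using exponent_bounds by (simp add: slack_def)
  have "a * (1 - a) \<le> a * 1" using exponent_bounds by (intro mult_left_mono) auto
  then show "\<delta> < a" "\<delta> \<le> 1" using exponent_bounds unfolding slack_def by linarith+
  show "\<delta> = a / 4 - a * a / 4" by (simp add: slack_def right_diff_distrib diff_divide_distrib)
qed

lemma light_const_pos: "0 < light_const H"
  using slack_bounds v_ge_3 by (auto simp: light_const_def)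

lemma upper_const_nonneg: "0 \<le> upper_const H"
  using slack_bounds light_const_pos by (auto simp: upper_const_def)

text \<open>
  The weight level at which all sets of \<open>k\<close> vertices are likely to contain a copy of \<open>H\<close>.
\<close>

definition "light_level k = light_const H * (real n / real k) powr \<delta> * real k powr (- 1 / d)"

text \<open>
  The thresholds \<open>n powr (a / 2)\<close> for a single weight and \<open>n powr (a / 4)\<close> for the size of a vertex set
  have product \<open>n powr (3 a / 4)\<close>, the permitted error, and both are powers of \<open>n\<close>, so that the
  exceptional event is superpolynomially unlikely.
\<close>

definition "exceptional =
  out_of_range (real n powr (a / 2)) \<union> no_light_copy (real n powr (a / 4)) light_level"

abbreviation "cutoff \<equiv> real n powr (3 * a / 4 - 1 / 2)"

abbreviation "minw \<equiv> min_factor_weight H n"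

lemma light_level_eq: "light_level k = light_const H * real n powr \<delta> * real k powr (a - \<delta> - 1)"
proof (cases "k = 0")
  case False
  have "- 1 / d = a - 1" using exponent_bounds(3) by simp
  then show ?thesis using False n
    by (simp add: light_level_def powr_divide powr_diff)
qed (simp add: light_level_def)

text \<open>
  For sets of at least \<open>n powr (a / 4)\<close> vertices the weight level tends to 0. In particular it
  eventually lies in \<open>[0, 1]\<close>, where the distribution function of the weights is at least half the identity.
\<close>

lemma light_level_le:
  assumes "real n powr (a / 4) \<le> real k"
  shows "light_level k \<le> light_const H * real n powr (- (a * \<delta> / 4))"
proof -
  have n1: "0 < real n powr (a / 4)" using n by simp
  have "real k powr (a - \<delta> - 1) \<le> (real n powr (a / 4)) powr (a - \<delta> - 1)"
    using assms n1 slack_bounds(1,3) exponent_bounds(2) by (intro powr_mono2') auto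
  then have "light_level k \<le> light_const H * real n powr \<delta> * (real n powr (a / 4)) powr (a - \<delta> - 1)"
    unfolding light_level_eq using light_const_pos by (intro mult_left_mono) auto
  also have "\<dots> = light_const H * real n powr (\<delta> + a / 4 * (a - \<delta> - 1))"
    by (simp add: powr_powr powr_add)
  also have "\<delta> + a / 4 * (a - \<delta> - 1) = - (a * \<delta> / 4)"
  proof -
    have "a / 4 * (a - \<delta> - 1) = a * a / 4 - a * \<delta> / 4 - a / 4"
      by (simp add: algebra_simps diff_divide_distrib)
    then show ?thesis using slack_bounds(4) by linarith
  qed
  finally show ?thesis .
qed

lemma prob_exceptional:
  assumes K: "2 * real v \<le> real n powr (a / 4)"
    and small: "light_const H * real n powr (- (a * \<delta> / 4)) \<le> 1"
  shows "exceptional \<in> sets Q" "measure Q exceptional \<le> failure_bound H n"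
proof -
  have K': "real (2 * v) \<le> real n powr (a / 4)" using K by simp
  have light: "no_light_copy (real n powr (a / 4)) light_level \<in> sets Q"
    "measure Q (no_light_copy (real n powr (a / 4)) light_level) \<le> (real n + 1) * exp (- (real n powr (a / 4)))"
    using prob_no_light_copy[OF K' slack_bounds(1,2), of light_level] order_trans[OF light_level_le small]
    by (auto simp: light_level_def light_const_def)
  have range: "measure Q (out_of_range (real n powr (a / 2))) \<le> real n ^ 2 * exp (- (real n powr (a / 2)))"
    by (rule prob_out_of_range) simp
  show "exceptional \<in> sets Q" unfolding exceptional_def using light sets_out_of_range by auto
  have "measure Q exceptional \<le> measure Q (out_of_range (real n powr (a / 2))) +
      measure Q (no_light_copy (real n powr (a / 4)) light_level)"
    unfolding exceptional_def using light sets_out_of_range by (intro measure_Un_le) auto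
  then show "measure Q exceptional \<le> failure_bound H n"
    using light range by (simp add: failure_bound_def)
qed

lemma good_range:
  assumes "w \<in> space Q - exceptional" "e \<in> E"
  shows "0 \<le> w e" "w e \<le> real n powr (a / 2)"
  using assms by (force simp: exceptional_def out_of_range_def not_less)+

lemma good_patch:
  assumes w: "w \<in> space Q - exceptional" and R: "R \<subseteq> {..<n}" "v dvd card R"
  shows "\<exists>\<F>. factor_of H n R \<F> \<and> factor_weight w \<F> \<le>
    m * (light_const H * real n powr \<delta> * real (card R) powr (a - \<delta>) / (a - \<delta>) + real n powr (3 * a / 4))"
proof -
  have "\<exists>\<F>. factor_of H n R \<F> \<and> factor_weight w \<F> \<le>
    m * (light_const H * real n powr \<delta> * real (card R) powr (a - \<delta>) / (a - \<delta>)
      + min (real (card R)) (real n powr (a / 4)) * real n powr (a / 2))"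
  proof (rule greedy_factor[OF H(1)])
    fix R assume R: "R \<subseteq> {..<n}" "real n powr (a / 4) \<le> real (card R)" "R \<noteq> {}"
    have "card R \<le> n" using card_mono[of "{..<n}" R] R by simp
    then have "light_copy H w (light_level (card R)) R"
      using w R by (auto simp: exceptional_def no_light_copy_def)
    then show "light_copy H w (light_const H * real n powr \<delta> * real (card R) powr (a - \<delta> - 1)) R"
      by (simp add: light_level_eq)
  qed (use v_ge_3 good_range[OF w] light_const_pos slack_bounds(1,3) exponent_bounds(1,2) R in auto)
  moreover have "min (real (card R)) (real n powr (a / 4)) * real n powr (a / 2) \<le> real n powr (3 * a / 4)"
  proof -
    have "min (real (card R)) (real n powr (a / 4)) * real n powr (a / 2)
      \<le> real n powr (a / 4) * real n powr (a / 2)" by (intro mult_right_mono) auto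
    also have "\<dots> = real n powr (3 * a / 4)" by (simp flip: powr_add)
    finally show ?thesis .
  qed
  ultimately show ?thesis
    by (meson add_left_mono mult_left_mono of_nat_0_le_iff order_trans)
qed

text \<open>
  The greedy cover of all \<open>n\<close> vertices.
\<close>

lemma good_upper:
  assumes w: "w \<in> space Q - exceptional"
  shows "minw w \<le> upper_const H * real n powr a"
proof -
  obtain \<F> where \<F>: "factor_of H n {..<n} \<F>" "factor_weight w \<F> \<le>
    m * (light_const H * real n powr \<delta> * real n powr (a - \<delta>) / (a - \<delta>) + real n powr (3 * a / 4))"
    using good_patch[OF w, of "{..<n}"] n by auto
  have "minw w \<le> factor_weight w \<F>" using \<F>(1) by (intro min_factor_weight_le) (simp add: is_factor_iff_factor_of)
  also have "\<dots> \<le> m * (light_const H * real n powr a / (a - \<delta>) + real n powr a)"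
  proof -
    have "real n powr \<delta> * real n powr (a - \<delta>) = real n powr a" by (simp flip: powr_add)
    moreover have "real n powr (3 * a / 4) \<le> real n powr a" using n exponent_bounds by (intro powr_mono) auto
    ultimately have "m * (light_const H * real n powr \<delta> * real n powr (a - \<delta>) / (a - \<delta>) + real n powr (3 * a / 4))
       \<le> m * (light_const H * real n powr a / (a - \<delta>) + real n powr a)"
      by (intro mult_left_mono add_mono) (auto simp: mult.assoc)
    then show ?thesis using \<F>(2) by linarith
  qed
  also have "\<dots> = upper_const H * real n powr a" by (simp add: upper_const_def algebra_simps)
  finally show ?thesis .
qed

lemma good_truncated_le:
  assumes w: "w \<in> space Q - exceptional"
  shows "truncated t w \<le> minw w"
  unfolding truncated_def using good_range[OF w] by (intro truncated_le H(1) factors_nonempty)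

text \<open>
  The repair involves \<open>r = O(n powr (1/2 + a/4))\<close> vertices, since the truncated minimum is
  \<open>O(n powr a)\<close> and the cutoff is \<open>n powr (3a/4 - 1/2)\<close>. Covering them greedily costs
  \<open>O(n powr \<delta> * r powr (a - \<delta>) + n powr (3a/4))\<close>, and the choice of \<open>\<delta>\<close> makes the first term of
  no larger order than the second.
\<close>

lemma good_le_truncated:
  assumes w: "w \<in> space Q - exceptional"
  shows "minw w \<le> truncated cutoff w + patch_const H * real n powr (3 * a / 4)"
proof -
  define g where "g = (\<lambda>r::nat. m * (light_const H * real n powr \<delta> * real r powr (a - \<delta>) / (a - \<delta>)
      + real n powr (3 * a / 4)))"
  have t: "0 < cutoff" using n by simp
  have "\<exists>r. real r \<le> v * truncated cutoff w / cutoff \<and> minw w \<le> truncated cutoff w + g r"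
    using good_patch[OF w] good_range[OF w] t v_ge_3 unfolding g_def
    by (intro min_le_truncated_plus_patch H(1) factors_nonempty) (auto simp: truncated_def)
  then obtain r where r: "real r \<le> v * truncated cutoff w / cutoff" "minw w \<le> truncated cutoff w + g r" by blast
  have "truncated cutoff w \<le> upper_const H * real n powr a"
    using good_truncated_le[OF w, of cutoff] good_upper[OF w] by linarith
  then have "v * truncated cutoff w / cutoff \<le> v * (upper_const H * real n powr a) / cutoff"
    using t by (intro divide_right_mono mult_left_mono) auto
  also have "\<dots> = v * upper_const H * real n powr (1 / 2 + a / 4)"
  proof -
    have "real n powr a = real n powr (1 / 2 + a / 4) * cutoff" by (simp flip: powr_add)
    then show ?thesis using t by simp
  qed
  finally have r': "real r \<le> v * upper_const H * real n powr (1 / 2 + a / 4)" using r(1) by simp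
  define B where "B = (v * upper_const H) powr (a - \<delta>)"
  have "real r powr (a - \<delta>) \<le> (v * upper_const H * real n powr (1 / 2 + a / 4)) powr (a - \<delta>)"
    using r' slack_bounds by (intro powr_mono2) auto
  also have "\<dots> = B * real n powr ((1 / 2 + a / 4) * (a - \<delta>))"
    using upper_const_nonneg by (simp add: powr_mult powr_powr B_def)
  finally have "real n powr \<delta> * real r powr (a - \<delta>) \<le> real n powr \<delta> * (B * real n powr ((1 / 2 + a / 4) * (a - \<delta>)))"
    by (rule mult_left_mono) simp
  also have "\<dots> = B * real n powr (\<delta> + (1 / 2 + a / 4) * (a - \<delta>))" by (simp add: powr_add)
  also have "\<dots> \<le> B * real n powr (3 * a / 4)"
  proof (intro mult_left_mono powr_mono)
    have "0 \<le> \<delta> * (1 / 2 + a / 4)" using slack_bounds exponent_bounds by simp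
    then show "\<delta> + (1 / 2 + a / 4) * (a - \<delta>) \<le> 3 * a / 4"
    proof -
      have "(1 / 2 + a / 4) * (a - \<delta>) = a / 2 + a * a / 4 - \<delta> * (1 / 2 + a / 4)"
        by (simp add: algebra_simps add_divide_distrib diff_divide_distrib)
      then show ?thesis using slack_bounds(4) \<open>0 \<le> \<delta> * (1 / 2 + a / 4)\<close> by linarith
    qed
  qed (use n in \<open>auto simp: B_def\<close>)
  finally have "light_const H * (real n powr \<delta> * real r powr (a - \<delta>)) / (a - \<delta>)
      \<le> light_const H * (B * real n powr (3 * a / 4)) / (a - \<delta>)"
    using light_const_pos slack_bounds by (intro divide_right_mono mult_left_mono) auto
  then have "g r \<le> m * (light_const H * (B * real n powr (3 * a / 4)) / (a - \<delta>) + real n powr (3 * a / 4))"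
    unfolding g_def by (intro mult_left_mono add_right_mono) (auto simp: mult.assoc)
  also have "\<dots> = patch_const H * real n powr (3 * a / 4)"
    by (simp add: patch_const_def B_def algebra_simps)
  finally show ?thesis using r(2) by simp
qed

text \<open>
  The cutoff is chosen such that \<open>sqrt n * cutoff = n powr (3 a / 4)\<close>, the standard deviation allowed by
  the error term.
\<close>

lemma prob_deviation_cutoff:
  assumes "0 < K"
  shows "measure Q (deviation cutoff (K * real n powr (3 * a / 4))) \<le> (real m / K)\<^sup>2"
proof -
  have "measure Q (deviation cutoff (K * real n powr (3 * a / 4))) \<le>
      real n * (real m * cutoff)\<^sup>2 / (K * real n powr (3 * a / 4))\<^sup>2"
    using n assms by (intro prob_deviation) auto
  also have "\<dots> = (real m / K)\<^sup>2"
  proof -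
    have "real n powr (3 * a / 4) = real n powr (1 / 2) * cutoff" by (simp flip: powr_add)
    moreover have "(real n powr (1 / 2))\<^sup>2 = real n" using n by (simp add: powr_half_sqrt)
    ultimately show ?thesis using n assms by (simp add: power_mult_distrib power_divide)
  qed
  finally show ?thesis .
qed

text \<open>
  The densest subgraph \<open>G\<close>, with \<open>v\<^sub>G\<close> vertices and \<open>e\<^sub>G\<close> edges, satisfies \<open>n ^ v\<^sub>G * (n powr (- 1 / d)) ^ e\<^sub>G = n\<close>, so at weight level
  \<open>s = n powr (- 1 / d) / (8 v)\<close> the expected number of light embeddings of \<open>G\<close> is a small multiple of
  \<open>n\<close>. The failure probability stays a constant; combined with concentration this suffices to bound
  the deterministic centre from below.
\<close>

lemma lower_event:
  "\<exists>B\<in>sets Q. measure Q B \<le> 1 / 4 \<and>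
     (\<forall>w\<in>space Q - B. (\<forall>e\<in>E. 0 \<le> w e) \<longrightarrow> real n powr a / (16 * real v ^ 2) \<le> minw w)"
proof -
  have "is_subgraph H H" using H by (simp add: is_subgraph_def)
  then obtain G where G: "is_subgraph G H" "2 \<le> card (verts G)" "density1 G = d"
    using max_density1_attained[OF H(1), of H] v_ge_3 by auto
  have sG: "simple_graph G" using G(1) by (simp add: is_subgraph_def)
  define s where "s = real n powr (a - 1) / (8 * v)"
  have s: "0 < s" using n v_ge_3 by (auto simp: s_def)
  have dens: "real (card (edges G)) = d * (real (card (verts G)) - 1)"
    using G by (simp add: density1_def field_simps)
  have eG: "1 \<le> card (edges G)"
  proof -
    have "0 < real (card (edges G))" unfolding dens using G(2) d_gt_1 by (intro mult_pos_pos) auto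
    then show ?thesis by linarith
  qed
  have exps: "real n ^ card (verts G) * (real n powr (a - 1)) ^ card (edges G) = real n"
  proof -
    have "d * (1 - a) = 1" using exponent_bounds(3) d_gt_1 by (simp flip: exponent_bounds(3))
    moreover have "d * x * (a - 1) = - (d * (1 - a)) * x" for x by (simp add: algebra_simps)
    ultimately have "d * (real (card (verts G)) - 1) * (a - 1) = - (real (card (verts G)) - 1)"
      by simp
    then have "(real n powr (a - 1)) ^ card (edges G) = real n powr (- (real (card (verts G)) - 1))"
      using n by (simp add: powr_power dens)
    moreover have "real n ^ card (verts G) = real n powr real (card (verts G))"
      using n by (simp add: powr_realpow)
    ultimately show ?thesis using n by (simp flip: powr_add)
  qed
  have "measure Q (many_light G s) \<le> real n ^ card (verts G) * s ^ card (edges G) * (2 * v / n)"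
    by (rule prob_many_light(2)[OF sG]) (use s in simp)
  also have "\<dots> = (real n ^ card (verts G) * (real n powr (a - 1)) ^ card (edges G)) * (2 * v / n) * (1 / (8 * v)) ^ card (edges G)"
    by (simp add: s_def power_divide)
  also have "\<dots> = 2 * v * (1 / (8 * v)) ^ card (edges G)"
    unfolding exps using n by simp
  also have "\<dots> \<le> 2 * v * (1 / (8 * v)) ^ 1"
    using eG v_ge_3 by (intro mult_left_mono power_decreasing) auto
  also have "\<dots> = 1 / 4" using v_ge_3 by simp
  finally have "measure Q (many_light G s) \<le> 1 / 4" .
  moreover have "real n powr a / (16 * real v ^ 2) \<le> minw w"
    if "w \<in> space Q - many_light G s" "\<forall>e\<in>E. 0 \<le> w e" for w
  proof -
    have "s * (n / (2 * v)) \<le> minw w"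
    proof (rule min_factor_weight_ge[OF G(1) _ s])
      show "verts G \<noteq> {}" using G(2) by auto
    qed (use that in \<open>auto simp: many_light_def not_le\<close>)
    moreover have "s * (n / (2 * v)) = real n powr a / (16 * real v ^ 2)"
      using n v_ge_3 by (simp add: s_def powr_diff field_simps power2_eq_square)
    ultimately show ?thesis by simp
  qed
  ultimately show ?thesis using prob_many_light(1)[OF sG, of s] s
    by (intro bexI[of _ "many_light G s"]) auto
qed

text \<open>
  The centre \<open>\<mu>\<close> is the mean of the truncated minimum. Its two bounds follow by exhibiting a single
  outcome: the events that may fail have total probability less than 1, so some weighting satisfies the
  lower bound, the upper bound and the closeness to \<open>\<mu>\<close> at the same time.
\<close>

lemma concentration_at:
  assumes K: "2 * real v \<le> real n powr (a / 4)"
    and small: "light_const H * real n powr (- (a * \<delta> / 4)) \<le> 1"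
    and fail: "failure_bound H n \<le> 1 / 4"
  shows "\<exists>\<mu>. real n powr a / (16 * real v ^ 2) - (2 * real m + patch_const H) * real n powr (3 * a / 4) \<le> \<mu> \<and>
    \<mu> \<le> upper_const H * real n powr a + 2 * real m * real n powr (3 * a / 4) \<and>
    (\<forall>K>0. \<exists>B\<in>sets Q. measure Q B \<le> failure_bound H n + (real m / K)\<^sup>2 \<and>
      (\<forall>w\<in>space Q - B. \<bar>minw w - \<mu>\<bar> \<le> (K + patch_const H) * real n powr (3 * a / 4)))"
proof (intro exI conjI allI impI)
  let ?\<mu> = "mean cutoff" and ?N = "real n powr (3 * a / 4)"
  note exc = prob_exceptional[OF K small]
  have close: "truncated cutoff w - ?\<mu> < K * ?N" "?\<mu> - truncated cutoff w < K * ?N"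
    if "w \<in> space Q - deviation cutoff (K * ?N)" for w K
    using that by (auto simp: deviation_def not_le abs_less_iff)
  have m0: "0 < real m" using edges_nonempty finite_edges[OF H(1)] by (simp add: card_gt_0_iff)
  obtain B where B: "B \<in> sets Q" "measure Q B \<le> 1 / 4"
    "\<And>w. w \<in> space Q - B \<Longrightarrow> (\<forall>e\<in>E. 0 \<le> w e) \<Longrightarrow> real n powr a / (16 * real v ^ 2) \<le> minw w"
    using lower_event by blast
  let ?D = "deviation cutoff (2 * real m * ?N)"
  have "measure Q (exceptional \<union> B \<union> ?D) \<le> measure Q exceptional + measure Q B + measure Q ?D"
    using exc(1) B(1) sets_deviation
    by (intro order_trans[OF measure_Un_le] add_mono measure_Un_le sets.Un) auto
  also have "\<dots> \<le> 1 / 4 + 1 / 4 + 1 / 4"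
    using exc(2) fail B(2) prob_deviation_cutoff[of "2 * real m"] m0 by (simp add: power_divide)
  finally have "measure Q (exceptional \<union> B \<union> ?D) < 1" by simp
  then have "exceptional \<union> B \<union> ?D \<noteq> space Q" using Q.prob_space by auto
  moreover have "exceptional \<union> B \<union> ?D \<subseteq> space Q"
    using exc(1) B(1) sets_deviation by (auto dest: sets.sets_into_space)
  ultimately obtain w where w: "w \<in> space Q - exceptional" "w \<in> space Q - B" "w \<in> space Q - ?D" by blast
  note ineqs = close[OF w(3)] good_upper[OF w(1)] good_truncated_le[OF w(1), of cutoff]
    good_le_truncated[OF w(1)] B(3)[OF w(2)]
  show "real n powr a / (16 * real v ^ 2) - (2 * real m + patch_const H) * ?N \<le> ?\<mu>"
    using ineqs good_range[OF w(1)] by (simp add: algebra_simps)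
  show "?\<mu> \<le> upper_const H * real n powr a + 2 * real m * ?N"
    using ineqs by linarith
  fix K :: real assume K: "0 < K"
  have pc: "0 \<le> patch_const H * ?N"
    using light_const_pos slack_bounds by (auto simp: patch_const_def)
  show "\<exists>B\<in>sets Q. measure Q B \<le> failure_bound H n + (real m / K)\<^sup>2 \<and>
      (\<forall>w\<in>space Q - B. \<bar>minw w - ?\<mu>\<bar> \<le> (K + patch_const H) * ?N)"
  proof (intro bexI conjI ballI)
    let ?B = "exceptional \<union> deviation cutoff (K * ?N)"
    show "?B \<in> sets Q" using exc(1) sets_deviation by auto
    have "measure Q ?B \<le> measure Q exceptional + measure Q (deviation cutoff (K * ?N))"
      using exc(1) sets_deviation by (intro measure_Un_le) auto
    then show "measure Q ?B \<le> failure_bound H n + (real m / K)\<^sup>2"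
      using exc(2) prob_deviation_cutoff[OF K] by linarith
    fix w assume "w \<in> space Q - ?B"
    then have w: "w \<in> space Q - exceptional" "w \<in> space Q - deviation cutoff (K * ?N)" by auto
    show "\<bar>minw w - ?\<mu>\<bar> \<le> (K + patch_const H) * ?N"
      using close[OF w(2)] good_truncated_le[OF w(1), of cutoff] good_le_truncated[OF w(1)] pc
      unfolding distrib_right abs_le_iff by linarith
  qed
qed

end

section \<open>Asymptotics\<close>

lemma min_factor_weight_restrict:
  assumes "simple_graph H"
  shows "min_factor_weight H n (restrict w (edges (complete_graph n))) = min_factor_weight H n w"
proof -
  have "factor_weight (restrict w (edges (complete_graph n))) \<F> = factor_weight w \<F>"
    if "\<F> \<in> {\<F>. is_factor H n \<F>}" for \<F>
  proof -
    have fac: "factor_of H n {..<n} \<F>" using that by (simp add: is_factor_iff_factor_of)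
    show ?thesis
      unfolding factor_weight_def
    proof (intro sum.cong refl)
      fix S e assume "S \<in> \<F>" "e \<in> edges S"
      then have "e \<in> edges (complete_graph n)" using factor_of_copy(4)[OF assms fac] by blast
      then show "restrict w (edges (complete_graph n)) e = w e" by simp
    qed
  qed
  then have "factor_weight (restrict w (edges (complete_graph n))) ` {\<F>. is_factor H n \<F>} =
      factor_weight w ` {\<F>. is_factor H n \<F>}" by (rule image_cong[OF refl])
  then show ?thesis by (simp add: min_factor_weight_def)
qed

text \<open>
  Moves a probability bound from the canonical product space to an arbitrary probability space that
  carries independent weights with the same law.
\<close>

lemma iid_prob_le_PiM:
  fixes W :: "'i \<Rightarrow> 'w \<Rightarrow> real"
  assumes P: "prob_space P" and indep: "prob_space.indep_vars P (\<lambda>_. borel) W I"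
    and law: "\<And>i. i \<in> I \<Longrightarrow> distr P borel (W i) = D" and I: "I \<noteq> {}"
    and B: "B \<in> sets (PiM I (\<lambda>_. D))"
    and sub: "\<And>\<omega>. \<omega> \<in> A \<Longrightarrow> \<omega> \<in> space P \<and> restrict (\<lambda>i. W i \<omega>) I \<in> B"
  shows "measure P A \<le> measure (PiM I (\<lambda>_. D)) B"
proof -
  interpret prob_space P by fact
  have rv: "W i \<in> borel_measurable P" if "i \<in> I" for i
    using indep that by (simp add: indep_vars_def)
  have meas: "(\<lambda>\<omega>. \<lambda>i\<in>I. W i \<omega>) \<in> measurable P (PiM I (\<lambda>_. borel))"
    using rv by (intro measurable_restrict)
  have "distr P (PiM I (\<lambda>_. borel)) (\<lambda>\<omega>. \<lambda>i\<in>I. W i \<omega>) = PiM I (\<lambda>i. distr P borel (W i))"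
    using indep_vars_iff_distr_eq_PiM'[where X = W and M' = "\<lambda>_. borel", OF I rv] indep by blast
  also have "\<dots> = PiM I (\<lambda>_. D)" by (rule PiM_cong) (simp_all add: law)
  finally have dist: "distr P (PiM I (\<lambda>_. borel)) (\<lambda>\<omega>. \<lambda>i\<in>I. W i \<omega>) = PiM I (\<lambda>_. D)" .
  then have B': "B \<in> sets (PiM I (\<lambda>_. borel))" using B by (metis sets_distr)
  have "measure P A \<le> measure P ((\<lambda>\<omega>. \<lambda>i\<in>I. W i \<omega>) -` B \<inter> space P)"
    using sub measurable_sets[OF meas B'] by (intro finite_measure_mono) auto
  also have "\<dots> = measure (PiM I (\<lambda>_. D)) B"
    unfolding dist[symmetric] by (rule measure_distr[OF meas B', symmetric])
  finally show ?thesis .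
qed

lemma failure_bound_tendsto_0:
  assumes "0 < weight_exponent H" shows "failure_bound H \<longlonglongrightarrow> 0"
  unfolding failure_bound_def[abs_def] using assms by real_asymp

theorem theorem1p1:
  fixes H :: "'a ugraph"
    and P :: "nat \<Rightarrow> 'w measure"
    and W :: "nat \<Rightarrow> nat set \<Rightarrow> 'w \<Rightarrow> real"
    and D :: "real measure"
  assumes "simple_graph H" and "has_cycle H"
    and "D = uniform_measure lborel {0..1} \<or> D = density lborel (\<lambda>x. ennreal (exponential_density 1 x))"
    and "\<And>n. card (verts H) dvd n \<Longrightarrow> prob_space (P n)"
    and "\<And>n. card (verts H) dvd n \<Longrightarrow>
           prob_space.indep_vars (P n) (\<lambda>_. borel) (W n) (edges (complete_graph n))"
    and "\<And>n e. card (verts H) dvd n \<Longrightarrow> e \<in> edges (complete_graph n) \<Longrightarrow>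
           distr (P n) borel (W n e) = D"
  shows "max_density1 H > 1 \<and>
    (\<exists>M :: nat \<Rightarrow> real. (\<forall>n. M n > 0) \<and>
       M \<in> \<Theta>[multiples_at_top (card (verts H))](\<lambda>n. real n powr (1 - 1 / max_density1 H)) \<and>
       bigo_in_prob (multiples_at_top (card (verts H))) P
         (\<lambda>n \<omega>. \<bar>min_factor_weight H n (\<lambda>e. W n e \<omega>) - M n\<bar>)
         (\<lambda>n \<omega>. M n powr (3 / 4)))"
proof -
  define v m where "v = card (verts H)" and "m = card (edges H)"
  define a where "a = weight_exponent H"
  define N where "N = (\<lambda>n::nat. real n powr (3 * a / 4))"
  have v3: "3 \<le> v" unfolding v_def by (rule has_cycle_card_verts[OF assms(1,2)])
  have law: "admissible_law D"
    using assms(3) admissible_law_uniform admissible_law_exponential by auto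
  have instance_at: "random_weights H D n" if "v dvd n" "0 < n" for n
    using that assms(1,2) law by (simp add: random_weights_def v_def)
  have d1: "1 < max_density1 H" by (rule max_density1_gt_1[OF assms(1,2)])
  have a: "0 < a" and \<delta>: "0 < slack H" and m0: "0 < m"
    and pc: "0 \<le> patch_const H" and uc: "0 \<le> upper_const H"
  proof -
    interpret rw: random_weights H D v by (rule instance_at) (use v3 in auto)
    show "0 < a" "0 < slack H" using rw.exponent_bounds rw.slack_bounds by (simp_all add: a_def)
    show "0 < m" using rw.edges_nonempty finite_edges[OF assms(1)] by (simp add: m_def card_gt_0_iff)
    show "0 \<le> patch_const H" using rw.light_const_pos rw.slack_bounds by (simp add: patch_const_def)
    show "0 \<le> upper_const H" by (rule rw.upper_const_nonneg)
  qed
  define c where "c = 1 / (32 * real v ^ 2)"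
  define C where "C = upper_const H + 2 * real m"
  have c: "0 < c" using v3 by (simp add: c_def)
  have C: "0 < C" using uc m0 by (simp add: C_def)
  define valid where "valid = (\<lambda>n. v dvd n \<and> 0 < n \<and> 2 * real v \<le> real n powr (a / 4) \<and>
      light_const H * real n powr (- (a * slack H / 4)) \<le> 1 \<and> failure_bound H n \<le> 1 / 4 \<and>
      (2 * real m + patch_const H) * real n powr (- (a / 4)) \<le> c)"
  have eventually_valid: "eventually valid (multiples_at_top v)"
    unfolding multiples_at_top_def eventually_inf_principal
  proof -
    have "filterlim (\<lambda>n. real n powr (a / 4)) at_top sequentially" using a by real_asymp
    then have "\<forall>\<^sub>F n in sequentially. 2 * real v \<le> real n powr (a / 4)"
      by (simp add: filterlim_at_top)
    moreover have "\<forall>\<^sub>F n in sequentially. light_const H * real n powr (- (a * slack H / 4)) < 1"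
    proof (rule order_tendstoD(2))
      have "0 < a * slack H / 4" using a \<delta> by simp
      then show "(\<lambda>n. light_const H * real n powr (- (a * slack H / 4))) \<longlonglongrightarrow> 0" by real_asymp
    qed simp
    moreover have "\<forall>\<^sub>F n in sequentially. failure_bound H n < 1 / 4"
      using a unfolding a_def by (intro order_tendstoD(2)[OF failure_bound_tendsto_0]) auto
    moreover have "\<forall>\<^sub>F n in sequentially. (2 * real m + patch_const H) * real n powr (- (a / 4)) < c"
    proof (rule order_tendstoD(2)[OF _ c])
      show "(\<lambda>n. (2 * real m + patch_const H) * real n powr (- (a / 4))) \<longlonglongrightarrow> 0"
        using a by real_asymp
    qed
    moreover have "\<forall>\<^sub>F n in sequentially. 0 < n" by (rule eventually_gt_at_top)
    ultimately show "\<forall>\<^sub>F n in sequentially. n \<in> {n. v dvd n} \<longrightarrow> valid n"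
      by eventually_elim (auto simp: valid_def intro: less_imp_le)
  qed
  have "\<exists>\<mu>. c * real n powr a \<le> \<mu> \<and> \<mu> \<le> C * real n powr a \<and>
      (\<forall>K>0. \<exists>B\<in>sets (PiM (edges (complete_graph n)) (\<lambda>_. D)).
        measure (PiM (edges (complete_graph n)) (\<lambda>_. D)) B \<le> failure_bound H n + (real m / K)\<^sup>2 \<and>
        (\<forall>w\<in>space (PiM (edges (complete_graph n)) (\<lambda>_. D)) - B.
          \<bar>min_factor_weight H n w - \<mu>\<bar> \<le> (K + patch_const H) * N n))"
    if n: "valid n" for n
  proof -
    interpret rw: random_weights H D n by (rule instance_at) (use n in \<open>auto simp: valid_def\<close>)
    have N_eq: "N n = real n powr a * real n powr (- (a / 4))"
      unfolding N_def by (simp flip: powr_add)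
    have low: "(2 * real m + patch_const H) * N n \<le> c * real n powr a"
    proof -
      have "real n powr a * ((2 * real m + patch_const H) * real n powr (- (a / 4))) \<le> real n powr a * c"
        using n by (intro mult_left_mono) (auto simp: valid_def)
      then show ?thesis by (simp add: N_eq mult_ac)
    qed
    have up: "2 * real m * N n \<le> 2 * real m * real n powr a"
      unfolding N_def using n a by (intro mult_left_mono powr_mono) (auto simp: valid_def)
    have "\<exists>\<mu>. real n powr a / (16 * real v ^ 2) - (2 * real m + patch_const H) * N n \<le> \<mu> \<and>
      \<mu> \<le> upper_const H * real n powr a + 2 * real m * N n \<and>
      (\<forall>K>0. \<exists>B\<in>sets rw.Q. measure rw.Q B \<le> failure_bound H n + (real m / K)\<^sup>2 \<and>
        (\<forall>w\<in>space rw.Q - B. \<bar>min_factor_weight H n w - \<mu>\<bar> \<le> (K + patch_const H) * N n))"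
      unfolding v_def m_def a_def N_def
      by (rule rw.concentration_at) (use n in \<open>simp_all add: valid_def v_def a_def\<close>)
    then obtain \<mu> where "real n powr a / (16 * real v ^ 2) - (2 * real m + patch_const H) * N n \<le> \<mu>"
      "\<mu> \<le> upper_const H * real n powr a + 2 * real m * N n" and
      conc: "\<forall>K>0. \<exists>B\<in>sets rw.Q. measure rw.Q B \<le> failure_bound H n + (real m / K)\<^sup>2 \<and>
        (\<forall>w\<in>space rw.Q - B. \<bar>min_factor_weight H n w - \<mu>\<bar> \<le> (K + patch_const H) * N n)"
      by blast
    moreover have "real n powr a / (16 * real v ^ 2) = 2 * c * real n powr a" by (simp add: c_def)
    ultimately have "c * real n powr a \<le> \<mu>" "\<mu> \<le> C * real n powr a"
      using low up unfolding C_def distrib_right by linarith+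
    then show ?thesis using conc unfolding rw.Q_def by blast
  qed
  then obtain \<mu> where \<mu>: "\<And>n. valid n \<Longrightarrow> c * real n powr a \<le> \<mu> n" "\<And>n. valid n \<Longrightarrow> \<mu> n \<le> C * real n powr a"
    and conc: "\<And>n K. valid n \<Longrightarrow> 0 < K \<Longrightarrow> \<exists>B\<in>sets (PiM (edges (complete_graph n)) (\<lambda>_. D)).
        measure (PiM (edges (complete_graph n)) (\<lambda>_. D)) B \<le> failure_bound H n + (real m / K)\<^sup>2 \<and>
        (\<forall>w\<in>space (PiM (edges (complete_graph n)) (\<lambda>_. D)) - B.
          \<bar>min_factor_weight H n w - \<mu> n\<bar> \<le> (K + patch_const H) * N n)"
    by metis
  \<comment> \<open>The value 1 only keeps \<open>M\<close> positive where \<open>n\<close> is small or not a multiple of \<open>v\<close>.\<close>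
  define M where "M = (\<lambda>n. if valid n then \<mu> n else 1)"
  have M_pos: "0 < M n" for n
  proof (cases "valid n")
    case True
    then have "0 < c * real n powr a" using c by (simp add: valid_def)
    then show ?thesis using \<mu>(1)[OF True] True by (simp add: M_def)
  qed (simp add: M_def)
  have theta: "M \<in> \<Theta>[multiples_at_top v](\<lambda>n. real n powr a)"
  proof (rule bigthetaI'[OF c C])
    show "\<forall>\<^sub>F n in multiples_at_top v. c * norm (real n powr a) \<le> norm (M n) \<and>
        norm (M n) \<le> C * norm (real n powr a)"
      using eventually_valid
    proof eventually_elim
      case (elim n)
      then show ?case using \<mu>[OF elim] M_pos[of n] by (simp add: M_def)
    qed
  qed
  have "bigo_in_prob (multiples_at_top v) P
      (\<lambda>n \<omega>. \<bar>min_factor_weight H n (\<lambda>e. W n e \<omega>) - M n\<bar>) (\<lambda>n \<omega>. M n powr (3 / 4))"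
    unfolding bigo_in_prob_def
  proof (intro allI impI)
    fix \<epsilon> :: real assume \<epsilon>: "0 < \<epsilon>"
    \<comment> \<open>Chebyshev at \<open>K\<close> standard deviations fails with probability at most \<open>\<epsilon> / 3\<close>.\<close>
    define K where "K = real m / sqrt (\<epsilon> / 3)"
    have K: "0 < K" "(real m / K)\<^sup>2 = \<epsilon> / 3" using \<epsilon> m0 by (simp_all add: K_def)
    define A where "A = (K + patch_const H) / c powr (3 / 4)"
    have A: "0 \<le> A" using K pc by (simp add: A_def)
    have "\<forall>\<^sub>F n in sequentially. failure_bound H n < \<epsilon> / 3"
      using a \<epsilon> unfolding a_def by (intro order_tendstoD(2)[OF failure_bound_tendsto_0]) auto
    then have "\<forall>\<^sub>F n in multiples_at_top v. failure_bound H n < \<epsilon> / 3"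
      unfolding multiples_at_top_def eventually_inf_principal by (rule eventually_mono) simp
    then have "\<forall>\<^sub>F n in multiples_at_top v. measure (P n) {\<omega> \<in> space (P n).
        \<bar>\<bar>min_factor_weight H n (\<lambda>e. W n e \<omega>) - M n\<bar>\<bar> > A * \<bar>M n powr (3 / 4)\<bar>} < \<epsilon>"
      using eventually_valid
    proof eventually_elim
      case (elim n)
      let ?E = "edges (complete_graph n)"
      have n: "v dvd n" "0 < n" using elim(2) by (auto simp: valid_def)
      then have dvd: "card (verts H) dvd n" by (simp add: v_def)
      have "3 \<le> n" using n v3 by (auto dest: dvd_imp_le)
      then have "{0, 1} \<in> ?E" by (auto simp: complete_graph_def)
      then have E: "?E \<noteq> {}" by blast
      obtain B where B: "B \<in> sets (PiM ?E (\<lambda>_. D))"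
        "measure (PiM ?E (\<lambda>_. D)) B \<le> failure_bound H n + (real m / K)\<^sup>2"
        "\<And>w. w \<in> space (PiM ?E (\<lambda>_. D)) - B \<Longrightarrow> \<bar>min_factor_weight H n w - \<mu> n\<bar> \<le> (K + patch_const H) * N n"
        using conc[OF elim(2) K(1)] by blast
      have scale: "(K + patch_const H) * N n \<le> A * M n powr (3 / 4)"
      proof -
        have "c powr (3 / 4) * N n = (c * real n powr a) powr (3 / 4)"
          using c by (simp add: powr_mult powr_powr N_def mult.commute)
        also have "\<dots> \<le> M n powr (3 / 4)"
          using c \<mu>(1)[OF elim(2)] elim(2) by (intro powr_mono2) (auto simp: M_def)
        finally have "A * (c powr (3 / 4) * N n) \<le> A * M n powr (3 / 4)" using A by (rule mult_left_mono)
        then show ?thesis using c by (simp add: A_def)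
      qed
      have "measure (P n) {\<omega> \<in> space (P n).
          \<bar>\<bar>min_factor_weight H n (\<lambda>e. W n e \<omega>) - M n\<bar>\<bar> > A * \<bar>M n powr (3 / 4)\<bar>} \<le>
        measure (PiM ?E (\<lambda>_. D)) B"
      proof (rule iid_prob_le_PiM[OF assms(4)[OF dvd] assms(5)[OF dvd] assms(6)[OF dvd] E B(1)])
        fix \<omega> assume \<omega>: "\<omega> \<in> {\<omega> \<in> space (P n).
          \<bar>\<bar>min_factor_weight H n (\<lambda>e. W n e \<omega>) - M n\<bar>\<bar> > A * \<bar>M n powr (3 / 4)\<bar>}"
        let ?w = "restrict (\<lambda>e. W n e \<omega>) ?E"
        have "(K + patch_const H) * N n < \<bar>min_factor_weight H n ?w - \<mu> n\<bar>"
          using \<omega> scale elim(2) by (simp add: min_factor_weight_restrict[OF assms(1)] M_def)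
        moreover have "space D = UNIV"
          using law unfolding admissible_law_def by (metis sets_eq_imp_space_eq space_borel)
        then have "?w \<in> space (PiM ?E (\<lambda>_. D))" by (simp add: space_PiM)
        ultimately show "\<omega> \<in> space (P n) \<and> ?w \<in> B" using B(3)[of ?w] \<omega> by force
      qed
      also have "\<dots> \<le> failure_bound H n + \<epsilon> / 3" using B(2) K(2) by simp
      also have "\<dots> < \<epsilon>" using elim(1) \<epsilon> by simp
      finally show ?case .
    qed
    then show "\<exists>C. \<forall>\<^sub>F n in multiples_at_top v. measure (P n) {\<omega> \<in> space (P n).
        \<bar>\<bar>min_factor_weight H n (\<lambda>e. W n e \<omega>) - M n\<bar>\<bar> > C * \<bar>M n powr (3 / 4)\<bar>} < \<epsilon>" ..
  qed
  then show ?thesis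
    using d1 M_pos theta unfolding v_def a_def weight_exponent_def by blast
qed

end
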